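(* Assume Hypothesis H (stated in the context) and let $u_0\in H$. Then for every $h\in L^2([0,T],U)$ there exists at most one solution in the space $C([0,T],H)\cap L^2([0,T],H^1)$ to the equation $$du_h+\mathrm{div}(B(u_h))\,dt=\mathrm{div}(A(u_h)\nabla u_h)\,dt+\sigma(u_h)h(t)\,dt,\qquad u_h(0)=u_0,$$ on $\mathbb{T}^d\times[0,T]$.
   Context: Notation: $T>0$ is fixed, $\mathbb{T}^d=[0,1]^d$ is the $d$-dimensional torus (periodic boundary conditions), $H=L^2(\mathbb{T}^d)$ with inner product $\langle\cdot,\cdot\rangle$, $H^1=H^1(\mathbb{T}^d)$ is the usual Sobolev space. $C^1_{lip}$ denotes the Lipschitz functions that are continuously differentiable. $U$ is a separable Hilbert space with norm $|\cdot|_U$ and orthonormal basis $(\bar e_k)_{k\ge1}$. Hypothesis H: (i) $B=(B_1,\dots,B_d):\mathbb{R}\to\mathbb{R}^d$ is of class $C^1_{lip}$. (ii) $A=(A_{ij})_{i,j=1}^d:\mathbb{R}\to\mathbb{R}^{d\times d}$ is of class $C^1_{lip}$, uniformly positive definite and bounded, i.e. $\delta I\le A\le CI$ for constants $\delta,C>0$. (iii) For each $u\in H$, $\sigma(u):U\to H$ is defined by $\sigma(u)\bar e_k=\sigma_k(u(\cdot))$ with $\sigma_k:\mathbb{R}\to\mathbb{R}$ satisfying, for all $y,y_1,y_2\in\mathbb{R}$, $\sum_{k\ge1}|\sigma_k(y)|^2\le C(1+|y|^2)$ and $\sum_{k\ge1}|\sigma_k(y_1)-\sigma_k(y_2)|^2\le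 C|y_1-y_2|^2$. Solution: a function $u\in C([0,T],H)\cap L^2([0,T],H^1)$ such that for every $\phi\in C^\infty(\mathbb{T}^d)$ and $t\in[0,T]$, $$\langle u(t),\phi\rangle-\langle u_0,\phi\rangle-\int_0^t\langle B(u(s)),\nabla\phi\rangle ds=-\int_0^t\langle A(u(s))\nabla u(s),\nabla\phi\rangle ds+\int_0^t\langle\sigma(u(s))h(s),\phi\rangle ds.$$ *)

theory Defs
  imports "HOL-Analysis.Analysis"
begin

section \<open>Function spaces on the torus\<close>

text \<open>
  Elements of Lebesgue and Sobolev spaces are represented by functions, and equality in the space
  is equality almost everywhere.  Domains carry the (complete) Lebesgue measure.  For a codomain
  with countable basis, Borel and strong measurability coincide, so
  \<open>square_integrable M\<close> is then the usual space $L^2(M)$.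
\<close>

definition square_integrable :: "'a measure \<Rightarrow> ('a \<Rightarrow> 'b::real_normed_vector) set" where
  "square_integrable M = {f \<in> borel_measurable M. integrable M (\<lambda>x. (norm (f x))\<^sup>2)}"

definition L2_norm :: "'a measure \<Rightarrow> ('a \<Rightarrow> 'b::real_normed_vector) \<Rightarrow> real" where
  "L2_norm M f = sqrt (\<integral>x. (norm (f x))\<^sup>2 \<partial>M)"

text \<open>
  The measure space of the torus is the unit cube; the values of a representative outside
  the cube are irrelevant.  The periodic boundary conditions enter through the test functions,
  which are smooth functions on the whole space, periodic in each coordinate.
\<close>

definition torus :: "(real ^ 'd) measure" where
  "torus = lebesgue_on (cbox 0 1)"

definition partial :: "'d \<Rightarrow> (real ^ 'd \<Rightarrow> real) \<Rightarrow> real ^ 'd \<Rightarrow> real" where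
  "partial i f x = frechet_derivative f (at x) (axis i 1)"

definition grad :: "(real ^ 'd \<Rightarrow> real) \<Rightarrow> real ^ 'd \<Rightarrow> real ^ 'd" where
  "grad f x = (\<chi> i. partial i f x)"

fun C_diff :: "nat \<Rightarrow> (real ^ 'd \<Rightarrow> real) \<Rightarrow> bool" where
  "C_diff 0 f \<longleftrightarrow> continuous_on UNIV f"
| "C_diff (Suc n) f \<longleftrightarrow> (\<forall>x. f differentiable (at x)) \<and> (\<forall>i. C_diff n (partial i f))"

definition smooth_torus :: "(real ^ 'd \<Rightarrow> real) set" where
  "smooth_torus = {\<phi>. (\<forall>n. C_diff n \<phi>) \<and> (\<forall>x i. \<phi> (x + axis i 1) = \<phi> x)}"

definition is_weak_grad :: "(real ^ 'd \<Rightarrow> real) \<Rightarrow> (real ^ 'd \<Rightarrow> real ^ 'd) \<Rightarrow> bool" where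
  "is_weak_grad f G \<longleftrightarrow> G \<in> square_integrable torus \<and>
    (\<forall>\<phi>\<in>smooth_torus. \<forall>i. (\<integral>x. f x * partial i \<phi> x \<partial>torus) = - (\<integral>x. G x $ i * \<phi> x \<partial>torus))"

definition H1 :: "(real ^ 'd \<Rightarrow> real) set" where
  "H1 = {f \<in> square_integrable torus. \<exists>G. is_weak_grad f G}"

text \<open>A representative of the weak gradient, which is unique almost everywhere for \<open>f \<in> H1\<close>.\<close>

definition weak_grad :: "(real ^ 'd \<Rightarrow> real) \<Rightarrow> real ^ 'd \<Rightarrow> real ^ 'd" where
  "weak_grad f = (SOME G. is_weak_grad f G)"

definition H1_norm :: "(real ^ 'd \<Rightarrow> real) \<Rightarrow> real" where
  "H1_norm f = sqrt ((L2_norm torus f)\<^sup>2 + (L2_norm torus (weak_grad f))\<^sup>2)"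

definition C_H :: "real \<Rightarrow> (real \<Rightarrow> real ^ 'd \<Rightarrow> real) set" where
  "C_H T = {u. \<forall>t\<in>{0..T}. u t \<in> square_integrable torus \<and>
     ((\<lambda>s. L2_norm torus (\<lambda>x. u s x - u t x)) \<longlongrightarrow> 0) (at t within {0..T})}"

text \<open>
  The Bochner space $L^2([0,T],H^1)$: its elements are almost everywhere limits of \<open>H1\<close>-valued
  simple functions, with square integrable norm.
\<close>

definition L2_H1 :: "real \<Rightarrow> (real \<Rightarrow> real ^ 'd \<Rightarrow> real) set" where
  "L2_H1 T = {u. (AE t in lebesgue_on {0..T}. u t \<in> H1) \<and>
     (\<exists>g. (\<forall>n::nat. simple_function (lebesgue_on {0..T}) (g n) \<and> g n ` {0..T} \<subseteq> H1) \<and>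
       (AE t in lebesgue_on {0..T}. (\<lambda>n. H1_norm (\<lambda>x. u t x - g n t x)) \<longlonglongrightarrow> 0)) \<and>
     (\<lambda>t. H1_norm (u t)) \<in> square_integrable (lebesgue_on {0..T})}"

section \<open>The equation\<close>

text \<open>
  The basis $(\bar e_k)_{k\ge 1}$ and the coefficients $(\sigma_k)_{k\ge 1}$ are indexed from 0.
\<close>

definition orthonormal_basis :: "(nat \<Rightarrow> 'u::real_inner) \<Rightarrow> bool" where
  "orthonormal_basis e \<longleftrightarrow>
     (\<forall>j k. e j \<bullet> e k = (if j = k then 1 else 0)) \<and> closure (span (range e)) = UNIV"

definition C1_lip :: "(real \<Rightarrow> 'b::real_normed_vector) \<Rightarrow> bool" where
  "C1_lip f \<longleftrightarrow> f C1_differentiable_on UNIV \<and> (\<exists>L. L-lipschitz_on UNIV f)"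

text \<open>
  The matrices \<open>A y\<close> are not required to be symmetric: the bounds \<open>\<delta> I \<le> A y \<le> C I\<close> are those of
  the quadratic forms.  Boundedness of \<open>A\<close> follows from them in the symmetric case.
\<close>

definition hypothesis_H ::
  "(real \<Rightarrow> real ^ 'd) \<Rightarrow> (real \<Rightarrow> real ^ 'd ^ 'd) \<Rightarrow> (nat \<Rightarrow> real \<Rightarrow> real) \<Rightarrow> bool" where
  "hypothesis_H B A \<sigma> \<longleftrightarrow>
     C1_lip B \<and>
     C1_lip A \<and> bounded (range A) \<and>
     (\<exists>\<delta>>0. \<exists>C>0. \<forall>y \<xi>. \<delta> * (\<xi> \<bullet> \<xi>) \<le> \<xi> \<bullet> (A y *v \<xi>) \<and> \<xi> \<bullet> (A y *v \<xi>) \<le> C * (\<xi> \<bullet> \<xi>)) \<and>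
     (\<exists>C.
       (\<forall>y. summable (\<lambda>k. \<bar>\<sigma> k y\<bar>\<^sup>2) \<and> (\<Sum>k. \<bar>\<sigma> k y\<bar>\<^sup>2) \<le> C * (1 + \<bar>y\<bar>\<^sup>2)) \<and>
       (\<forall>y\<^sub>1 y\<^sub>2. summable (\<lambda>k. \<bar>\<sigma> k y\<^sub>1 - \<sigma> k y\<^sub>2\<bar>\<^sup>2) \<and>
          (\<Sum>k. \<bar>\<sigma> k y\<^sub>1 - \<sigma> k y\<^sub>2\<bar>\<^sup>2) \<le> C * \<bar>y\<^sub>1 - y\<^sub>2\<bar>\<^sup>2))"

text \<open>
  The operator $\sigma(u) : U \to H$ with $\sigma(u) \bar e_k = \sigma_k(u(\cdot))$, extended
  linearly and continuously: $\sigma(u) h = \sum_k \langle h, \bar e_k\rangle \sigma_k(u(\cdot))$.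
  The series converges absolutely at every point; the lemmas below show that \<open>sigma_op\<close> is indeed
  linear, bounded from $U$ to $H$, and takes the prescribed values on the basis.
\<close>

definition sigma_op ::
  "(nat \<Rightarrow> 'u::real_inner) \<Rightarrow> (nat \<Rightarrow> real \<Rightarrow> real) \<Rightarrow> ('x \<Rightarrow> real) \<Rightarrow> 'u \<Rightarrow> 'x \<Rightarrow> real" where
  "sigma_op e \<sigma> u h x = (\<Sum>k. (h \<bullet> e k) * \<sigma> k (u x))"

definition is_solution ::
  "(real \<Rightarrow> real ^ 'd) \<Rightarrow> (real \<Rightarrow> real ^ 'd ^ 'd) \<Rightarrow> (nat \<Rightarrow> real \<Rightarrow> real) \<Rightarrow> (nat \<Rightarrow> 'u::real_inner)
    \<Rightarrow> real \<Rightarrow> (real ^ 'd \<Rightarrow> real) \<Rightarrow> (real \<Rightarrow> 'u) \<Rightarrow> (real \<Rightarrow> real ^ 'd \<Rightarrow> real) \<Rightarrow> bool" where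
  "is_solution B A \<sigma> e T u0 h u \<longleftrightarrow> u \<in> C_H T \<inter> L2_H1 T \<and>
     (\<forall>\<phi>\<in>smooth_torus. \<forall>t\<in>{0..T}.
        (\<integral>x. u t x * \<phi> x \<partial>torus) - (\<integral>x. u0 x * \<phi> x \<partial>torus)
          - (\<integral>s. (\<integral>x. B (u s x) \<bullet> grad \<phi> x \<partial>torus) \<partial>lebesgue_on {0..t})
        = - (\<integral>s. (\<integral>x. (A (u s x) *v weak_grad (u s) x) \<bullet> grad \<phi> x \<partial>torus) \<partial>lebesgue_on {0..t})
          + (\<integral>s. (\<integral>x. sigma_op e \<sigma> (u s) (h s) x * \<phi> x \<partial>torus) \<partial>lebesgue_on {0..t}))"

section \<open>Properties of the noise operator\<close>

lemma bessel_partial: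
  fixes e :: "nat \<Rightarrow> 'u::real_inner"
  assumes "\<And>j k. e j \<bullet> e k = (if j = k then 1 else 0)"
  shows "(\<Sum>k<n. (h \<bullet> e k)\<^sup>2) \<le> (norm h)\<^sup>2"
proof -
  let ?p = "\<Sum>k<n. (h \<bullet> e k) *\<^sub>R e k"
  have hp: "h \<bullet> ?p = (\<Sum>k<n. (h \<bullet> e k)\<^sup>2)"
    by (simp add: inner_sum_right power2_eq_square)
  have ep: "e k \<bullet> ?p = (h \<bullet> e k)" if "k < n" for k
    using that by (simp add: inner_sum_right assms if_distrib[of "\<lambda>c. _ * c"] cong: if_cong)
  have "?p \<bullet> ?p = (\<Sum>k<n. (h \<bullet> e k) * (e k \<bullet> ?p))"
    by (simp add: inner_sum_left)
  also have "\<dots> = (\<Sum>k<n. (h \<bullet> e k)\<^sup>2)"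
    by (intro sum.cong) (simp_all only: lessThan_iff ep power2_eq_square)
  finally have pp: "?p \<bullet> ?p = (\<Sum>k<n. (h \<bullet> e k)\<^sup>2)" .
  have "0 \<le> (h - ?p) \<bullet> (h - ?p)" by simp
  also have "\<dots> = h \<bullet> h - 2 * (h \<bullet> ?p) + ?p \<bullet> ?p"
    by (simp only: inner_diff_left inner_diff_right inner_commute[of ?p h])
  finally show ?thesis unfolding hp pp by (simp add: power2_norm_eq_inner)
qed

lemma bessel:
  fixes e :: "nat \<Rightarrow> 'u::real_inner"
  assumes "orthonormal_basis e"
  shows "summable (\<lambda>k. (h \<bullet> e k)\<^sup>2)" "(\<Sum>k. (h \<bullet> e k)\<^sup>2) \<le> (norm h)\<^sup>2"
proof -
  have b: "(\<Sum>k<n. (h \<bullet> e k)\<^sup>2) \<le> (norm h)\<^sup>2" for n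
    using assms by (intro bessel_partial) (simp add: orthonormal_basis_def)
  show s: "summable (\<lambda>k. (h \<bullet> e k)\<^sup>2)"
    using b by (intro summableI_nonneg_bounded) auto
  show "(\<Sum>k. (h \<bullet> e k)\<^sup>2) \<le> (norm h)\<^sup>2"
    using b by (intro suminf_le_const s)
qed

lemma abs_summable_mult_square_summable:
  fixes a b :: "nat \<Rightarrow> real"
  assumes "summable (\<lambda>k. (a k)\<^sup>2)" "summable (\<lambda>k. (b k)\<^sup>2)"
  shows "summable (\<lambda>k. \<bar>a k * b k\<bar>)"
proof (rule summable_comparison_test)
  have "\<bar>a k * b k\<bar> \<le> (a k)\<^sup>2 + (b k)\<^sup>2" for k
  proof -
    have "0 \<le> (\<bar>a k\<bar> - \<bar>b k\<bar>)\<^sup>2" by simp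
    then have "2 * (\<bar>a k\<bar> * \<bar>b k\<bar>) \<le> (a k)\<^sup>2 + (b k)\<^sup>2"
      by (simp add: power2_diff)
    moreover have "0 \<le> \<bar>a k\<bar> * \<bar>b k\<bar>" by simp
    ultimately show ?thesis unfolding abs_mult by linarith
  qed
  then show "\<exists>N. \<forall>k\<ge>N. norm \<bar>a k * b k\<bar> \<le> (a k)\<^sup>2 + (b k)\<^sup>2" by auto
  show "summable (\<lambda>k. (a k)\<^sup>2 + (b k)\<^sup>2)" by (intro summable_add assms)
qed

lemma suminf_mult_square_le:
  fixes a b :: "nat \<Rightarrow> real"
  assumes a: "summable (\<lambda>k. (a k)\<^sup>2)" and b: "summable (\<lambda>k. (b k)\<^sup>2)"
  shows "(\<Sum>k. a k * b k)\<^sup>2 \<le> (\<Sum>k. (a k)\<^sup>2) * (\<Sum>k. (b k)\<^sup>2)"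
proof (rule LIMSEQ_le_const2)
  have "summable (\<lambda>k. a k * b k)"
    using abs_summable_mult_square_summable[OF a b] by (rule summable_rabs_cancel)
  then show "(\<lambda>n. (\<Sum>k<n. a k * b k)\<^sup>2) \<longlonglongrightarrow> (\<Sum>k. a k * b k)\<^sup>2"
    by (intro tendsto_power summable_LIMSEQ)
  have "(\<Sum>k<n. a k * b k)\<^sup>2 \<le> (\<Sum>k. (a k)\<^sup>2) * (\<Sum>k. (b k)\<^sup>2)" for n
  proof -
    have "(\<Sum>k<n. a k * b k)\<^sup>2 \<le> (\<Sum>k<n. (a k)\<^sup>2) * (\<Sum>k<n. (b k)\<^sup>2)"
      by (rule Cauchy_Schwarz_ineq_sum)
    also have "\<dots> \<le> (\<Sum>k. (a k)\<^sup>2) * (\<Sum>k. (b k)\<^sup>2)"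
      by (intro mult_mono sum_le_suminf a b suminf_nonneg sum_nonneg) auto
    finally show ?thesis .
  qed
  then show "\<exists>N. \<forall>n\<ge>N. (\<Sum>k<n. a k * b k)\<^sup>2 \<le> (\<Sum>k. (a k)\<^sup>2) * (\<Sum>k. (b k)\<^sup>2)"
    by blast
qed

lemma sigma_op_abs_summable:
  assumes "orthonormal_basis e" "hypothesis_H B A \<sigma>"
  shows "summable (\<lambda>k. \<bar>(h \<bullet> e k) * \<sigma> k y\<bar>)"
  using assms by (intro abs_summable_mult_square_summable bessel) (auto simp: hypothesis_H_def)

lemma sigma_op_basis:
  assumes "orthonormal_basis e"
  shows "sigma_op e \<sigma> u (e k) x = \<sigma> k (u x)"
proof -
  have "sigma_op e \<sigma> u (e k) x = (\<Sum>j. if j = k then \<sigma> j (u x) else 0)"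
    unfolding sigma_op_def using assms
    by (intro suminf_cong) (auto simp: orthonormal_basis_def)
  also have "\<dots> = \<sigma> k (u x)"
    using sums_If_finite_set[of "{k}" "\<lambda>j. \<sigma> j (u x)"] by (simp add: sums_iff)
  finally show ?thesis .
qed

lemma sigma_op_linear:
  assumes "orthonormal_basis e" "hypothesis_H B A \<sigma>"
  shows "linear (\<lambda>h. sigma_op e \<sigma> u h x)"
proof (rule linearI)
  have s: "summable (\<lambda>k. (h \<bullet> e k) * \<sigma> k (u x))" for h
    using sigma_op_abs_summable[OF assms] by (rule summable_rabs_cancel)
  show "sigma_op e \<sigma> u (h + h') x = sigma_op e \<sigma> u h x + sigma_op e \<sigma> u h' x" for h h'
    unfolding sigma_op_def by (simp add: suminf_add[OF s s] inner_add_left distrib_right)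
  show "sigma_op e \<sigma> u (c *\<^sub>R h) x = c *\<^sub>R sigma_op e \<sigma> u h x" for c h
    unfolding sigma_op_def by (simp add: suminf_mult[OF s, symmetric] mult.assoc)
qed

lemma finite_measure_torus: "finite_measure torus"
  unfolding torus_def
  by (rule finite_measure_lebesgue_on) (rule lmeasurable_cbox)

lemma sigma_op_bounded:
  fixes e :: "nat \<Rightarrow> 'u::real_inner" and B :: "real \<Rightarrow> real ^ 'd"
  assumes e: "orthonormal_basis e" and H: "hypothesis_H B A \<sigma>"
    and u: "(u :: real ^ 'd \<Rightarrow> real) \<in> square_integrable torus"
  shows "\<exists>K. \<forall>h. sigma_op e \<sigma> u h \<in> square_integrable torus \<and>
           L2_norm torus (sigma_op e \<sigma> u h) \<le> K * norm h"
proof -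
  obtain C where
    C1: "\<And>y. summable (\<lambda>k. (\<sigma> k y)\<^sup>2)" "\<And>y. (\<Sum>k. (\<sigma> k y)\<^sup>2) \<le> C * (1 + y\<^sup>2)" and
    C2: "\<And>y z. summable (\<lambda>k. (\<sigma> k y - \<sigma> k z)\<^sup>2)"
        "\<And>y z. (\<Sum>k. (\<sigma> k y - \<sigma> k z)\<^sup>2) \<le> C * (y - z)\<^sup>2"
    using H unfolding hypothesis_H_def power2_abs by blast
  interpret finite_measure "torus :: (real ^ 'd) measure" by (rule finite_measure_torus)
  have "0 \<le> (\<Sum>k. (\<sigma> k 0)\<^sup>2)" by (intro suminf_nonneg C1) auto
  with C1(2)[of 0] have C0: "0 \<le> C" by simp
  have cont: "continuous_on UNIV (\<sigma> k)" for k
  proof (rule lipschitz_on_continuous_on[of "sqrt C"], rule lipschitz_onI)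
    fix y z
    have "(\<sigma> k y - \<sigma> k z)\<^sup>2 \<le> (\<Sum>k. (\<sigma> k y - \<sigma> k z)\<^sup>2)"
      using sum_le_suminf[OF C2(1), of "{k}" y z] by simp
    also note C2(2)
    finally have "sqrt ((\<sigma> k y - \<sigma> k z)\<^sup>2) \<le> sqrt (C * (y - z)\<^sup>2)" by (rule real_sqrt_le_mono)
    then show "dist (\<sigma> k y) (\<sigma> k z) \<le> sqrt C * dist y z"
      by (simp add: dist_real_def real_sqrt_mult)
  qed (use C0 in simp)
  have um: "u \<in> borel_measurable torus" and ui: "integrable torus (\<lambda>x. (u x)\<^sup>2)"
    using u by (auto simp: square_integrable_def)
  have meas: "sigma_op e \<sigma> u h \<in> borel_measurable torus" for h
    unfolding sigma_op_def[abs_def]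
    by (intro borel_measurable_suminf borel_measurable_times borel_measurable_const
        borel_measurable_continuous_on[OF cont um])
  have bd: "(sigma_op e \<sigma> u h x)\<^sup>2 \<le> (norm h)\<^sup>2 * (C * (1 + (u x)\<^sup>2))" for h x
  proof -
    have "(sigma_op e \<sigma> u h x)\<^sup>2 \<le> (\<Sum>k. (h \<bullet> e k)\<^sup>2) * (\<Sum>k. (\<sigma> k (u x))\<^sup>2)"
      unfolding sigma_op_def by (intro suminf_mult_square_le bessel e C1)
    also have "\<dots> \<le> (norm h)\<^sup>2 * (C * (1 + (u x)\<^sup>2))"
      by (intro mult_mono bessel e C1 suminf_nonneg) auto
    finally show ?thesis .
  qed
  have ib: "integrable torus (\<lambda>x. C * (1 + (u x)\<^sup>2))" using ui by simp
  then have ib': "integrable torus (\<lambda>x. (norm h)\<^sup>2 * (C * (1 + (u x)\<^sup>2)))" for h :: 'u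
    by simp
  have int: "integrable torus (\<lambda>x. (sigma_op e \<sigma> u h x)\<^sup>2)" for h
    by (rule Bochner_Integration.integrable_bound[OF ib'[of h]])
      (use meas bd C0 in \<open>auto intro!: AE_I2 borel_measurable_power\<close>)
  let ?K = "sqrt (\<integral>x. C * (1 + (u x)\<^sup>2) \<partial>torus)"
  have "L2_norm torus (sigma_op e \<sigma> u h) \<le> ?K * norm h" for h
  proof -
    have "(\<integral>x. (sigma_op e \<sigma> u h x)\<^sup>2 \<partial>torus) \<le> (\<integral>x. (norm h)\<^sup>2 * (C * (1 + (u x)\<^sup>2)) \<partial>torus)"
      by (intro integral_mono int ib' bd)
    also have "\<dots> = (norm h)\<^sup>2 * (\<integral>x. C * (1 + (u x)\<^sup>2) \<partial>torus)" by (rule integral_mult_right_zero)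
    finally have "sqrt (\<integral>x. (sigma_op e \<sigma> u h x)\<^sup>2 \<partial>torus)
        \<le> sqrt ((norm h)\<^sup>2 * (\<integral>x. C * (1 + (u x)\<^sup>2) \<partial>torus))" by (rule real_sqrt_le_mono)
    then show ?thesis by (simp only: L2_norm_def real_norm_def power2_abs real_sqrt_mult
          real_sqrt_abs abs_norm_cancel mult.commute)
  qed
  moreover have "sigma_op e \<sigma> u h \<in> square_integrable torus" for h
    using meas int by (simp add: square_integrable_def)
  ultimately show ?thesis by blast
qed

end

theory Submission
  imports Defs
begin

text \<open>
  Why uniqueness holds. Let \<open>u\<close>, \<open>v\<close> be two solutions and \<open>w = u - v\<close>. The equation controls the
  \<open>L\<^sup>1\<close> norm of \<open>w\<close>: take \<open>\<phi> r = sqrt (r\<^sup>2 + \<epsilon>\<^sup>2)\<close> as a smooth convex substitute for \<open>\<bar>r\<bar>\<close> and test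
  the equation for \<open>w\<close> with \<open>\<phi>' w\<close>. The divergence terms give
  \<open>\<integral> \<phi>'' w (flux u - flux v) \<bullet> (\<nabla>u - \<nabla>v)\<close> with \<open>flux u = B u - A u \<nabla>u\<close>. Writing
  \<open>A u \<nabla>u - A v \<nabla>v = A u (\<nabla>u - \<nabla>v) + (A u - A v) \<nabla>v\<close>, ellipticity and the Lipschitz
  bounds estimate the inner product by a multiple of \<open>w\<^sup>2 (1 + \<bar>\<nabla>v\<bar>\<^sup>2)\<close> (\<open>flux_diff_inner_le\<close>), and
  \<open>w\<^sup>2 \<phi>'' w \<le> \<epsilon>\<close> (\<open>square_mult_sabs''_le\<close>), so this contribution disappears as \<open>\<epsilon> \<rightarrow> 0\<close>. An
  estimate of the \<open>L\<^sup>2\<close> norm would instead leave the uncontrolled product \<open>w\<^sup>2 \<bar>\<nabla>v\<bar>\<^sup>2\<close>. The noise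
  contributes at most \<open>sqrt C \<bar>h t\<bar> \<integral>\<bar>w\<bar>\<close>, and Gronwall's lemma with the integrable coefficient
  \<open>sqrt C \<bar>h\<bar>\<close> gives \<open>w = 0\<close>.

  The function \<open>\<phi>' w\<close> is not an admissible test function, and the chain rule in time has to be
  justified. Both difficulties are met by projecting \<open>w\<close> onto finitely many Fourier modes. The
  projected function \<open>trig_proj N w\<close> depends on time only through finitely many coefficients, each of
  which is an integral over time of an integrable function, by the equation tested with a single mode
  (\<open>solution_mode_equation\<close>); for such functions the chain rule inequality
  \<open>subgradient_chain_rule\<close> is elementary and yields \<open>energy_inequality\<close>. In space,
  \<open>trig_proj N w\<close> is smooth, the projections are symmetric contractions that commute with
  differentiation, and they converge strongly to the identity (\<open>trig_proj_tendsto\<close>). Hence at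
  almost every time the energy balance of the projected difference converges to the formal one
  (\<open>J_limit\<close>) and is dominated uniformly in \<open>N\<close> (\<open>abs_J_le\<close>); dominated convergence in time then
  gives \<open>L1_diff_integral_inequality\<close>.

  Two facts are prepared for this: completeness of the Fourier modes in \<open>L\<^sup>2\<close> of the torus, through
  the Stone-Weierstrass theorem on the torus embedded as a product of circles; and measurability in
  time of the three terms of the equation, which for the second order term rests on the strong
  measurability of \<open>u\<close> with values in \<open>H\<^sup>1\<close>.
\<close>

section \<open>Square integrable functions\<close>

lemma square_integrableD:
  assumes "f \<in> square_integrable M"
  shows "f \<in> borel_measurable M" "integrable M (\<lambda>x. (norm (f x))\<^sup>2)"
  using assms by (auto simp: square_integrable_def)

lemma square_integrable_realD:
  fixes f :: "'a \<Rightarrow> real"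
  assumes "f \<in> square_integrable M"
  shows "integrable M (\<lambda>x. (f x)\<^sup>2)"
  using square_integrableD(2)[OF assms] by simp

lemma square_integrable_bound:
  assumes f: "f \<in> square_integrable M" and g: "g \<in> borel_measurable M"
    and le: "AE x in M. norm (g x) \<le> norm (f x)"
  shows "g \<in> square_integrable M"
proof -
  have "integrable M (\<lambda>x. (norm (g x))\<^sup>2)"
    by (rule Bochner_Integration.integrable_bound[OF square_integrableD(2)[OF f]])
      (use g le in \<open>auto elim!: eventually_mono intro: power_mono\<close>)
  with g show ?thesis by (simp add: square_integrable_def)
qed

lemma square_integrable_add:
  fixes f g :: "'a \<Rightarrow> 'b::{second_countable_topology, real_normed_vector}"
  assumes f: "f \<in> square_integrable M" and g: "g \<in> square_integrable M"
  shows "(\<lambda>x. f x + g x) \<in> square_integrable M"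
proof -
  note [measurable] = square_integrableD(1)[OF f] square_integrableD(1)[OF g]
  have le: "(norm (f x + g x))\<^sup>2 \<le> 2 * (norm (f x))\<^sup>2 + 2 * (norm (g x))\<^sup>2" for x
  proof -
    have "(norm (f x + g x))\<^sup>2 \<le> (norm (f x) + norm (g x))\<^sup>2"
      by (intro power_mono norm_triangle_ineq norm_ge_zero)
    also have "\<dots> \<le> 2 * (norm (f x))\<^sup>2 + 2 * (norm (g x))\<^sup>2"
      using sum_squares_bound[of "norm (f x)" "norm (g x)"] by (simp add: power2_sum)
    finally show ?thesis .
  qed
  have "integrable M (\<lambda>x. 2 * (norm (f x))\<^sup>2 + 2 * (norm (g x))\<^sup>2)"
    using square_integrableD(2)[OF f] square_integrableD(2)[OF g] by simp
  then have "integrable M (\<lambda>x. (norm (f x + g x))\<^sup>2)"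
    by (rule Bochner_Integration.integrable_bound) (use le in \<open>auto intro: order_trans\<close>)
  then show ?thesis by (simp add: square_integrable_def)
qed

lemma square_integrable_cmult:
  fixes f :: "'a \<Rightarrow> 'b::{second_countable_topology, real_normed_vector}"
  assumes f: "f \<in> square_integrable M"
  shows "(\<lambda>x. c *\<^sub>R f x) \<in> square_integrable M"
proof -
  note [measurable] = square_integrableD(1)[OF f]
  show ?thesis
    using square_integrableD(2)[OF f] by (simp add: square_integrable_def power_mult_distrib)
qed

lemma square_integrable_diff:
  fixes f g :: "'a \<Rightarrow> 'b::{second_countable_topology, real_normed_vector}"
  assumes f: "f \<in> square_integrable M" and g: "g \<in> square_integrable M"
  shows "(\<lambda>x. f x - g x) \<in> square_integrable M"
  using square_integrable_add[OF f square_integrable_cmult[OF g, of "-1"]] by simp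

lemma square_integrable_norm:
  assumes "f \<in> square_integrable M"
  shows "(\<lambda>x. norm (f x)) \<in> square_integrable M"
  using assms by (auto simp: square_integrable_def)

lemma square_integrable_component:
  fixes F :: "'a \<Rightarrow> real ^ 'n"
  assumes "F \<in> square_integrable M"
  shows "(\<lambda>x. F x $ i) \<in> square_integrable M"
proof (rule square_integrable_bound[OF assms])
  show "(\<lambda>x. F x $ i) \<in> borel_measurable M"
    using square_integrableD(1)[OF assms]
    by (intro borel_measurable_continuous_on[where f = "\<lambda>v. v $ i"]) (auto intro: continuous_intros)
qed (use component_le_norm_cart in auto)

lemma integrable_mult_square_integrable:
  fixes f g :: "'a \<Rightarrow> real"
  assumes f: "f \<in> square_integrable M" and g: "g \<in> square_integrable M"
  shows "integrable M (\<lambda>x. f x * g x)"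
proof (rule Bochner_Integration.integrable_bound)
  show "integrable M (\<lambda>x. (f x)\<^sup>2 + (g x)\<^sup>2)"
    using square_integrable_realD[OF f] square_integrable_realD[OF g] by simp
  show "(\<lambda>x. f x * g x) \<in> borel_measurable M"
    using square_integrableD(1)[OF f] square_integrableD(1)[OF g] by simp
  have "\<bar>f x * g x\<bar> \<le> (f x)\<^sup>2 + (g x)\<^sup>2" for x
  proof -
    have "\<bar>f x * g x\<bar> \<le> 2 * (\<bar>f x\<bar> * \<bar>g x\<bar>)" by (simp add: abs_mult)
    also have "\<dots> \<le> (f x)\<^sup>2 + (g x)\<^sup>2"
      using sum_squares_bound[of "\<bar>f x\<bar>" "\<bar>g x\<bar>"] by simp
    finally show ?thesis .
  qed
  then show "AE x in M. norm (f x * g x) \<le> norm ((f x)\<^sup>2 + (g x)\<^sup>2)"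
    by simp
qed

lemma integrable_if_square_integrable:
  fixes f :: "'a \<Rightarrow> real"
  assumes "finite_measure M" "f \<in> square_integrable M"
  shows "integrable M f"
proof -
  interpret finite_measure M by fact
  have "(\<lambda>_. 1) \<in> square_integrable M" by (simp add: square_integrable_def)
  from integrable_mult_square_integrable[OF assms(2) this] show ?thesis by simp
qed

lemma L2_norm_nonneg [simp]: "0 \<le> L2_norm M f"
  by (simp add: L2_norm_def)

lemma L2_norm_power2: "(L2_norm M f)\<^sup>2 = (\<integral>x. (norm (f x))\<^sup>2 \<partial>M)"
  by (simp add: L2_norm_def)

lemma L2_norm_mono:
  assumes "f \<in> square_integrable M" "g \<in> borel_measurable M"
    "AE x in M. norm (g x) \<le> norm (f x)"
  shows "L2_norm M g \<le> L2_norm M f"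
  unfolding L2_norm_def
proof (intro real_sqrt_le_mono integral_mono_AE)
  show "integrable M (\<lambda>x. (norm (g x))\<^sup>2)" "integrable M (\<lambda>x. (norm (f x))\<^sup>2)"
    using square_integrableD(2)[OF square_integrable_bound[OF assms]]
      square_integrableD(2)[OF assms(1)] .
  show "AE x in M. (norm (g x))\<^sup>2 \<le> (norm (f x))\<^sup>2"
    using assms(3) by (auto elim!: eventually_mono intro: power_mono)
qed

lemma L2_norm_eq_0_AE:
  assumes "f \<in> square_integrable M" "L2_norm M f = 0"
  shows "AE x in M. f x = 0"
proof -
  have "(\<integral>x. (norm (f x))\<^sup>2 \<partial>M) = 0"
    using assms(2) by (simp add: L2_norm_def)
  then show ?thesis
    using integral_nonneg_eq_0_iff_AE[OF square_integrableD(2)[OF assms(1)]] by simp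
qed

lemma L2_norm_cong_AE:
  assumes "f \<in> borel_measurable M" "g \<in> borel_measurable M" "AE x in M. f x = g x"
  shows "L2_norm M f = L2_norm M g"
proof -
  have "(\<integral>x. (norm (f x))\<^sup>2 \<partial>M) = (\<integral>x. (norm (g x))\<^sup>2 \<partial>M)"
    by (rule integral_cong_AE) (use assms in \<open>auto elim!: eventually_mono\<close>)
  then show ?thesis by (simp add: L2_norm_def)
qed

lemma L2_norm_norm [simp]: "L2_norm M (\<lambda>x. norm (f x)) = L2_norm M f"
  by (simp add: L2_norm_def)

lemma L2_norm_abs [simp]: "L2_norm M (\<lambda>x. \<bar>f x :: real\<bar>) = L2_norm M f"
  by (simp add: L2_norm_def)

lemma L2_norm_cmult: "L2_norm M (\<lambda>x. c *\<^sub>R f x) = \<bar>c\<bar> * L2_norm M f"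
  by (simp add: L2_norm_def power_mult_distrib real_sqrt_mult)

lemma square_integrable_scaled_bound:
  fixes f :: "'a \<Rightarrow> 'b::{second_countable_topology, real_normed_vector}"
  assumes f: "f \<in> square_integrable M" and g: "g \<in> borel_measurable M"
    and c: "0 \<le> c" and le: "\<And>x. norm (g x) \<le> c * norm (f x)"
  shows "g \<in> square_integrable M" "L2_norm M g \<le> c * L2_norm M f"
proof -
  have le': "AE x in M. norm (g x) \<le> norm (c *\<^sub>R f x)"
    using le c by simp
  show "g \<in> square_integrable M"
    by (rule square_integrable_bound[OF square_integrable_cmult[OF f] g le'])
  have "L2_norm M g \<le> L2_norm M (\<lambda>x. c *\<^sub>R f x)"
    by (rule L2_norm_mono[OF square_integrable_cmult[OF f] g le'])
  then show "L2_norm M g \<le> c * L2_norm M f"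
    using c by (simp add: L2_norm_cmult)
qed

lemma bounded_times_square_integrable:
  fixes f g :: "'a \<Rightarrow> real"
  assumes f: "f \<in> square_integrable M" and g: "g \<in> borel_measurable M"
    and le: "\<And>x. \<bar>g x\<bar> \<le> c"
  shows "(\<lambda>x. g x * f x) \<in> square_integrable M" "L2_norm M (\<lambda>x. g x * f x) \<le> c * L2_norm M f"
proof -
  have m: "(\<lambda>x. g x * f x) \<in> borel_measurable M"
    by (rule borel_measurable_times[OF g square_integrableD(1)[OF f]])
  have c: "0 \<le> c" using le[of undefined] abs_ge_zero[of "g undefined"] by linarith
  have "norm (g x * f x) \<le> c * norm (f x)" for x
    using mult_right_mono[OF le[of x] abs_ge_zero[of "f x"]] by (simp add: abs_mult)
  from square_integrable_scaled_bound[OF f m c this]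
  show "(\<lambda>x. g x * f x) \<in> square_integrable M" "L2_norm M (\<lambda>x. g x * f x) \<le> c * L2_norm M f" .
qed

lemma square_integrable_bounded:
  fixes g :: "'a \<Rightarrow> real"
  assumes "finite_measure M" "g \<in> borel_measurable M" "\<And>x. \<bar>g x\<bar> \<le> c"
  shows "g \<in> square_integrable M"
proof -
  interpret finite_measure M by fact
  have "(\<lambda>_. 1) \<in> square_integrable M"
    by (simp add: square_integrable_def)
  from bounded_times_square_integrable(1)[OF this assms(2,3)] show ?thesis by simp
qed

lemma L2_norm_minus_commute: "L2_norm M (\<lambda>x. f x - g x) = L2_norm M (\<lambda>x. g x - f x)"
  by (simp add: L2_norm_def norm_minus_commute)

lemma integral_mult_le_L2_norm:
  fixes f g :: "'a \<Rightarrow> real"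
  assumes f: "f \<in> square_integrable M" and g: "g \<in> square_integrable M"
  shows "\<bar>\<integral>x. f x * g x \<partial>M\<bar> \<le> L2_norm M f * L2_norm M g"
proof -
  define a b c where "a = (\<integral>x. (f x)\<^sup>2 \<partial>M)" and "b = (\<integral>x. f x * g x \<partial>M)"
    and "c = (\<integral>x. (g x)\<^sup>2 \<partial>M)"
  have q: "0 \<le> a + 2 * t * b + t\<^sup>2 * c" for t
  proof -
    have "0 \<le> (\<integral>x. (f x + t * g x)\<^sup>2 \<partial>M)" by simp
    also have "\<dots> = (\<integral>x. (f x)\<^sup>2 + (2 * t) * (f x * g x) + t\<^sup>2 * (g x)\<^sup>2 \<partial>M)"
      by (intro Bochner_Integration.integral_cong refl) (simp add: power2_sum power_mult_distrib algebra_simps)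
    also have "\<dots> = a + 2 * t * b + t\<^sup>2 * c"
      using square_integrable_realD[OF f] square_integrable_realD[OF g]
        integrable_mult_square_integrable[OF f g]
      by (simp add: a_def b_def c_def)
    finally show ?thesis .
  qed
  have "b\<^sup>2 \<le> a * c"
  proof (cases "c = 0")
    case True
    have "b = 0"
    proof (rule ccontr)
      assume "b \<noteq> 0"
      with q[of "- (a + 1) / (2 * b)"] True show False by (simp add: field_simps)
    qed
    with True show ?thesis by simp
  next
    case False
    moreover have "0 \<le> c" by (simp add: c_def)
    ultimately have c: "0 < c" by simp
    have "a + 2 * (- b / c) * b + (- b / c)\<^sup>2 * c = a - b\<^sup>2 / c"
      using c by (simp add: field_simps power2_eq_square)
    with q[of "- b / c"] have "b\<^sup>2 / c \<le> a" by simp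
    with c show ?thesis by (simp add: field_simps)
  qed
  then have "sqrt (b\<^sup>2) \<le> sqrt (a * c)" by (rule real_sqrt_le_mono)
  then show ?thesis
    by (simp add: L2_norm_def a_def b_def c_def real_sqrt_mult)
qed

lemma integral_abs_mult_le_L2_norm:
  fixes f g :: "'a \<Rightarrow> real"
  assumes f: "f \<in> square_integrable M" and g: "g \<in> square_integrable M"
  shows "(\<integral>x. \<bar>f x * g x\<bar> \<partial>M) \<le> L2_norm M f * L2_norm M g"
  using integral_mult_le_L2_norm[OF square_integrable_norm[OF f] square_integrable_norm[OF g]]
  by (simp add: abs_mult)

lemma L2_norm_triangle:
  fixes f g :: "'a \<Rightarrow> 'b::{second_countable_topology, real_normed_vector}"
  assumes f: "f \<in> square_integrable M" and g: "g \<in> square_integrable M"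
  shows "L2_norm M (\<lambda>x. f x + g x) \<le> L2_norm M f + L2_norm M g"
proof (rule power2_le_imp_le)
  note nf = square_integrable_norm[OF f] and ng = square_integrable_norm[OF g]
  have "(L2_norm M (\<lambda>x. f x + g x))\<^sup>2 = (\<integral>x. (norm (f x + g x))\<^sup>2 \<partial>M)"
    by (rule L2_norm_power2)
  also have "\<dots> \<le> (\<integral>x. (norm (f x))\<^sup>2 + 2 * (norm (f x) * norm (g x)) + (norm (g x))\<^sup>2 \<partial>M)"
  proof (rule integral_mono)
    show "integrable M (\<lambda>x. (norm (f x + g x))\<^sup>2)"
      by (rule square_integrableD(2)[OF square_integrable_add[OF f g]])
    show "integrable M (\<lambda>x. (norm (f x))\<^sup>2 + 2 * (norm (f x) * norm (g x)) + (norm (g x))\<^sup>2)"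
      using square_integrableD(2)[OF f] square_integrableD(2)[OF g]
        integrable_mult_square_integrable[OF nf ng] by simp
    show "(norm (f x + g x))\<^sup>2 \<le> (norm (f x))\<^sup>2 + 2 * (norm (f x) * norm (g x)) + (norm (g x))\<^sup>2" for x
      using power_mono[OF norm_triangle_ineq norm_ge_zero, of "f x" "g x" 2]
      by (simp add: power2_sum)
  qed
  also have "\<dots> = (L2_norm M f)\<^sup>2 + 2 * (\<integral>x. norm (f x) * norm (g x) \<partial>M) + (L2_norm M g)\<^sup>2"
    using square_integrableD(2)[OF f] square_integrableD(2)[OF g]
      integrable_mult_square_integrable[OF nf ng]
    by (simp add: L2_norm_power2)
  also have "\<dots> \<le> (L2_norm M f)\<^sup>2 + 2 * (L2_norm M f * L2_norm M g) + (L2_norm M g)\<^sup>2"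
    using integral_mult_le_L2_norm[OF nf ng] by simp
  also have "\<dots> = (L2_norm M f + L2_norm M g)\<^sup>2"
    by (simp add: power2_sum)
  finally show "(L2_norm M (\<lambda>x. f x + g x))\<^sup>2 \<le> (L2_norm M f + L2_norm M g)\<^sup>2" .
qed simp

lemma L2_norm_triangle_diff:
  fixes f g :: "'a \<Rightarrow> 'b::{second_countable_topology, real_normed_vector}"
  assumes f: "f \<in> square_integrable M" and g: "g \<in> square_integrable M"
  shows "L2_norm M (\<lambda>x. f x - g x) \<le> L2_norm M f + L2_norm M g"
  using L2_norm_triangle[OF f square_integrable_cmult[OF g, of "-1"]]
  by (simp add: L2_norm_cmult[where c = "-1", simplified])

lemma L2_norm_triangle_le:
  fixes f g h :: "'a \<Rightarrow> 'b::{second_countable_topology, real_normed_vector}"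
  assumes "f \<in> square_integrable M" "g \<in> square_integrable M" "h \<in> square_integrable M"
  shows "L2_norm M (\<lambda>x. f x - h x) \<le> L2_norm M (\<lambda>x. f x - g x) + L2_norm M (\<lambda>x. g x - h x)"
  using L2_norm_triangle[OF square_integrable_diff[OF assms(1,2)] square_integrable_diff[OF assms(2,3)]]
  by simp

lemma L2_norm_reverse_triangle:
  fixes f g :: "'a \<Rightarrow> 'b::{second_countable_topology, real_normed_vector}"
  assumes f: "f \<in> square_integrable M" and g: "g \<in> square_integrable M"
  shows "\<bar>L2_norm M f - L2_norm M g\<bar> \<le> L2_norm M (\<lambda>x. f x - g x)"
proof -
  have "L2_norm M f \<le> L2_norm M (\<lambda>x. f x - g x) + L2_norm M g"
    using L2_norm_triangle[OF square_integrable_diff[OF f g] g] by simp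
  moreover have "L2_norm M g \<le> L2_norm M (\<lambda>x. f x - g x) + L2_norm M f"
    using L2_norm_triangle[OF square_integrable_diff[OF g f] f]
    by (simp add: L2_norm_minus_commute[of M g])
  ultimately show ?thesis by linarith
qed

lemma L2_norm_component_le:
  fixes F :: "'a \<Rightarrow> real ^ 'n"
  assumes "F \<in> square_integrable M"
  shows "L2_norm M (\<lambda>x. F x $ i) \<le> L2_norm M F"
  by (rule L2_norm_mono[OF assms])
    (use square_integrableD(1)[OF square_integrable_component[OF assms]] component_le_norm_cart in auto)

text \<open>Up to an error small in \<open>L\<^sup>1\<close>, \<open>g\<close> may be replaced by a bounded truncation, for which the
  Lipschitz bound on \<open>\<psi>\<close> turns \<open>L\<^sup>2\<close> convergence of \<open>w n\<close> into convergence of the integrals.\<close>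

lemma tendsto_integral_lipschitz_factor:
  fixes g :: "'a \<Rightarrow> real" and w :: "nat \<Rightarrow> 'a \<Rightarrow> real"
  assumes M: "finite_measure M" and g: "integrable M g"
    and w: "\<And>n. w n \<in> square_integrable M" and w0: "w0 \<in> square_integrable M"
    and lim: "(\<lambda>n. L2_norm M (\<lambda>x. w n x - w0 x)) \<longlonglongrightarrow> 0"
    and lip: "L-lipschitz_on UNIV \<psi>" and bd: "\<And>r. \<bar>\<psi> r\<bar> \<le> (K::real)"
  shows "(\<lambda>n. \<integral>x. g x * \<psi> (w n x) \<partial>M) \<longlonglongrightarrow> (\<integral>x. g x * \<psi> (w0 x) \<partial>M)"
proof -
  interpret finite_measure M by (rule M)
  have [measurable]: "\<psi> \<in> borel_measurable borel"
    using lipschitz_on_continuous_on[OF lip] by (rule borel_measurable_continuous_onI)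
  note [measurable] = square_integrableD(1)[OF w] square_integrableD(1)[OF w0]
  have gm [measurable]: "g \<in> borel_measurable M" using g by auto
  have L0: "0 \<le> L" using lip by (rule lipschitz_on_nonneg)
  have K0: "0 \<le> K" using bd[of 0] by linarith
  have int: "integrable M (\<lambda>x. f x * \<psi> (v x))" if "integrable M f" "v \<in> borel_measurable M" for f v
  proof (rule Bochner_Integration.integrable_bound)
    show "integrable M (\<lambda>x. K * f x)" using that by simp
    show "(\<lambda>x. f x * \<psi> (v x)) \<in> borel_measurable M" using that by auto
    have "\<bar>f x * \<psi> (v x)\<bar> \<le> \<bar>K * f x\<bar>" for x
      using mult_right_mono[OF bd[of "v x"] abs_ge_zero[of "f x"]] K0 by (simp add: abs_mult mult.commute)
    then show "AE x in M. norm (f x * \<psi> (v x)) \<le> norm (K * f x)" by simp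
  qed
  define gc where "gc m x = max (- real m) (min (real m) (g x))" for m x
  have gcb: "\<bar>gc m x\<bar> \<le> real m" "\<bar>gc m x\<bar> \<le> \<bar>g x\<bar>" for m x
    by (auto simp: gc_def)
  have gcm [measurable]: "gc m \<in> borel_measurable M" for m
    unfolding gc_def[abs_def] by measurable
  have gci: "integrable M (gc m)" for m
    by (rule Bochner_Integration.integrable_bound[OF g]) (use gcb in auto)
  have "(\<lambda>m. \<integral>x. \<bar>g x - gc m x\<bar> \<partial>M) \<longlonglongrightarrow> (\<integral>x. 0 \<partial>M)"
  proof (rule integral_dominated_convergence[where w = "\<lambda>x. 2 * \<bar>g x\<bar>"])
    show "integrable M (\<lambda>x. 2 * \<bar>g x\<bar>)" using g by simp
    have "(\<lambda>m. \<bar>g x - gc m x\<bar>) \<longlonglongrightarrow> 0" for x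
    proof (rule tendsto_eventually, rule eventually_sequentiallyI[of "nat \<lceil>\<bar>g x\<bar>\<rceil>"])
      fix m assume "nat \<lceil>\<bar>g x\<bar>\<rceil> \<le> m"
      then have "\<bar>g x\<bar> \<le> real m" by linarith
      then show "\<bar>g x - gc m x\<bar> = 0" by (auto simp: gc_def)
    qed
    then show "AE x in M. (\<lambda>m. \<bar>g x - gc m x\<bar>) \<longlonglongrightarrow> 0" by simp
    show "AE x in M. norm \<bar>g x - gc m x\<bar> \<le> 2 * \<bar>g x\<bar>" for m
      by (auto simp: gc_def intro!: AE_I2)
  qed auto
  then have trunc: "(\<lambda>m. \<integral>x. \<bar>g x - gc m x\<bar> \<partial>M) \<longlonglongrightarrow> 0" by simp
  have one: "(\<lambda>_. 1) \<in> square_integrable M" by (simp add: square_integrable_def)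
  let ?D = "\<lambda>n. L2_norm M (\<lambda>x. w n x - w0 x)"
  have est: "\<bar>(\<integral>x. g x * \<psi> (w n x) \<partial>M) - (\<integral>x. g x * \<psi> (w0 x) \<partial>M)\<bar>
      \<le> 2 * K * (\<integral>x. \<bar>g x - gc m x\<bar> \<partial>M) + real m * L * (?D n * L2_norm M (\<lambda>x. 1::real))" for n m
  proof -
    have wi: "integrable M (\<lambda>x. \<bar>w n x - w0 x\<bar>)"
      by (intro integrable_abs integrable_if_square_integrable[OF M] square_integrable_diff w w0)
    have i1: "integrable M (\<lambda>x. g x * \<psi> (w n x))" "integrable M (\<lambda>x. g x * \<psi> (w0 x))"
      by (rule int[OF g]; measurable)+
    have "\<bar>(\<integral>x. g x * \<psi> (w n x) \<partial>M) - (\<integral>x. g x * \<psi> (w0 x) \<partial>M)\<bar>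
        = \<bar>\<integral>x. g x * \<psi> (w n x) - g x * \<psi> (w0 x) \<partial>M\<bar>"
      using i1 by simp
    also have "\<dots> \<le> (\<integral>x. \<bar>g x * \<psi> (w n x) - g x * \<psi> (w0 x)\<bar> \<partial>M)"
      by (rule integral_abs_bound)
    also have "\<dots> \<le> (\<integral>x. 2 * K * \<bar>g x - gc m x\<bar> + real m * L * \<bar>w n x - w0 x\<bar> \<partial>M)"
    proof (rule integral_mono)
      show "integrable M (\<lambda>x. \<bar>g x * \<psi> (w n x) - g x * \<psi> (w0 x)\<bar>)" using i1 by simp
      show "integrable M (\<lambda>x. 2 * K * \<bar>g x - gc m x\<bar> + real m * L * \<bar>w n x - w0 x\<bar>)"
        using wi g gci by simp
      fix x
      have "g x * \<psi> (w n x) - g x * \<psi> (w0 x) =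
          (g x - gc m x) * (\<psi> (w n x) - \<psi> (w0 x)) + gc m x * (\<psi> (w n x) - \<psi> (w0 x))"
        by (simp add: algebra_simps)
      also have "\<bar>\<dots>\<bar> \<le> \<bar>g x - gc m x\<bar> * \<bar>\<psi> (w n x) - \<psi> (w0 x)\<bar>
          + \<bar>gc m x\<bar> * \<bar>\<psi> (w n x) - \<psi> (w0 x)\<bar>"
        by (simp add: abs_mult[symmetric] abs_triangle_ineq)
      also have "\<dots> \<le> \<bar>g x - gc m x\<bar> * (2 * K) + real m * (L * \<bar>w n x - w0 x\<bar>)"
      proof (intro add_mono mult_mono)
        show "\<bar>\<psi> (w n x) - \<psi> (w0 x)\<bar> \<le> 2 * K"
          using bd[of "w n x"] bd[of "w0 x"] by linarith
        show "\<bar>\<psi> (w n x) - \<psi> (w0 x)\<bar> \<le> L * \<bar>w n x - w0 x\<bar>"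
          using lipschitz_onD[OF lip, of "w n x" "w0 x"] by (simp add: dist_real_def)
      qed (use gcb K0 in auto)
      finally show "\<bar>g x * \<psi> (w n x) - g x * \<psi> (w0 x)\<bar>
          \<le> 2 * K * \<bar>g x - gc m x\<bar> + real m * L * \<bar>w n x - w0 x\<bar>"
        by (simp add: algebra_simps)
    qed
    also have "\<dots> = 2 * K * (\<integral>x. \<bar>g x - gc m x\<bar> \<partial>M) + real m * L * (\<integral>x. \<bar>w n x - w0 x\<bar> \<partial>M)"
      using wi g gci by simp
    also have "(\<integral>x. \<bar>w n x - w0 x\<bar> \<partial>M) \<le> ?D n * L2_norm M (\<lambda>x. 1::real)"
      using integral_abs_mult_le_L2_norm[OF square_integrable_diff[OF w w0] one] by simp
    finally show ?thesis using L0 by (simp add: mult_left_mono)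
  qed
  show ?thesis
  proof (rule LIMSEQ_I)
    fix e :: real assume e: "0 < e"
    have "(\<lambda>m. 2 * K * (\<integral>x. \<bar>g x - gc m x\<bar> \<partial>M)) \<longlonglongrightarrow> 2 * K * 0"
      by (intro tendsto_intros trunc)
    then have "\<forall>\<^sub>F m in sequentially. 2 * K * (\<integral>x. \<bar>g x - gc m x\<bar> \<partial>M) < e / 2"
      by (rule order_tendstoD) (use e in simp)
    then obtain m where m: "2 * K * (\<integral>x. \<bar>g x - gc m x\<bar> \<partial>M) < e / 2"
      using eventually_happens'[OF sequentially_bot] by blast
    have "(\<lambda>n. real m * L * (?D n * L2_norm M (\<lambda>x. 1::real))) \<longlonglongrightarrow> real m * L * (0 * L2_norm M (\<lambda>x. 1::real))"
      by (intro tendsto_intros lim)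
    then have "\<forall>\<^sub>F n in sequentially. real m * L * (?D n * L2_norm M (\<lambda>x. 1::real)) < e / 2"
      by (rule order_tendstoD) (use e in simp)
    then obtain N where N: "\<And>n. n \<ge> N \<Longrightarrow> real m * L * (?D n * L2_norm M (\<lambda>x. 1::real)) < e / 2"
      by (auto simp: eventually_sequentially)
    show "\<exists>N. \<forall>n\<ge>N. norm ((\<integral>x. g x * \<psi> (w n x) \<partial>M) - (\<integral>x. g x * \<psi> (w0 x) \<partial>M)) < e"
    proof (intro exI[of _ N] allI impI)
      fix n assume "n \<ge> N"
      from est[of n m] m N[OF this]
      show "norm ((\<integral>x. g x * \<psi> (w n x) \<partial>M) - (\<integral>x. g x * \<psi> (w0 x) \<partial>M)) < e"
        by simp
    qed
  qed
qed

text \<open>A product of two \<open>L\<^sup>2\<close> factors and a bounded Lipschitz function of a third one. This is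
  the shape of every nonlinear term below: coefficient or \<open>sabs''\<close> times gradient times gradient or
  test function.\<close>

lemma tendsto_integral_triple:
  fixes a b w :: "nat \<Rightarrow> 'a \<Rightarrow> real"
  assumes M: "finite_measure M"
    and a: "\<And>n. a n \<in> square_integrable M" and a0: "a0 \<in> square_integrable M"
    and b: "\<And>n. b n \<in> square_integrable M" and b0: "b0 \<in> square_integrable M"
    and w: "\<And>n. w n \<in> square_integrable M" and w0: "w0 \<in> square_integrable M"
    and alim: "(\<lambda>n. L2_norm M (\<lambda>x. a n x - a0 x)) \<longlonglongrightarrow> 0"
    and blim: "(\<lambda>n. L2_norm M (\<lambda>x. b n x - b0 x)) \<longlonglongrightarrow> 0"
    and wlim: "(\<lambda>n. L2_norm M (\<lambda>x. w n x - w0 x)) \<longlonglongrightarrow> 0"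
    and lip: "L-lipschitz_on UNIV \<psi>" and bd: "\<And>r. \<bar>\<psi> r\<bar> \<le> (K::real)"
  shows "(\<lambda>n. \<integral>x. a n x * b n x * \<psi> (w n x) \<partial>M) \<longlonglongrightarrow> (\<integral>x. a0 x * b0 x * \<psi> (w0 x) \<partial>M)"
proof -
  have [measurable]: "\<psi> \<in> borel_measurable borel"
    using lipschitz_on_continuous_on[OF lip] by (rule borel_measurable_continuous_onI)
  note [measurable] = square_integrableD(1)[OF w]
  have K0: "0 \<le> K" using bd[of 0] by linarith
  let ?A = "\<lambda>n. L2_norm M (\<lambda>x. a n x - a0 x)" and ?B = "\<lambda>n. L2_norm M (\<lambda>x. b n x - b0 x)"
  let ?E = "\<lambda>n. ?A n * (?B n + L2_norm M b0) * K + L2_norm M a0 * ?B n * K"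
  have pb: "(\<lambda>x. \<psi> (w n x) * f x) \<in> square_integrable M" if "f \<in> square_integrable M" for n f
    by (rule bounded_times_square_integrable(1)[OF that _ bd]) measurable
  have int: "integrable M (\<lambda>x. f x * g x * \<psi> (w n x))"
    if "f \<in> square_integrable M" "g \<in> square_integrable M" for f g n
    using integrable_mult_square_integrable[OF that(1) pb[OF that(2), of n]]
    by (simp add: ac_simps)
  have bdd: "\<bar>\<integral>x. f x * g x * \<psi> (w n x) \<partial>M\<bar> \<le> L2_norm M f * L2_norm M g * K"
    if f: "f \<in> square_integrable M" and g: "g \<in> square_integrable M" for f g n
  proof -
    have "\<bar>\<integral>x. f x * g x * \<psi> (w n x) \<partial>M\<bar> = \<bar>\<integral>x. f x * (\<psi> (w n x) * g x) \<partial>M\<bar>"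
      by (simp add: ac_simps)
    also have "\<dots> \<le> L2_norm M f * L2_norm M (\<lambda>x. \<psi> (w n x) * g x)"
      by (rule integral_mult_le_L2_norm[OF f pb[OF g]])
    also have "\<dots> \<le> L2_norm M f * (K * L2_norm M g)"
      by (intro mult_left_mono bounded_times_square_integrable(2)[OF g _ bd] L2_norm_nonneg) measurable
    finally show ?thesis by (simp add: ac_simps)
  qed
  have est: "\<bar>(\<integral>x. a n x * b n x * \<psi> (w n x) \<partial>M) - (\<integral>x. a0 x * b0 x * \<psi> (w n x) \<partial>M)\<bar> \<le> ?E n" for n
  proof -
    have "(\<integral>x. a n x * b n x * \<psi> (w n x) \<partial>M) - (\<integral>x. a0 x * b0 x * \<psi> (w n x) \<partial>M)
        = (\<integral>x. (a n x - a0 x) * b n x * \<psi> (w n x) + a0 x * (b n x - b0 x) * \<psi> (w n x) \<partial>M)"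
      unfolding Bochner_Integration.integral_diff[OF int[OF a b] int[OF a0 b0], symmetric]
      by (intro Bochner_Integration.integral_cong refl) (simp add: algebra_simps)
    also have "\<dots> = (\<integral>x. (a n x - a0 x) * b n x * \<psi> (w n x) \<partial>M)
        + (\<integral>x. a0 x * (b n x - b0 x) * \<psi> (w n x) \<partial>M)"
      by (intro Bochner_Integration.integral_add int square_integrable_diff a a0 b b0)
    finally have eq: "\<bar>(\<integral>x. a n x * b n x * \<psi> (w n x) \<partial>M) - (\<integral>x. a0 x * b0 x * \<psi> (w n x) \<partial>M)\<bar>
        = \<bar>(\<integral>x. (a n x - a0 x) * b n x * \<psi> (w n x) \<partial>M)
          + (\<integral>x. a0 x * (b n x - b0 x) * \<psi> (w n x) \<partial>M)\<bar>" by simp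
    have "L2_norm M (b n) \<le> ?B n + L2_norm M b0"
      using L2_norm_triangle[OF square_integrable_diff[OF b b0] b0, of n] by simp
    then have "?A n * L2_norm M (b n) * K \<le> ?A n * (?B n + L2_norm M b0) * K"
      using K0 by (intro mult_right_mono mult_left_mono) auto
    then show ?thesis
      using bdd[OF square_integrable_diff[OF a a0] b, of n n n] bdd[OF a0 square_integrable_diff[OF b b0], of n n]
      unfolding eq by linarith
  qed
  have E: "?E \<longlonglongrightarrow> 0 * (0 + L2_norm M b0) * K + L2_norm M a0 * 0 * K"
    by (intro tendsto_intros alim blim)
  have "(\<lambda>n. (\<integral>x. a n x * b n x * \<psi> (w n x) \<partial>M) - (\<integral>x. a0 x * b0 x * \<psi> (w n x) \<partial>M)) \<longlonglongrightarrow> 0"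
    by (rule Lim_null_comparison[OF _ E[simplified]]) (use est in simp)
  moreover have "(\<lambda>n. \<integral>x. (a0 x * b0 x) * \<psi> (w n x) \<partial>M) \<longlonglongrightarrow> (\<integral>x. (a0 x * b0 x) * \<psi> (w0 x) \<partial>M)"
    by (rule tendsto_integral_lipschitz_factor[OF M integrable_mult_square_integrable[OF a0 b0] w w0 wlim lip bd])
  ultimately have "(\<lambda>n. ((\<integral>x. a n x * b n x * \<psi> (w n x) \<partial>M) - (\<integral>x. a0 x * b0 x * \<psi> (w n x) \<partial>M))
      + (\<integral>x. a0 x * b0 x * \<psi> (w n x) \<partial>M)) \<longlonglongrightarrow> 0 + (\<integral>x. a0 x * b0 x * \<psi> (w0 x) \<partial>M)"
    by (rule tendsto_add)
  then show ?thesis by simp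
qed

section \<open>Integration of periodic functions over the unit cube\<close>

lemma borel_measurable_torus_continuous:
  fixes f :: "real ^ 'd \<Rightarrow> 'b::{second_countable_topology, t2_space}"
  assumes "continuous_on UNIV f"
  shows "f \<in> borel_measurable torus"
  unfolding torus_def
  by (rule continuous_imp_measurable_on_sets_lebesgue)
    (use continuous_on_subset[OF assms] in auto)

lemma integrable_torus_continuous:
  fixes f :: "real ^ 'd \<Rightarrow> real"
  assumes "continuous_on UNIV f"
  shows "integrable torus f"
  unfolding torus_def
  by (intro absolutely_integrable_imp_integrable absolutely_integrable_continuous
      continuous_on_subset[OF assms]) auto

lemma integral_torus_continuous:
  fixes f :: "real ^ 'd \<Rightarrow> real"
  assumes "continuous_on UNIV f"
  shows "integral\<^sup>L torus f = integral (cbox 0 1) f"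
  using integrable_torus_continuous[OF assms] unfolding torus_def
  by (intro lebesgue_integral_eq_integral) auto

lemma integral_torus_const [simp]: "integral\<^sup>L (torus :: (real ^ 'd) measure) (\<lambda>_. c :: real) = c"
proof -
  have "cbox 0 (1::real^'d) \<noteq> {}"
    by (metis (no_types) mem_box_cart(2) empty_iff one_index zero_index order_refl zero_le_one)
  then have "measure lborel (cbox 0 (1::real^'d)) = 1"
    by (simp add: content_cbox_cart)
  then show ?thesis
    by (subst integral_torus_continuous) auto
qed

lemma measure_torus_space [simp]: "measure (torus :: (real ^ 'd) measure) (space torus) = 1"
  using integral_torus_const[of 1, where 'd = 'd] by simp

lemma square_integrable_torus_continuous:
  fixes f :: "real ^ 'd \<Rightarrow> real"
  assumes "continuous_on UNIV f"
  shows "f \<in> square_integrable torus"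
  using integrable_torus_continuous[of "\<lambda>x. (f x)\<^sup>2"] assms
  by (auto simp: square_integrable_def borel_measurable_torus_continuous intro!: continuous_intros)

lemma square_integrable_torus_const: "(\<lambda>x :: real ^ 'd. c :: real) \<in> square_integrable torus"
  by (rule square_integrable_torus_continuous[OF continuous_on_const])

lemma L2_norm_torus_const: "L2_norm torus (\<lambda>x :: real ^ 'd. c :: real) = \<bar>c\<bar>"
  by (simp add: L2_norm_def)

lemma integral_abs_le_L2_norm_torus:
  fixes f :: "real ^ 'd \<Rightarrow> real"
  assumes "f \<in> square_integrable torus"
  shows "integrable torus (\<lambda>x. \<bar>f x\<bar>)" "(\<integral>x. \<bar>f x\<bar> \<partial>torus) \<le> L2_norm torus f"
  using integral_abs_mult_le_L2_norm[OF assms square_integrable_torus_const[of 1]]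
    integrable_abs[OF integrable_if_square_integrable[OF finite_measure_torus assms]]
  by (simp_all add: L2_norm_torus_const)

lemma L2_norm_torus_le_bound:
  fixes f :: "real ^ 'd \<Rightarrow> real"
  assumes f: "f \<in> borel_measurable torus" and le: "\<And>x. x \<in> cbox 0 1 \<Longrightarrow> \<bar>f x\<bar> \<le> c"
  shows "L2_norm torus f \<le> c"
proof -
  have c: "0 \<le> c"
    using le[of 0] abs_ge_zero[of "f 0"] by (simp add: mem_box_cart)
  have "L2_norm torus f \<le> L2_norm torus (\<lambda>x :: real ^ 'd. c)"
    by (rule L2_norm_mono[OF square_integrable_torus_const f])
      (use le c in \<open>auto simp: torus_def intro!: AE_I2\<close>)
  with c show ?thesis by (simp add: L2_norm_torus_const)
qed

text \<open>Cut the translated cube along the hyperplane \<open>x\<^sub>i = 1\<close> and move the protruding slab back by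
  one period.\<close>

lemma integral_cube_translate:
  fixes f :: "real ^ 'd \<Rightarrow> real"
  assumes f: "continuous_on UNIV f" and per: "\<And>x. f (x + axis i 1) = f x"
    and s: "0 \<le> s" "s \<le> 1"
  shows "integral (cbox 0 1) (\<lambda>x. f (x + s *\<^sub>R axis i 1)) = integral (cbox 0 1) f"
proof -
  define e :: "real ^ 'd" where "e = axis i 1"
  have e: "e \<in> Basis" by (simp add: e_def)
  have ie: "x \<bullet> e = x $ i" for x by (simp add: e_def inner_axis)
  have ec: "e $ j = (if j = i then 1 else 0)" for j by (auto simp: e_def axis_def)
  have int: "f integrable_on cbox a b" for a b
    by (intro integrable_continuous continuous_on_subset[OF f]) auto
  have 1: "cbox (s *\<^sub>R e) (1 + s *\<^sub>R e) \<inter> {x. x \<bullet> e \<le> 1} = cbox (s *\<^sub>R e) 1"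
    using s by (auto simp: mem_box_cart ie ec split: if_splits) (smt (verit))
  have 2: "cbox (s *\<^sub>R e) (1 + s *\<^sub>R e) \<inter> {x. x \<bullet> e \<ge> 1} = cbox e (1 + s *\<^sub>R e)"
    using s by (auto simp: mem_box_cart ie ec split: if_splits) (smt (verit))+
  have 3: "cbox 0 1 \<inter> {x. x \<bullet> e \<le> s} = cbox 0 (1 + s *\<^sub>R e - e)"
    using s by (auto simp: mem_box_cart ie ec split: if_splits) (smt (verit))+
  have 4: "cbox 0 1 \<inter> {x. x \<bullet> e \<ge> s} = cbox (s *\<^sub>R e) 1"
    using s by (auto simp: mem_box_cart ie ec split: if_splits) (smt (verit))+
  have "integral (cbox 0 1) (\<lambda>x. f (x + s *\<^sub>R e)) = integral (cbox (s *\<^sub>R e) (1 + s *\<^sub>R e)) f"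
    using integral_shift_cbox[of "s *\<^sub>R e" "s *\<^sub>R e" "1 + s *\<^sub>R e" f] by simp
  also have "\<dots> = integral (cbox (s *\<^sub>R e) 1) f + integral (cbox e (1 + s *\<^sub>R e)) f"
    using integral_split[OF int e, of "s *\<^sub>R e" "1 + s *\<^sub>R e" 1] unfolding 1 2 .
  also have "integral (cbox e (1 + s *\<^sub>R e)) f = integral (cbox 0 (1 + s *\<^sub>R e - e)) f"
    using integral_shift_cbox[of e e "1 + s *\<^sub>R e" f] per by (simp add: e_def)
  also have "integral (cbox (s *\<^sub>R e) 1) f + integral (cbox 0 (1 + s *\<^sub>R e - e)) f = integral (cbox 0 1) f"
    using integral_split[OF int e, of 0 1 s] unfolding 3 4 by simp
  finally show ?thesis by (simp add: e_def)
qed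

text \<open>The fundamental theorem of calculus along the closed coordinate circles: averaging \<open>\<psi>'\<close>
  over the translates of the cube changes nothing, and the average along each circle vanishes.\<close>

lemma integral_torus_derivative_eq_0:
  fixes \<psi> \<psi>' :: "real ^ 'd \<Rightarrow> real"
  assumes cont: "continuous_on UNIV \<psi>'"
    and deriv: "\<And>x. ((\<lambda>s. \<psi> (x + s *\<^sub>R axis i 1)) has_real_derivative \<psi>' x) (at 0)"
    and per: "\<And>x. \<psi> (x + axis i 1) = \<psi> x"
  shows "(\<integral>x. \<psi>' x \<partial>torus) = 0"
proof -
  define e :: "real ^ 'd" where "e = axis i 1"
  have der: "((\<lambda>s. \<psi> (x + s *\<^sub>R e)) has_real_derivative \<psi>' (x + t *\<^sub>R e)) (at t)" for x t
    using deriv[of "x + t *\<^sub>R e"] DERIV_shift[of "\<lambda>s. \<psi> (x + s *\<^sub>R e)" "\<psi>' (x + t *\<^sub>R e)" 0 t]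
    by (simp add: e_def scaleR_add_left add.assoc add.commute add.left_commute)
  have per': "\<psi>' (x + e) = \<psi>' x" for x
  proof (rule DERIV_unique)
    show "((\<lambda>s. \<psi> (x + s *\<^sub>R e)) has_real_derivative \<psi>' x) (at 0)"
      using deriv by (simp add: e_def)
    have "(\<lambda>s. \<psi> (x + e + s *\<^sub>R e)) = (\<lambda>s. \<psi> (x + s *\<^sub>R e))"
      using per[of "x + s *\<^sub>R e" for s] by (simp add: e_def ac_simps)
    then show "((\<lambda>s. \<psi> (x + s *\<^sub>R e)) has_real_derivative \<psi>' (x + e)) (at 0)"
      using deriv[of "x + e"] by (simp add: e_def)
  qed
  have circle: "integral {0..1} (\<lambda>s. \<psi>' (x + s *\<^sub>R e)) = 0" for x
  proof -
    have "((\<lambda>s. \<psi>' (x + s *\<^sub>R e)) has_integral \<psi> (x + 1 *\<^sub>R e) - \<psi> (x + 0 *\<^sub>R e)) {0..1}"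
      by (rule fundamental_theorem_of_calculus)
        (use der in \<open>auto simp: has_real_derivative_iff_has_vector_derivative[symmetric]
            intro: has_field_derivative_at_within\<close>)
    then show ?thesis using per[of x] by (simp add: e_def integral_unique)
  qed
  have "integral (cbox 0 1) \<psi>' = integral (cbox 0 (1::real)) (\<lambda>s. integral (cbox 0 1) \<psi>')"
    by simp
  also have "\<dots> = integral (cbox 0 (1::real)) (\<lambda>s. integral (cbox 0 1) (\<lambda>x. \<psi>' (x + s *\<^sub>R e)))"
  proof (rule Henstock_Kurzweil_Integration.integral_cong)
    fix s :: real assume "s \<in> cbox 0 1"
    then show "integral (cbox 0 1) \<psi>' = integral (cbox 0 1) (\<lambda>x. \<psi>' (x + s *\<^sub>R e))"
      using integral_cube_translate[OF cont per'[unfolded e_def], of s] by (simp add: e_def)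
  qed
  also have "\<dots> = integral (cbox 0 1) (\<lambda>x. integral (cbox 0 (1::real)) (\<lambda>s. \<psi>' (x + s *\<^sub>R e)))"
    by (rule integral_swap_continuous)
      (auto simp: case_prod_unfold intro!: continuous_on_compose2[OF cont] continuous_intros)
  also have "\<dots> = 0" by (simp add: circle)
  finally show ?thesis by (simp add: integral_torus_continuous[OF cont])
qed

section \<open>Fourier modes\<close>

definition phase :: "('d \<Rightarrow> int) \<Rightarrow> real ^ 'd \<Rightarrow> real" where
  "phase k x = 2 * pi * (\<Sum>i\<in>UNIV. of_int (k i) * x $ i)"

text \<open>The phase shift covers sine and cosine at once, and turns differentiation into a quarter
  turn.\<close>

definition mode :: "('d \<Rightarrow> int) \<Rightarrow> real \<Rightarrow> real ^ 'd \<Rightarrow> real" where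
  "mode k \<alpha> x = cos (phase k x + \<alpha>)"

definition wave_number :: "('d \<Rightarrow> int) \<Rightarrow> 'd \<Rightarrow> real" where
  "wave_number k i = 2 * pi * of_int (k i)"

lemma phase_add: "phase k (x + y) = phase k x + phase k y"
  by (simp add: phase_def sum.distrib algebra_simps)

lemma phase_scale: "phase k (c *\<^sub>R x) = c * phase k x"
  by (simp add: phase_def sum_distrib_left algebra_simps)

lemma phase_axis: "phase k (axis i 1) = wave_number k i"
  by (simp add: phase_def wave_number_def axis_def if_distrib[of "\<lambda>c. _ * c"] cong: if_cong)

lemma bounded_linear_phase: "bounded_linear (phase k)"
  by (rule linear_conv_bounded_linear[THEN iffD1], rule linearI) (simp_all add: phase_add phase_scale)

lemma continuous_phase [continuous_intros]: "continuous_on S (phase k)"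
  by (rule linear_continuous_on[OF bounded_linear_phase])

lemma continuous_mode: "continuous_on S (mode k \<alpha>)"
  unfolding mode_def by (intro continuous_intros)

lemma abs_mode_le_1: "\<bar>mode k \<alpha> x\<bar> \<le> 1"
  by (simp add: mode_def)

lemma mode_quarter: "mode k (\<alpha> + pi / 2) x = - sin (phase k x + \<alpha>)"
  unfolding mode_def add.assoc[symmetric] cos_add[of "phase k x + \<alpha>"] by simp

lemma mode_0: "mode (\<lambda>_. 0) \<alpha> x = cos \<alpha>"
  by (simp add: mode_def phase_def)

lemma has_derivative_mode:
  "(mode k \<alpha> has_derivative (\<lambda>h. phase k h * mode k (\<alpha> + pi / 2) x)) (at x)"
proof -
  have 1: "(phase k has_derivative phase k) (at x)"
    by (rule bounded_linear_imp_has_derivative[OF bounded_linear_phase])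
  have "((\<lambda>x. cos (phase k x + \<alpha>)) has_derivative (\<lambda>h. phase k h * mode k (\<alpha> + pi / 2) x)) (at x)"
    by (auto intro!: derivative_eq_intros 1 simp: mode_quarter)
  then show ?thesis by (simp add: mode_def[abs_def])
qed

lemma partial_cmult_mode:
  "partial i (\<lambda>x. c * mode k \<alpha> x) = (\<lambda>x. (c * wave_number k i) * mode k (\<alpha> + pi / 2) x)"
proof
  fix x
  have "((\<lambda>x. c * mode k \<alpha> x) has_derivative (\<lambda>h. c * (phase k h * mode k (\<alpha> + pi / 2) x))) (at x)"
    by (intro has_derivative_mult_right has_derivative_mode)
  from frechet_derivative_at[OF this, symmetric]
  show "partial i (\<lambda>x. c * mode k \<alpha> x) x = (c * wave_number k i) * mode k (\<alpha> + pi / 2) x"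
    by (simp add: partial_def phase_axis)
qed

lemma partial_mode: "partial i (mode k \<alpha>) = (\<lambda>x. wave_number k i * mode k (\<alpha> + pi / 2) x)"
  using partial_cmult_mode[of i 1 k \<alpha>] by simp

lemma C_diff_mode: "C_diff n (\<lambda>x. c * mode k \<alpha> x)"
proof (induction n arbitrary: c \<alpha>)
  case 0
  show ?case by (simp add: continuous_mode continuous_on_mult_left)
next
  case (Suc n)
  have "(\<lambda>x. c * mode k \<alpha> x) differentiable (at x)" for x
    unfolding differentiable_def using has_derivative_mult_right[OF has_derivative_mode] by blast
  with Suc show ?case by (simp add: partial_cmult_mode)
qed

lemma mode_periodic: "mode k \<alpha> (x + axis i 1) = mode k \<alpha> x"
proof -
  have "mode k \<alpha> (x + axis i 1) = cos ((phase k x + \<alpha>) + 2 * pi * of_int (k i))"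
    by (simp add: mode_def phase_add phase_axis wave_number_def algebra_simps)
  also have "\<dots> = mode k \<alpha> x"
    unfolding cos_add[of "phase k x + \<alpha>"] cos_int_2pin sin_int_2pin by (simp add: mode_def)
  finally show ?thesis .
qed

lemma mode_smooth_torus: "mode k \<alpha> \<in> smooth_torus"
  using C_diff_mode[of _ 1 k \<alpha>] by (simp add: smooth_torus_def mode_periodic)

lemma square_integrable_mode: "mode k \<alpha> \<in> square_integrable torus"
  by (rule square_integrable_bounded[OF finite_measure_torus _ abs_mode_le_1])
    (rule borel_measurable_torus_continuous[OF continuous_mode])

lemma integral_mode: "(\<integral>x. mode k \<alpha> x \<partial>torus) = (if k = (\<lambda>_. 0) then cos \<alpha> else 0)"
proof (cases "k = (\<lambda>_. 0)")
  case True
  then show ?thesis by (simp add: mode_0)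
next
  case False
  then obtain i where "k i \<noteq> 0" by auto
  then have wn: "wave_number k i \<noteq> 0" by (simp add: wave_number_def)
  have "((\<lambda>s. mode k (\<alpha> - pi / 2) (x + s *\<^sub>R axis i 1) / wave_number k i)
      has_real_derivative mode k \<alpha> x) (at 0)" for x
  proof -
    have "((\<lambda>s. cos (phase k x + s * wave_number k i + (\<alpha> - pi / 2)) / wave_number k i)
      has_real_derivative mode k \<alpha> x) (at 0)"
      using wn by (auto intro!: derivative_eq_intros simp: mode_def sin_diff add_diff_eq cos_add)
    then show ?thesis by (simp add: mode_def phase_add phase_scale phase_axis)
  qed
  then have "(\<integral>x. mode k \<alpha> x \<partial>torus) = 0"
    by (rule integral_torus_derivative_eq_0[OF continuous_mode]) (simp add: mode_periodic)
  with False show ?thesis by simp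
qed

lemma mode_mult:
  "mode k \<alpha> x * mode l \<beta> x =
    (mode (\<lambda>i. k i + l i) (\<alpha> + \<beta>) x + mode (\<lambda>i. k i - l i) (\<alpha> - \<beta>) x) / 2"
proof -
  have "phase (\<lambda>i. k i + l i) x = phase k x + phase l x"
    "phase (\<lambda>i. k i - l i) x = phase k x - phase l x"
    by (simp_all add: phase_def sum.distrib sum_subtractf algebra_simps)
  then show ?thesis
    unfolding mode_def by (simp only: cos_times_cos) (simp add: add_diff_eq diff_add_eq diff_diff_eq2 ac_simps diff_diff_eq)
qed

section \<open>Fourier projections\<close>

definition freqs :: "nat \<Rightarrow> ('d::finite \<Rightarrow> int) set" where
  "freqs N = (UNIV \<rightarrow>\<^sub>E {- int N..int N})"

definition modes :: "nat \<Rightarrow> (('d::finite \<Rightarrow> int) \<times> real) set" where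
  "modes N = freqs N \<times> {0, - (pi / 2)}"

definition fcoeff :: "(real ^ 'd \<Rightarrow> real) \<Rightarrow> ('d \<Rightarrow> int) \<Rightarrow> real \<Rightarrow> real" where
  "fcoeff f k \<alpha> = (\<integral>x. f x * mode k \<alpha> x \<partial>torus)"

text \<open>Every pair of opposite frequencies occurs twice in the sum; this compensates for the
  normalisation \<open>1/2\<close> of the nonconstant modes, so that the sum is the orthogonal projection.\<close>

definition trig_proj :: "nat \<Rightarrow> (real ^ 'd \<Rightarrow> real) \<Rightarrow> real ^ 'd \<Rightarrow> real" where
  "trig_proj N f x = (\<Sum>(k, \<alpha>)\<in>modes N. fcoeff f k \<alpha> * mode k \<alpha> x)"

lemma finite_freqs [simp]: "finite (freqs N)"
  unfolding freqs_def by (intro finite_PiE) auto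

lemma finite_modes [simp]: "finite (modes N)"
  by (simp add: modes_def)

lemma mem_freqs: "k \<in> freqs N \<longleftrightarrow> (\<forall>i. \<bar>k i\<bar> \<le> int N)"
  by (auto simp: freqs_def PiE_iff abs_le_iff) (smt (verit))+

lemma sum_modes: "(\<Sum>(k, \<alpha>)\<in>modes N. F k \<alpha>) = (\<Sum>k\<in>freqs N. F k 0 + F k (- (pi / 2)))"
  unfolding modes_def by (simp add: sum.cartesian_product[symmetric] pi_neq_zero)

lemma integrable_mult_mode:
  "f \<in> square_integrable torus \<Longrightarrow> integrable torus (\<lambda>x. f x * mode k \<alpha> x)"
  by (rule integrable_mult_square_integrable[OF _ square_integrable_mode])

lemma fcoeff_add:
  assumes "f \<in> square_integrable torus" "g \<in> square_integrable torus"
  shows "fcoeff (\<lambda>x. f x + g x) k \<alpha> = fcoeff f k \<alpha> + fcoeff g k \<alpha>"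
  unfolding fcoeff_def
  using integrable_mult_mode[OF assms(1), of k \<alpha>] integrable_mult_mode[OF assms(2), of k \<alpha>]
  by (simp add: distrib_right)

lemma fcoeff_cmult: "fcoeff (\<lambda>x. c * f x) k \<alpha> = c * fcoeff f k \<alpha>"
  by (simp add: fcoeff_def mult.assoc)

lemma fcoeff_diff:
  assumes "f \<in> square_integrable torus" "g \<in> square_integrable torus"
  shows "fcoeff (\<lambda>x. f x - g x) k \<alpha> = fcoeff f k \<alpha> - fcoeff g k \<alpha>"
  unfolding fcoeff_def
  using integrable_mult_mode[OF assms(1), of k \<alpha>] integrable_mult_mode[OF assms(2), of k \<alpha>]
  by (simp add: left_diff_distrib)

lemma trig_proj_add:
  assumes "f \<in> square_integrable torus" "g \<in> square_integrable torus"
  shows "trig_proj N (\<lambda>x. f x + g x) x = trig_proj N f x + trig_proj N g x"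
  by (simp add: trig_proj_def fcoeff_add[OF assms] case_prod_unfold distrib_right sum.distrib)

lemma trig_proj_cmult: "trig_proj N (\<lambda>x. c * f x) x = c * trig_proj N f x"
  by (simp add: trig_proj_def fcoeff_cmult case_prod_unfold sum_distrib_left mult.assoc)

lemma trig_proj_diff:
  assumes "f \<in> square_integrable torus" "g \<in> square_integrable torus"
  shows "trig_proj N (\<lambda>x. f x - g x) x = trig_proj N f x - trig_proj N g x"
  by (simp add: trig_proj_def fcoeff_diff[OF assms] case_prod_unfold left_diff_distrib sum_subtractf)

lemma continuous_trig_proj: "continuous_on S (trig_proj N f)"
  unfolding trig_proj_def case_prod_unfold
  by (intro continuous_intros continuous_mode)

lemma abs_trig_proj_le: "\<bar>trig_proj N f x\<bar> \<le> (\<Sum>(k, \<alpha>)\<in>modes N. \<bar>fcoeff f k \<alpha>\<bar>)"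
  unfolding trig_proj_def case_prod_unfold
  by (rule order_trans[OF sum_abs sum_mono])
    (simp add: abs_mult mult_left_le abs_mode_le_1)

lemma square_integrable_trig_proj: "trig_proj N f \<in> square_integrable torus"
  by (rule square_integrable_bounded[OF finite_measure_torus _ abs_trig_proj_le])
    (rule borel_measurable_torus_continuous[OF continuous_trig_proj])

lemma integral_trig_proj_mult:
  assumes "g \<in> square_integrable torus"
  shows "(\<integral>x. trig_proj N f x * g x \<partial>torus) = (\<Sum>(k, \<alpha>)\<in>modes N. fcoeff f k \<alpha> * fcoeff g k \<alpha>)"
proof -
  have "(\<integral>x. trig_proj N f x * g x \<partial>torus)
      = (\<integral>x. (\<Sum>(k, \<alpha>)\<in>modes N. fcoeff f k \<alpha> * (g x * mode k \<alpha> x)) \<partial>torus)"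
    by (simp add: trig_proj_def case_prod_unfold sum_distrib_left sum_distrib_right ac_simps)
  also have "\<dots> = (\<Sum>(k, \<alpha>)\<in>modes N. fcoeff f k \<alpha> * fcoeff g k \<alpha>)"
    by (simp add: case_prod_unfold fcoeff_def integrable_mult_mode[OF assms])
  finally show ?thesis .
qed

lemma trig_proj_symmetric:
  assumes "f \<in> square_integrable torus" "g \<in> square_integrable torus"
  shows "(\<integral>x. trig_proj N f x * g x \<partial>torus) = (\<integral>x. f x * trig_proj N g x \<partial>torus)"
  using integral_trig_proj_mult[OF assms(2), of N f] integral_trig_proj_mult[OF assms(1), of N g]
  by (simp add: mult.commute)

text \<open>The addition theorem collapses the two modes of each frequency to a single convolution with
  \<open>cos (k \<cdot> (x - y))\<close>.\<close>

lemma trig_proj_eq_sum_freqs: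
  assumes f: "f \<in> square_integrable torus"
  shows "trig_proj N f x = (\<Sum>k\<in>freqs N. fcoeff f k (- phase k x))"
proof -
  have "fcoeff f k 0 * mode k 0 x + fcoeff f k (- (pi / 2)) * mode k (- (pi / 2)) x
      = fcoeff f k (- phase k x)" for k
  proof -
    have "fcoeff f k (- phase k x)
        = (\<integral>y. mode k 0 x * (f y * mode k 0 y) + mode k (- (pi / 2)) x * (f y * mode k (- (pi / 2)) y) \<partial>torus)"
      unfolding fcoeff_def mode_def
      by (intro Bochner_Integration.integral_cong refl) (simp add: cos_diff algebra_simps)
    also have "\<dots> = mode k 0 x * fcoeff f k 0 + mode k (- (pi / 2)) x * fcoeff f k (- (pi / 2))"
      using integrable_mult_mode[OF f, of k 0] integrable_mult_mode[OF f, of k "- (pi / 2)"]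
      by (simp add: fcoeff_def)
    finally show ?thesis by (simp add: mult.commute)
  qed
  then show ?thesis by (simp add: trig_proj_def sum_modes)
qed

text \<open>The two opposite frequencies \<open>l\<close> and \<open>- l\<close> each reproduce one half of the mode.\<close>

lemma trig_proj_mode:
  assumes l: "l \<in> freqs N"
  shows "trig_proj N (mode l \<beta>) x = mode l \<beta> x"
proof -
  define m where "m = (\<lambda>i. - l i)"
  have m: "m \<in> freqs N" using l by (simp add: m_def mem_freqs)
  have pm: "phase m x = - phase l x" by (simp add: phase_def m_def sum_negf)
  have co: "fcoeff (mode l \<beta>) k (- phase k x)
      = (if k = m then mode l \<beta> x / 2 else 0) + (if k = l then mode l \<beta> x / 2 else 0)" for k
  proof -
    have eq: "(\<lambda>i. l i + k i) = (\<lambda>_. 0) \<longleftrightarrow> k = m" "(\<lambda>i. l i - k i) = (\<lambda>_. 0) \<longleftrightarrow> k = l"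
      by (auto simp: m_def fun_eq_iff add_eq_0_iff)
    have "fcoeff (mode l \<beta>) k (- phase k x)
        = (\<integral>y. mode (\<lambda>i. l i + k i) (\<beta> - phase k x) y / 2 + mode (\<lambda>i. l i - k i) (\<beta> + phase k x) y / 2 \<partial>torus)"
      unfolding fcoeff_def mode_mult by (simp add: add_divide_distrib)
    also have "\<dots> = (\<integral>y. mode (\<lambda>i. l i + k i) (\<beta> - phase k x) y \<partial>torus) / 2
        + (\<integral>y. mode (\<lambda>i. l i - k i) (\<beta> + phase k x) y \<partial>torus) / 2"
      by (subst Bochner_Integration.integral_add)
        (auto intro!: integrable_torus_continuous[OF continuous_mode])
    finally have "fcoeff (mode l \<beta>) k (- phase k x)
        = (if k = m then cos (\<beta> - phase k x) else 0) / 2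
        + (if k = l then cos (\<beta> + phase k x) else 0) / 2"
      unfolding integral_mode eq .
    moreover have "cos (\<beta> - phase k x) = mode l \<beta> x" if "k = m"
      using that by (simp add: mode_def pm add.commute)
    moreover have "cos (\<beta> + phase k x) = mode l \<beta> x" if "k = l"
      using that by (simp add: mode_def add.commute)
    ultimately show ?thesis by (simp split: if_splits)
  qed
  show ?thesis
    using l m by (simp add: trig_proj_eq_sum_freqs[OF square_integrable_mode] co sum.distrib)
qed

lemma square_integrable_sum_modes:
  "finite J \<Longrightarrow> (\<lambda>x. \<Sum>(k, \<alpha>)\<in>J. c k \<alpha> * mode k \<alpha> x) \<in> square_integrable torus"
proof (induction J rule: finite_induct)
  case empty
  then show ?case by (simp add: square_integrable_def)
next
  case (insert j J)
  then show ?case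
    using square_integrable_add[OF square_integrable_cmult[OF square_integrable_mode[of "fst j" "snd j"], of "c (fst j) (snd j)"] insert.IH]
    by (simp add: case_prod_unfold)
qed

lemma trig_proj_sum_modes:
  "finite J \<Longrightarrow> fst ` J \<subseteq> freqs N \<Longrightarrow>
    trig_proj N (\<lambda>x. \<Sum>(k, \<alpha>)\<in>J. c k \<alpha> * mode k \<alpha> x) x = (\<Sum>(k, \<alpha>)\<in>J. c k \<alpha> * mode k \<alpha> x)"
proof (induction J rule: finite_induct)
  case empty
  then show ?case by (simp add: trig_proj_def fcoeff_def)
next
  case (insert j J)
  have "trig_proj N (\<lambda>x. c (fst j) (snd j) * mode (fst j) (snd j) x + (\<Sum>(k, \<alpha>)\<in>J. c k \<alpha> * mode k \<alpha> x)) x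
      = c (fst j) (snd j) * mode (fst j) (snd j) x + (\<Sum>(k, \<alpha>)\<in>J. c k \<alpha> * mode k \<alpha> x)"
    using insert.IH insert.prems insert.hyps
    by (subst trig_proj_add)
      (auto simp: trig_proj_cmult trig_proj_mode square_integrable_sum_modes
        intro!: square_integrable_cmult[OF square_integrable_mode, simplified])
  with insert.hyps show ?case by (simp add: case_prod_unfold)
qed

lemma trig_proj_idem: "trig_proj N (trig_proj N f) = trig_proj N f"
  using trig_proj_sum_modes[of "modes N" N "fcoeff f"]
  by (auto simp: trig_proj_def[of N f, abs_def] modes_def)

text \<open>A symmetric idempotent operator is a contraction.\<close>

lemma L2_norm_trig_proj_le:
  assumes f: "f \<in> square_integrable torus"
  shows "L2_norm torus (trig_proj N f) \<le> L2_norm torus f"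
proof -
  let ?p = "trig_proj N f"
  have "(L2_norm torus ?p)\<^sup>2 = (\<integral>x. trig_proj N f x * ?p x \<partial>torus)"
    unfolding L2_norm_power2 by (simp add: power2_eq_square)
  also have "\<dots> = (\<integral>x. f x * ?p x \<partial>torus)"
    using trig_proj_symmetric[OF f square_integrable_trig_proj, of N N f] by (simp add: trig_proj_idem)
  also have "\<dots> \<le> L2_norm torus f * L2_norm torus ?p"
    using integral_mult_le_L2_norm[OF f square_integrable_trig_proj, of N f] by linarith
  finally show ?thesis
    by (cases "L2_norm torus ?p = 0") (auto simp: power2_eq_square less_le)
qed

section \<open>Completeness of the Fourier modes\<close>

text \<open>Being fixed by all large projections is the property of finite sums of modes that matters
  here, and it spares naming their coefficients.\<close>

definition trig_polynomial :: "(real ^ 'd \<Rightarrow> real) \<Rightarrow> bool" where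
  "trig_polynomial p \<longleftrightarrow> continuous_on UNIV p \<and> (\<exists>N. \<forall>n\<ge>N. \<forall>x. trig_proj n p x = p x)"

lemma trig_polynomial_mode: "trig_polynomial (mode k \<alpha>)"
proof -
  define N where "N = nat (\<Sum>i\<in>UNIV. \<bar>k i\<bar>)"
  have "k \<in> freqs n" if "N \<le> n" for n
  proof -
    have "\<bar>k i\<bar> \<le> (\<Sum>i\<in>UNIV. \<bar>k i\<bar>)" for i
      by (rule member_le_sum) auto
    with that show ?thesis unfolding mem_freqs N_def
      by (metis nat_le_iff order_trans)
  qed
  then show ?thesis
    unfolding trig_polynomial_def
    by (intro conjI continuous_mode exI[of _ N]) (simp add: trig_proj_mode)
qed

lemma trig_polynomial_add:
  assumes "trig_polynomial p" "trig_polynomial q"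
  shows "trig_polynomial (\<lambda>x. p x + q x)"
proof -
  obtain N M where "\<And>n x. n \<ge> N \<Longrightarrow> trig_proj n p x = p x" "\<And>n x. n \<ge> M \<Longrightarrow> trig_proj n q x = q x"
    using assms unfolding trig_polynomial_def by blast
  with assms show ?thesis
    unfolding trig_polynomial_def
    by (auto intro!: continuous_intros exI[of _ "max N M"]
        simp: trig_proj_add square_integrable_torus_continuous)
qed

lemma trig_polynomial_cmult:
  assumes "trig_polynomial p"
  shows "trig_polynomial (\<lambda>x. c * p x)"
  using assms unfolding trig_polynomial_def
  by (auto intro!: continuous_intros simp: trig_proj_cmult)

lemma trig_polynomial_const: "trig_polynomial (\<lambda>_. c)"
  using trig_polynomial_cmult[OF trig_polynomial_mode[of "\<lambda>_. 0" 0], of c] by (simp add: mode_0)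

lemma trig_polynomial_sum:
  "(\<And>i. i \<in> I \<Longrightarrow> trig_polynomial (p i)) \<Longrightarrow> trig_polynomial (\<lambda>x. \<Sum>i\<in>I. p i x)"
  by (induction I rule: infinite_finite_induct)
    (auto intro: trig_polynomial_const trig_polynomial_add)

lemma trig_polynomial_mult:
  assumes "trig_polynomial p" "trig_polynomial q"
  shows "trig_polynomial (\<lambda>x. p x * q x)"
proof -
  obtain N M where p: "\<And>x. trig_proj N p x = p x" and q: "\<And>x. trig_proj M q x = q x"
    using assms unfolding trig_polynomial_def by blast
  have mm: "trig_polynomial (\<lambda>x. mode k \<alpha> x * mode l \<beta> x)" for k \<alpha> l \<beta>
    using trig_polynomial_cmult[OF trig_polynomial_add[OF trig_polynomial_mode trig_polynomial_mode], of "1/2"]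
    unfolding mode_mult by simp
  have "trig_polynomial (\<lambda>x. \<Sum>i\<in>modes N. \<Sum>j\<in>modes M. (fcoeff p (fst i) (snd i) * fcoeff q (fst j) (snd j)) *
      (mode (fst i) (snd i) x * mode (fst j) (snd j) x))"
    by (intro trig_polynomial_sum trig_polynomial_cmult mm)
  moreover have "(\<Sum>i\<in>modes N. \<Sum>j\<in>modes M. (fcoeff p (fst i) (snd i) * fcoeff q (fst j) (snd j)) *
      (mode (fst i) (snd i) x * mode (fst j) (snd j) x)) = p x * q x" for x
    unfolding p[of x, symmetric] q[of x, symmetric] trig_proj_def[of N p x] trig_proj_def[of M q x]
      case_prod_unfold sum_product
    by (intro sum.cong refl) (simp only: mult_ac)
  ultimately show ?thesis by simp
qed

text \<open>The torus as a compact subset of Euclidean space. Trigonometric polynomials are the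
  restrictions of ordinary polynomials to it, which makes the Stone-Weierstrass theorem available.\<close>

definition torus_embed :: "real ^ 'd \<Rightarrow> (real ^ 'd) \<times> (real ^ 'd)" where
  "torus_embed x = ((\<chi> i. cos (2 * pi * x $ i)), (\<chi> i. sin (2 * pi * x $ i)))"

lemma continuous_torus_embed: "continuous_on S torus_embed"
  unfolding torus_embed_def
  by (intro continuous_intros)

lemma trig_polynomial_torus_embed:
  assumes "real_polynomial_function p"
  shows "trig_polynomial (\<lambda>x :: real ^ 'd. p (torus_embed x))"
  using assms
proof induction
  case (linear f)
  interpret bounded_linear f by fact
  have unit: "cos (2 * pi * x $ i) = mode (\<lambda>j. if j = i then 1 else 0) 0 x"
    "sin (2 * pi * x $ i) = mode (\<lambda>j. if j = i then 1 else 0) (- (pi / 2)) x" for x :: "real ^ 'd" and i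
    by (simp_all add: mode_def phase_def if_distrib[of "\<lambda>c. c * _"] if_distrib[of of_int] cos_diff cong: if_cong)
  have dec: "torus_embed x = (\<Sum>i\<in>UNIV. cos (2 * pi * x $ i) *\<^sub>R (axis i 1, 0))
      + (\<Sum>i\<in>UNIV. sin (2 * pi * x $ i) *\<^sub>R (0, axis i 1))" for x :: "real ^ 'd"
    by (simp add: torus_embed_def prod_eq_iff fst_sum snd_sum vec_eq_iff axis_def
        if_distrib[of "\<lambda>c. _ * c"] cong: if_cong)
  have "f (torus_embed x) = (\<Sum>i\<in>UNIV. f (axis i 1, 0) * mode (\<lambda>j. if j = i then 1 else 0) 0 x)
      + (\<Sum>i\<in>UNIV. f (0, axis i 1) * mode (\<lambda>j. if j = i then 1 else 0) (- (pi / 2)) x)" for x :: "real ^ 'd"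
    unfolding dec unit by (simp only: add sum scaleR real_scaleR_def mult.commute)
  then show ?case
    by (simp only:) (intro trig_polynomial_add trig_polynomial_sum trig_polynomial_cmult trig_polynomial_mode)
qed (auto intro: trig_polynomial_const trig_polynomial_add trig_polynomial_mult)

text \<open>Only points of the boundary of the cube are identified on the torus.\<close>

lemma torus_embed_eqD:
  assumes "torus_embed x = torus_embed y" "x \<in> box 0 1" "y \<in> cbox 0 1"
  shows "x = y"
proof -
  have "x $ i = y $ i" for i
  proof -
    have "cos (2 * pi * x $ i) = cos (2 * pi * y $ i)" "sin (2 * pi * x $ i) = sin (2 * pi * y $ i)"
      using assms(1) by (simp_all add: torus_embed_def vec_eq_iff)
    then obtain n where "2 * pi * x $ i = 2 * pi * y $ i + 2 * pi * of_int n"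
      using sin_cos_eq_iff[of "2 * pi * x $ i" "2 * pi * y $ i"] by blast
    then have "2 * pi * x $ i = 2 * pi * (y $ i + of_int n)" by (simp only: distrib_left)
    then have n: "x $ i = y $ i + of_int n" by simp
    have "0 < x $ i" "x $ i < 1" "0 \<le> y $ i" "y $ i \<le> 1"
      using assms(2,3) by (auto simp: mem_box_cart)
    with n have "of_int n < (1 :: real)" "- 1 < (of_int n :: real)" by linarith+
    then have "n < 1" "- 1 < n" by linarith+
    then have "n = 0" by simp
    with n show ?thesis by simp
  qed
  then show ?thesis by (simp add: vec_eq_iff)
qed

lemma L2_tendsto_dominated:
  fixes f :: "'a \<Rightarrow> real"
  assumes h: "h \<in> square_integrable M" and f: "f \<in> borel_measurable M"
    and g: "\<And>n. g n \<in> borel_measurable M"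
    and lim: "AE x in M. (\<lambda>n. g n x) \<longlonglongrightarrow> f x"
    and le: "\<And>n. AE x in M. \<bar>g n x\<bar> \<le> h x"
  shows "(\<lambda>n. L2_norm M (\<lambda>x. f x - g n x)) \<longlonglongrightarrow> 0"
proof -
  have fle: "AE x in M. \<bar>f x\<bar> \<le> h x"
  proof -
    have "AE x in M. \<forall>n. \<bar>g n x\<bar> \<le> h x" using le by (simp add: AE_all_countable)
    with lim show ?thesis
      by eventually_elim (rule LIMSEQ_le_const2[OF tendsto_rabs], auto)
  qed
  have "(\<lambda>n. \<integral>x. (f x - g n x)\<^sup>2 \<partial>M) \<longlonglongrightarrow> (\<integral>x. 0 \<partial>M)"
  proof (rule integral_dominated_convergence[where w = "\<lambda>x. 4 * (h x)\<^sup>2"])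
    show "integrable M (\<lambda>x. 4 * (h x)\<^sup>2)" using square_integrable_realD[OF h] by simp
    show "AE x in M. (\<lambda>n. (f x - g n x)\<^sup>2) \<longlonglongrightarrow> 0"
      using lim by eventually_elim (auto intro!: tendsto_eq_intros)
    show "AE x in M. norm ((f x - g n x)\<^sup>2) \<le> 4 * (h x)\<^sup>2" for n
      using fle le[of n]
    proof eventually_elim
      case (elim x)
      then have "\<bar>f x - g n x\<bar> \<le> 2 * h x" by linarith
      then have "\<bar>f x - g n x\<bar>\<^sup>2 \<le> (2 * h x)\<^sup>2" by (rule power_mono) simp
      then show ?case by (simp add: power_mult_distrib)
    qed
  qed (use f g in auto)
  then have "(\<lambda>n. sqrt (\<integral>x. (f x - g n x)\<^sup>2 \<partial>M)) \<longlonglongrightarrow> sqrt 0"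
    by (intro tendsto_real_sqrt) simp
  then show ?thesis by (simp add: L2_norm_def)
qed

lemma L2_norm_tendsto_0I:
  assumes le: "\<And>n. L2_norm M (f n) \<le> a n" and a: "a \<longlonglongrightarrow> 0"
  shows "(\<lambda>n. L2_norm M (f n)) \<longlonglongrightarrow> 0"
  by (rule tendsto_sandwich[OF always_eventually[OF allI] always_eventually[OF allI] tendsto_const a])
    (simp_all add: le)

definition trig_limit :: "(real ^ 'd \<Rightarrow> real) \<Rightarrow> bool" where
  "trig_limit f \<longleftrightarrow> f \<in> square_integrable torus \<and>
    (\<lambda>n. L2_norm torus (\<lambda>x. f x - trig_proj n f x)) \<longlonglongrightarrow> 0"

lemma trig_limit_trig_polynomial: "trig_polynomial p \<Longrightarrow> trig_limit p"
proof -
  assume p: "trig_polynomial p"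
  then obtain N where N: "\<And>n x. n \<ge> N \<Longrightarrow> trig_proj n p x = p x"
    unfolding trig_polynomial_def by blast
  have "(\<lambda>n. L2_norm torus (\<lambda>x. p x - trig_proj n p x)) \<longlonglongrightarrow> 0"
    by (rule tendsto_eventually, rule eventually_sequentiallyI[of N]) (simp add: N L2_norm_def)
  with p show ?thesis
    by (simp add: trig_limit_def trig_polynomial_def square_integrable_torus_continuous)
qed

text \<open>The projections are uniformly bounded, so convergence passes to limits in \<open>L\<^sup>2\<close>.\<close>

lemma trig_limit_closed:
  assumes f: "f \<in> square_integrable torus" and g: "\<And>n. trig_limit (g n)"
    and lim: "(\<lambda>n. L2_norm torus (\<lambda>x. f x - g n x)) \<longlonglongrightarrow> 0"
  shows "trig_limit f"
proof -
  have gs: "g n \<in> square_integrable torus" for n using g by (simp add: trig_limit_def)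
  have "(\<lambda>n. L2_norm torus (\<lambda>x. f x - trig_proj n f x)) \<longlonglongrightarrow> 0"
  proof (rule LIMSEQ_I)
    fix e :: real assume e: "0 < e"
    obtain m where m: "L2_norm torus (\<lambda>x. f x - g m x) < e / 3"
      using LIMSEQ_D[OF lim, of "e / 3"] e by auto
    obtain N where N: "\<And>n. n \<ge> N \<Longrightarrow> L2_norm torus (\<lambda>x. g m x - trig_proj n (g m) x) < e / 3"
      using LIMSEQ_D[of _ 0 "e / 3"] g[of m] e unfolding trig_limit_def by fastforce
    show "\<exists>N. \<forall>n\<ge>N. norm (L2_norm torus (\<lambda>x. f x - trig_proj n f x) - 0) < e"
    proof (intro exI[of _ N] allI impI)
      fix n assume n: "N \<le> n"
      have "L2_norm torus (\<lambda>x. f x - trig_proj n f x)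
          \<le> L2_norm torus (\<lambda>x. f x - g m x) + L2_norm torus (\<lambda>x. g m x - trig_proj n f x)"
        by (rule L2_norm_triangle_le[OF f gs square_integrable_trig_proj])
      also have "L2_norm torus (\<lambda>x. g m x - trig_proj n f x)
          \<le> L2_norm torus (\<lambda>x. g m x - trig_proj n (g m) x)
            + L2_norm torus (\<lambda>x. trig_proj n (g m) x - trig_proj n f x)"
        by (rule L2_norm_triangle_le[OF gs square_integrable_trig_proj square_integrable_trig_proj])
      also have "L2_norm torus (\<lambda>x. trig_proj n (g m) x - trig_proj n f x)
          = L2_norm torus (trig_proj n (\<lambda>x. g m x - f x))"
        by (simp add: trig_proj_diff[OF gs f, abs_def])
      also have "\<dots> \<le> L2_norm torus (\<lambda>x. g m x - f x)"
        by (rule L2_norm_trig_proj_le[OF square_integrable_diff[OF gs f]])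
      also have "\<dots> = L2_norm torus (\<lambda>x. f x - g m x)" by (rule L2_norm_minus_commute)
      finally show "norm (L2_norm torus (\<lambda>x. f x - trig_proj n f x) - 0) < e"
        using m N[OF n] by simp
    qed
  qed
  with f show ?thesis by (simp add: trig_limit_def)
qed

lemma trig_limit_add:
  assumes "trig_limit f" "trig_limit g"
  shows "trig_limit (\<lambda>x. f x + g x)"
proof -
  have s: "f \<in> square_integrable torus" "g \<in> square_integrable torus"
    using assms by (auto simp: trig_limit_def)
  have lim: "(\<lambda>n. L2_norm torus (\<lambda>x. f x - trig_proj n f x) + L2_norm torus (\<lambda>x. g x - trig_proj n g x))
      \<longlonglongrightarrow> 0"
    using assms by (intro tendsto_add_zero) (auto simp: trig_limit_def)
  have bd: "L2_norm torus (\<lambda>x. (f x + g x) - trig_proj n (\<lambda>x. f x + g x) x)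
      \<le> L2_norm torus (\<lambda>x. f x - trig_proj n f x) + L2_norm torus (\<lambda>x. g x - trig_proj n g x)" for n
  proof -
    have "f x + g x - trig_proj n (\<lambda>x. f x + g x) x = (f x - trig_proj n f x) + (g x - trig_proj n g x)" for x
      unfolding trig_proj_add[OF s] by simp
    moreover have "L2_norm torus (\<lambda>x. (f x - trig_proj n f x) + (g x - trig_proj n g x))
        \<le> L2_norm torus (\<lambda>x. f x - trig_proj n f x) + L2_norm torus (\<lambda>x. g x - trig_proj n g x)"
      by (intro L2_norm_triangle square_integrable_diff s square_integrable_trig_proj)
    ultimately show ?thesis by (simp only:)
  qed
  have "(\<lambda>n. L2_norm torus (\<lambda>x. (f x + g x) - trig_proj n (\<lambda>x. f x + g x) x)) \<longlonglongrightarrow> 0"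
    by (rule L2_norm_tendsto_0I[OF bd lim])
  with s show ?thesis by (simp add: trig_limit_def square_integrable_add)
qed

lemma trig_limit_cmult:
  assumes "trig_limit f"
  shows "trig_limit (\<lambda>x. c * f x)"
proof -
  have "(\<lambda>n. \<bar>c\<bar> * L2_norm torus (\<lambda>x. f x - trig_proj n f x)) \<longlonglongrightarrow> \<bar>c\<bar> * 0"
    using assms by (intro tendsto_intros) (simp add: trig_limit_def)
  moreover have "L2_norm torus (\<lambda>x. c * f x - trig_proj n (\<lambda>x. c * f x) x)
      = \<bar>c\<bar> * L2_norm torus (\<lambda>x. f x - trig_proj n f x)" for n
    using L2_norm_cmult[of torus c "\<lambda>x. f x - trig_proj n f x"]
    by (simp add: trig_proj_cmult right_diff_distrib)
  moreover have "(\<lambda>x. c * f x) \<in> square_integrable torus"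
    using assms square_integrable_cmult[of f torus c] by (simp add: trig_limit_def)
  ultimately show ?thesis by (simp add: trig_limit_def)
qed

lemma trig_limit_continuous_torus_embed:
  fixes g :: "(real ^ 'd) \<times> (real ^ 'd) \<Rightarrow> real"
  assumes g: "continuous_on UNIV g"
  shows "trig_limit (\<lambda>x. g (torus_embed x))"
proof -
  let ?K = "torus_embed ` cbox 0 (1 :: real ^ 'd)"
  have K: "compact ?K" by (intro compact_continuous_image continuous_torus_embed) simp
  have "\<exists>p. real_polynomial_function p \<and> (\<forall>y\<in>?K. \<bar>g y - p y\<bar> < 1 / real (Suc n))" for n
    using Stone_Weierstrass_real_polynomial_function[OF K continuous_on_subset[OF g], of "1 / real (Suc n)"]
    by (metis of_nat_0_less_iff subset_UNIV zero_less_Suc zero_less_divide_1_iff)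
  then obtain p where p: "\<And>n. real_polynomial_function (p n)"
    and pg: "\<And>n y. y \<in> ?K \<Longrightarrow> \<bar>g y - p n y\<bar> < 1 / real (Suc n)" by metis
  have gs: "(\<lambda>x. g (torus_embed x)) \<in> square_integrable torus"
    by (intro square_integrable_torus_continuous continuous_on_compose2[OF g continuous_torus_embed]) auto
  have ps: "(\<lambda>x. p n (torus_embed x)) \<in> square_integrable torus" for n
    using trig_polynomial_torus_embed[OF p, of n]
    by (intro square_integrable_torus_continuous) (simp add: trig_polynomial_def)
  show ?thesis
  proof (rule trig_limit_closed[OF gs])
    show "trig_limit (\<lambda>x. p n (torus_embed x))" for n
      by (rule trig_limit_trig_polynomial[OF trig_polynomial_torus_embed[OF p]])
    show "(\<lambda>n. L2_norm torus (\<lambda>x. g (torus_embed x) - p n (torus_embed x))) \<longlonglongrightarrow> 0"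
    proof (rule Lim_null_comparison)
      have "\<bar>g (torus_embed x) - p n (torus_embed x)\<bar> \<le> 1 / real (Suc n)" if "x \<in> cbox 0 1" for x n
        using pg[of "torus_embed x" n] that by force
      then have "L2_norm torus (\<lambda>x. g (torus_embed x) - p n (torus_embed x)) \<le> 1 / real (Suc n)" for n
        by (intro L2_norm_torus_le_bound square_integrableD(1)[OF square_integrable_diff[OF gs ps]])
      then show "\<forall>\<^sub>F n in sequentially. norm (L2_norm torus (\<lambda>x. g (torus_embed x) - p n (torus_embed x)))
          \<le> 1 / real (Suc n)"
        by simp
      show "(\<lambda>n. 1 / real (Suc n)) \<longlonglongrightarrow> 0"
        using LIMSEQ_inverse_real_of_nat by (simp add: inverse_eq_divide)
    qed
  qed
qed

text \<open>The images of \<open>W\<close> and of the rest of the cube on the embedded torus are disjoint, and the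
  latter is compact. Hence truncated multiples of the distance to it increase to the indicator of \<open>W\<close>.\<close>

lemma trig_limit_indicator_open:
  fixes W :: "(real ^ 'd) set"
  assumes W: "open W" "W \<subseteq> box 0 1"
  shows "trig_limit (indicat_real W)"
proof -
  let ?K = "torus_embed ` (cbox 0 1 - W)"
  define g where "g n y = min 1 (real n * infdist y ?K)" for n y
  have K: "closed ?K"
    using W(1) by (intro compact_imp_closed compact_continuous_image continuous_torus_embed compact_diff) auto
  have K0: "?K \<noteq> {}"
  proof -
    have "0 \<in> cbox 0 (1 :: real ^ 'd)" "0 \<notin> box 0 (1 :: real ^ 'd)" by (simp_all add: mem_box_cart)
    with W(2) show ?thesis by blast
  qed
  have gc: "continuous_on UNIV (g n)" for n
    unfolding g_def by (intro continuous_intros)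
  have lim: "(\<lambda>n. g n (torus_embed x)) \<longlonglongrightarrow> indicat_real W x" if x: "x \<in> cbox 0 1" for x
  proof (cases "x \<in> W")
    case True
    with W(2) have "torus_embed x \<notin> ?K" by (auto dest: torus_embed_eqD)
    then have pos: "0 < infdist (torus_embed x) ?K"
      by (rule infdist_pos_not_in_closed[OF K K0])
    have "\<forall>\<^sub>F n in sequentially. g n (torus_embed x) = indicat_real W x"
    proof (rule eventually_sequentiallyI[of "nat \<lceil>1 / infdist (torus_embed x) ?K\<rceil>"])
      fix n assume "nat \<lceil>1 / infdist (torus_embed x) ?K\<rceil> \<le> n"
      then have "1 / infdist (torus_embed x) ?K \<le> real n" by linarith
      with pos have "1 \<le> real n * infdist (torus_embed x) ?K" by (simp add: field_simps)
      with True show "g n (torus_embed x) = indicat_real W x" by (simp add: g_def)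
    qed
    then show ?thesis by (rule tendsto_eventually)
  next
    case False
    with x have "infdist (torus_embed x) ?K = 0" by (intro infdist_zero) auto
    with False show ?thesis by (simp add: g_def)
  qed
  have Wm: "indicat_real W \<in> borel_measurable torus"
    unfolding torus_def using W(1) subset_trans[OF W(2) box_subset_cbox]
    by (intro borel_measurable_indicator) (auto simp: sets_restrict_space_iff)
  show ?thesis
  proof (rule trig_limit_closed)
    show "indicat_real W \<in> square_integrable torus"
      by (rule square_integrable_bounded[OF finite_measure_torus Wm, of 1]) (auto simp: indicator_def)
    show "trig_limit (\<lambda>x. g n (torus_embed x))" for n
      by (rule trig_limit_continuous_torus_embed[OF gc])
    show "(\<lambda>n. L2_norm torus (\<lambda>x. indicat_real W x - g n (torus_embed x))) \<longlonglongrightarrow> 0"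
    proof (rule L2_tendsto_dominated[where h = "\<lambda>_. 1", OF _ Wm])
      show "(\<lambda>_ :: real ^ 'd. 1 :: real) \<in> square_integrable torus"
        by (rule square_integrable_torus_const)
      show "(\<lambda>x. g n (torus_embed x)) \<in> borel_measurable torus" for n
        by (intro borel_measurable_torus_continuous continuous_on_compose2[OF gc continuous_torus_embed]) auto
      show "AE x in torus. (\<lambda>n. g n (torus_embed x)) \<longlonglongrightarrow> indicat_real W x"
        using lim by (auto simp: torus_def intro!: AE_I2)
      show "AE x in torus. \<bar>g n (torus_embed x)\<bar> \<le> 1" for n
      proof -
        have "0 \<le> real n * infdist (torus_embed x) ?K" for x :: "real ^ 'd"
          by (simp add: infdist_nonneg)
        then have "\<bar>g n (torus_embed x)\<bar> \<le> 1" for x :: "real ^ 'd"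
          unfolding g_def by (smt (verit))
        then show ?thesis by simp
      qed
    qed
  qed
qed

text \<open>Outer regularity of the Lebesgue measure reduces measurable sets to open ones. Only the
  interior of the cube matters, since its boundary is null.\<close>

lemma trig_limit_indicator:
  fixes S :: "(real ^ 'd) set"
  assumes S: "S \<in> sets torus"
  shows "trig_limit (indicat_real S)"
proof -
  have Sl: "S \<in> sets lebesgue" and Sc: "S \<subseteq> cbox 0 1"
    using S by (auto simp: torus_def sets_restrict_space_iff)
  have "\<exists>W. open W \<and> S \<subseteq> W \<and> W - S \<in> lmeasurable \<and> emeasure lebesgue (W - S) < ennreal (1 / real (Suc n))" for n
    using sets_lebesgue_outer_open[OF Sl, of "1 / real (Suc n)"]
    by (metis of_nat_0_less_iff zero_less_Suc zero_less_divide_1_iff)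
  then obtain W where W: "\<And>n. open (W n)" "\<And>n. S \<subseteq> W n" "\<And>n. W n - S \<in> lmeasurable"
    "\<And>n. emeasure lebesgue (W n - S) < ennreal (1 / real (Suc n))" by metis
  define V where "V n = W n \<inter> box 0 1" for n
  have Vo: "open (V n)" "V n \<subseteq> box 0 1" for n using W(1) by (auto simp: V_def open_Int)
  have Ss: "indicat_real S \<in> square_integrable torus"
    by (rule square_integrable_bounded[OF finite_measure_torus, of _ 1])
      (use S in \<open>auto simp: indicator_def\<close>)
  have bdry: "AE x in torus. x \<in> box 0 (1 :: real ^ 'd)"
  proof -
    have "AE x in lebesgue. x \<notin> cbox 0 1 - box 0 (1 :: real ^ 'd)"
      using negligible_frontier_interval[of 0 "1 :: real ^ 'd"]
      by (intro AE_not_in) (simp add: negligible_iff_null_sets)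
    then show ?thesis
      unfolding torus_def by (subst AE_restrict_space_iff) auto
  qed
  show ?thesis
  proof (rule trig_limit_closed[OF Ss])
    show "trig_limit (indicat_real (V n))" for n
      by (rule trig_limit_indicator_open[OF Vo])
    have sq: "(L2_norm torus (\<lambda>x. indicat_real S x - indicat_real (V n) x))\<^sup>2 \<le> 1 / real (Suc n)" for n
    proof -
      have dm: "W n - S \<in> sets lebesgue" using W(3) by (simp add: fmeasurableD)
      have dt: "(W n - S) \<inter> cbox 0 1 \<in> sets torus"
        using dm by (auto simp: torus_def sets_restrict_space_iff)
      have "(L2_norm torus (\<lambda>x. indicat_real S x - indicat_real (V n) x))\<^sup>2
          = (\<integral>x. indicat_real ((W n - S) \<inter> cbox 0 1) x \<partial>torus)"
        unfolding L2_norm_power2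
      proof (rule integral_cong_AE)
        have "indicat_real (V n) \<in> borel_measurable torus"
          using trig_limit_indicator_open[OF Vo, of n] by (simp add: trig_limit_def square_integrable_def)
        with S show "(\<lambda>x. (norm (indicat_real S x - indicat_real (V n) x))\<^sup>2) \<in> borel_measurable torus"
          using Ss by (intro borel_measurable_power borel_measurable_norm[THEN measurable_compose[rotated]]
              borel_measurable_diff) (auto simp: square_integrable_def)
        show "indicat_real ((W n - S) \<inter> cbox 0 1) \<in> borel_measurable torus"
          using dt by (rule borel_measurable_indicator)
        show "AE x in torus. (norm (indicat_real S x - indicat_real (V n) x))\<^sup>2
            = indicat_real ((W n - S) \<inter> cbox 0 1) x"
          using bdry
        proof eventually_elim
          case (elim x)
          moreover from elim have "x \<in> cbox 0 1" using box_subset_cbox by blast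
          ultimately show ?case using W(2)[of n] by (auto simp: indicator_def V_def)
        qed
      qed
      also have "\<dots> = measure torus ((W n - S) \<inter> cbox 0 1)"
        using dt sets.sets_into_space by (simp add: Int_absorb2)
      also have "\<dots> = measure lebesgue ((W n - S) \<inter> cbox 0 1)"
        unfolding torus_def by (rule measure_restrict_space) auto
      also have "\<dots> \<le> measure lebesgue (W n - S)"
        using W(3) by (intro measure_mono_fmeasurable) auto
      also have "\<dots> \<le> 1 / real (Suc n)"
        using W(3,4)[of n] by (simp add: emeasure_eq_measure2 ennreal_less_iff)
      finally show ?thesis .
    qed
    have bd: "L2_norm torus (\<lambda>x. indicat_real S x - indicat_real (V n) x) \<le> sqrt (1 / real (Suc n))" for n
      using real_le_rsqrt[OF sq] .
    have "(\<lambda>n. sqrt (1 / real (Suc n))) \<longlonglongrightarrow> sqrt 0"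
      using tendsto_real_sqrt[OF LIMSEQ_inverse_real_of_nat] unfolding inverse_eq_divide .
    then have lim: "(\<lambda>n. sqrt (1 / real (Suc n))) \<longlonglongrightarrow> 0"
      unfolding real_sqrt_zero .
    show "(\<lambda>n. L2_norm torus (\<lambda>x. indicat_real S x - indicat_real (V n) x)) \<longlonglongrightarrow> 0"
      by (rule L2_norm_tendsto_0I[OF bd lim])
  qed
qed

text \<open>Monotone approximation by simple functions; the limit itself dominates the approximants.\<close>

lemma trig_limit_nonneg:
  fixes f :: "real ^ 'd \<Rightarrow> real"
  assumes "f \<in> borel_measurable torus" "\<And>x. 0 \<le> f x" "f \<in> square_integrable torus"
  shows "trig_limit f"
proof -
  have "f \<in> square_integrable torus \<longrightarrow> trig_limit f"
    using assms(1,2)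
  proof (induction rule: borel_measurable_induct_real)
    case (set A)
    then show ?case by (simp add: trig_limit_indicator)
  next
    case (mult u c)
    show ?case
    proof (cases "c = 0")
      case True
      moreover have "trig_limit (\<lambda>_ :: real ^ 'd. 0)"
        by (rule trig_limit_trig_polynomial[OF trig_polynomial_const])
      ultimately show ?thesis by simp
    next
      case False
      show ?thesis
      proof
        assume "(\<lambda>x. c * u x) \<in> square_integrable torus"
        from square_integrable_cmult[OF this, of "1 / c"] False
        have "u \<in> square_integrable torus" by simp
        with mult show "trig_limit (\<lambda>x. c * u x)" by (auto intro: trig_limit_cmult)
      qed
    qed
  next
    case (add u v)
    show ?case
    proof
      assume s: "(\<lambda>x. v x + u x) \<in> square_integrable torus"
      have "u \<in> square_integrable torus" "v \<in> square_integrable torus"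
        by (rule square_integrable_bound[OF s]; use add in \<open>auto intro!: AE_I2\<close>)+
      with add show "trig_limit (\<lambda>x. v x + u x)" by (auto intro: trig_limit_add)
    qed
  next
    case (seq U)
    show ?case
    proof
      assume s: "f \<in> square_integrable torus"
      have le: "U i x \<le> f x" if "x \<in> space torus" for i x
        using incseq_le[OF _ seq(4)[OF that]] seq(3) by (simp add: incseq_def le_fun_def)
      have Us: "U i \<in> square_integrable torus" for i
        by (rule square_integrable_bound[OF s seq(1)])
          (use seq(2) assms(2) le in \<open>auto intro!: AE_I2\<close>)
      show "trig_limit f"
      proof (rule trig_limit_closed[OF s])
        show "trig_limit (U n)" for n using seq(5) Us by blast
        show "(\<lambda>n. L2_norm torus (\<lambda>x. f x - U n x)) \<longlonglongrightarrow> 0"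
          by (rule L2_tendsto_dominated[OF s square_integrableD(1)[OF s] seq(1)])
            (use seq(2,4) le in \<open>auto intro!: AE_I2\<close>)
      qed
    qed
  qed
  with assms(3) show ?thesis by blast
qed

text \<open>Completeness of the Fourier modes.\<close>

theorem trig_proj_tendsto:
  fixes f :: "real ^ 'd \<Rightarrow> real"
  assumes f: "f \<in> square_integrable torus"
  shows "(\<lambda>n. L2_norm torus (\<lambda>x. trig_proj n f x - f x)) \<longlonglongrightarrow> 0"
proof -
  have m: "f \<in> borel_measurable torus" using f by (rule square_integrableD)
  have "trig_limit (\<lambda>x. max (f x) 0)" "trig_limit (\<lambda>x. max (- f x) 0)"
    by (rule trig_limit_nonneg; use m in \<open>auto intro!: square_integrable_bound[OF f] AE_I2\<close>)+
  from trig_limit_add[OF this(1) trig_limit_cmult[OF this(2), of "-1"]]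
  have "trig_limit (\<lambda>x. max (f x) 0 + - 1 * max (- f x) 0)" .
  also have "(\<lambda>x. max (f x) 0 + - 1 * max (- f x) 0) = f" by (auto simp: max_def)
  finally show ?thesis by (simp add: trig_limit_def L2_norm_minus_commute[of torus f])
qed

section \<open>Weak derivatives and the Fourier projections\<close>

text \<open>Integration by parts against the Fourier modes alone; by completeness of the modes it
  already determines the weak derivative.\<close>

definition weak_partial :: "'d::finite \<Rightarrow> (real ^ 'd \<Rightarrow> real) \<Rightarrow> (real ^ 'd \<Rightarrow> real) \<Rightarrow> bool" where
  "weak_partial i f g \<longleftrightarrow> (\<forall>k \<alpha>. fcoeff g k \<alpha> = - (wave_number k i * fcoeff f k (\<alpha> + pi / 2)))"

lemma weak_partial_weak_grad:
  assumes "is_weak_grad f G"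
  shows "weak_partial i f (\<lambda>x. G x $ i)"
  unfolding weak_partial_def
proof (intro allI)
  fix k \<alpha>
  have "(\<integral>x. f x * partial i (mode k \<alpha>) x \<partial>torus) = - (\<integral>x. G x $ i * mode k \<alpha> x \<partial>torus)"
    using assms mode_smooth_torus[of k \<alpha>] unfolding is_weak_grad_def by blast
  moreover have "(\<integral>x. f x * partial i (mode k \<alpha>) x \<partial>torus) = wave_number k i * fcoeff f k (\<alpha> + pi / 2)"
    by (simp add: partial_mode fcoeff_def mult.left_commute[of _ "wave_number k i"])
  ultimately show "fcoeff (\<lambda>x. G x $ i) k \<alpha> = - (wave_number k i * fcoeff f k (\<alpha> + pi / 2))"
    by (simp add: fcoeff_def)
qed

lemma weak_partial_diff:
  assumes "weak_partial i f F" "weak_partial i g G"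
    "f \<in> square_integrable torus" "g \<in> square_integrable torus"
    "F \<in> square_integrable torus" "G \<in> square_integrable torus"
  shows "weak_partial i (\<lambda>x. f x - g x) (\<lambda>x. F x - G x)"
  using assms by (simp add: weak_partial_def fcoeff_diff right_diff_distrib)

lemma fcoeff_eq_imp_AE_eq:
  fixes f g :: "real ^ 'd \<Rightarrow> real"
  assumes f: "f \<in> square_integrable torus" and g: "g \<in> square_integrable torus"
    and eq: "\<And>k \<alpha>. fcoeff f k \<alpha> = fcoeff g k \<alpha>"
  shows "AE x in torus. f x = g x"
proof -
  have fg: "(\<lambda>x. f x - g x) \<in> square_integrable torus" by (rule square_integrable_diff[OF f g])
  have "trig_proj n (\<lambda>x. f x - g x) x = 0" for n x
    by (simp add: trig_proj_def fcoeff_diff[OF f g] eq)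
  then have "(\<lambda>n::nat. L2_norm torus (\<lambda>x. f x - g x)) \<longlonglongrightarrow> 0"
    using trig_proj_tendsto[OF fg] by (simp add: L2_norm_def power2_commute[of "g _"])
  then have "L2_norm torus (\<lambda>x. f x - g x) = 0" by (simp add: LIMSEQ_const_iff)
  from L2_norm_eq_0_AE[OF fg this] show ?thesis by simp
qed

lemma weak_partial_unique:
  assumes "weak_partial i f g" "weak_partial i f h"
    "g \<in> square_integrable torus" "h \<in> square_integrable torus"
  shows "AE x in torus. g x = h x"
  by (rule fcoeff_eq_imp_AE_eq) (use assms in \<open>simp_all add: weak_partial_def\<close>)

text \<open>Half a turn changes the sign, so on the two phases of a frequency the quarter turn is a
  skew symmetric map.\<close>

lemma sum_modes_quarter:
  assumes "\<And>k. a k (pi / 2) = - a k (- (pi / 2))" "\<And>k. b k (pi / 2) = - b k (- (pi / 2))"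
  shows "(\<Sum>(k, \<alpha>)\<in>modes N. c k * (a k (\<alpha> + pi / 2) * b k \<alpha>))
    = - (\<Sum>(k, \<alpha>)\<in>modes N. c k * (a k \<alpha> * b k (\<alpha> + pi / 2) :: real))"
  unfolding sum_modes by (simp add: assms sum_negf[symmetric] algebra_simps)

lemma mode_half_turn: "mode k (pi / 2) x = - mode k (- (pi / 2)) x"
  by (simp add: mode_def cos_add cos_diff)

lemma fcoeff_half_turn: "fcoeff f k (pi / 2) = - fcoeff f k (- (pi / 2))"
  unfolding fcoeff_def mode_half_turn by simp

text \<open>The flux \<open>F\<close> is tested with the derivative of the projection of \<open>g\<close>. By skewness the
  derivative passes to \<open>g\<close>, and by symmetry the projection passes to \<open>F\<close>.\<close>

lemma sum_modes_flux:
  assumes "weak_partial i g h" "h \<in> square_integrable torus"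
  shows "(\<Sum>(k, \<alpha>)\<in>modes N. wave_number k i * fcoeff F k (\<alpha> + pi / 2) * fcoeff g k \<alpha>)
    = (\<integral>x. trig_proj N F x * h x \<partial>torus)"
proof -
  have "(\<Sum>(k, \<alpha>)\<in>modes N. wave_number k i * fcoeff F k (\<alpha> + pi / 2) * fcoeff g k \<alpha>)
      = - (\<Sum>(k, \<alpha>)\<in>modes N. wave_number k i * (fcoeff F k \<alpha> * fcoeff g k (\<alpha> + pi / 2)))"
    using sum_modes_quarter[of "fcoeff F" "fcoeff g" "\<lambda>k. wave_number k i" N]
    by (simp add: fcoeff_half_turn mult.assoc)
  also have "\<dots> = (\<Sum>(k, \<alpha>)\<in>modes N. fcoeff F k \<alpha> * fcoeff h k \<alpha>)"
    using assms(1) by (simp add: weak_partial_def sum_negf[symmetric] case_prod_unfold ac_simps)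
  finally show ?thesis by (simp add: integral_trig_proj_mult[OF assms(2)])
qed

lemma mode_line_derivative:
  "((\<lambda>s. mode k \<alpha> (x + s *\<^sub>R axis i 1)) has_real_derivative
    wave_number k i * mode k (\<alpha> + pi / 2) x) (at 0)"
proof -
  have "((\<lambda>s. cos (phase k x + s * wave_number k i + \<alpha>)) has_real_derivative
    wave_number k i * mode k (\<alpha> + pi / 2) x) (at 0)"
    by (auto intro!: derivative_eq_intros simp: mode_quarter)
  then show ?thesis by (simp add: mode_def phase_add phase_scale phase_axis)
qed

text \<open>Projecting commutes with differentiating.\<close>

lemma trig_proj_line_derivative:
  assumes "weak_partial i f F"
  shows "((\<lambda>s. trig_proj N f (x + s *\<^sub>R axis i 1)) has_real_derivative trig_proj N F x) (at 0)"
proof -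
  have "((\<lambda>s. \<Sum>j\<in>modes N. fcoeff f (fst j) (snd j) * mode (fst j) (snd j) (x + s *\<^sub>R axis i 1))
      has_real_derivative
      (\<Sum>j\<in>modes N. fcoeff f (fst j) (snd j) * (wave_number (fst j) i * mode (fst j) (snd j + pi / 2) x))) (at 0)"
    by (intro DERIV_sum DERIV_cmult mode_line_derivative)
  moreover have "(\<Sum>j\<in>modes N. fcoeff f (fst j) (snd j) * (wave_number (fst j) i * mode (fst j) (snd j + pi / 2) x))
      = (\<Sum>(k, \<alpha>)\<in>modes N. wave_number k i * (mode k (\<alpha> + pi / 2) x * fcoeff f k \<alpha>))"
    by (simp add: case_prod_unfold ac_simps)
  moreover have "\<dots> = - (\<Sum>(k, \<alpha>)\<in>modes N. wave_number k i * (mode k \<alpha> x * fcoeff f k (\<alpha> + pi / 2)))"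
    by (rule sum_modes_quarter) (rule mode_half_turn fcoeff_half_turn)+
  moreover have "\<dots> = trig_proj N F x"
    using assms by (simp add: trig_proj_def weak_partial_def sum_negf[symmetric] case_prod_unfold ac_simps)
  ultimately show ?thesis by (simp only: trig_proj_def case_prod_unfold)
qed

lemma trig_proj_periodic: "trig_proj N f (x + axis i 1) = trig_proj N f x"
  by (simp add: trig_proj_def mode_periodic)

text \<open>The projected function is smooth, so this is the classical chain rule followed by integration
  by parts on the torus.\<close>

lemma weak_partial_compose_trig_proj:
  fixes f :: "real ^ 'd \<Rightarrow> real"
  assumes "weak_partial i f F"
    and der: "\<And>r. (\<psi> has_real_derivative \<psi>' r) (at r)" and cont: "continuous_on UNIV \<psi>'"
  shows "weak_partial i (\<lambda>x. \<psi> (trig_proj N f x)) (\<lambda>x. trig_proj N F x * \<psi>' (trig_proj N f x))"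
  unfolding weak_partial_def
proof (intro allI)
  fix k \<alpha>
  let ?P = "trig_proj N f" and ?Q = "trig_proj N F"
  let ?a = "\<lambda>x. ?Q x * \<psi>' (?P x) * mode k \<alpha> x"
    and ?b = "\<lambda>x. \<psi> (?P x) * mode k (\<alpha> + pi / 2) x"
  have c0: "continuous_on UNIV \<psi>"
    using der by (intro DERIV_continuous_on) (auto intro: has_field_derivative_at_within)
  have c1: "continuous_on UNIV (\<lambda>x. \<psi>' (?P x))" and c2: "continuous_on UNIV (\<lambda>x. \<psi> (?P x))"
    by (rule continuous_on_compose2[OF cont continuous_trig_proj]
        continuous_on_compose2[OF c0 continuous_trig_proj], simp)+
  have ca: "continuous_on UNIV ?a" and cb: "continuous_on UNIV ?b"
    by (intro continuous_intros c1 c2 continuous_trig_proj continuous_mode)+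
  have "(\<integral>x. ?a x + wave_number k i * ?b x \<partial>torus) = 0"
  proof (rule integral_torus_derivative_eq_0)
    show "continuous_on UNIV (\<lambda>x. ?a x + wave_number k i * ?b x)"
      by (intro continuous_on_add continuous_on_mult_left ca cb)
    show "\<psi> (?P (x + axis i 1)) * mode k \<alpha> (x + axis i 1) = \<psi> (?P x) * mode k \<alpha> x" for x
      by (simp add: trig_proj_periodic mode_periodic)
    fix x
    have "((\<lambda>s. \<psi> (?P (x + s *\<^sub>R axis i 1))) has_real_derivative \<psi>' (?P x) * ?Q x) (at 0)"
      using DERIV_chain2[of \<psi> "\<psi>' (?P x)" "\<lambda>s. ?P (x + s *\<^sub>R axis i 1)" 0 "?Q x" UNIV]
        der[of "?P x"] trig_proj_line_derivative[OF assms(1), of N x] by simp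
    from DERIV_mult[OF this mode_line_derivative[of k \<alpha> x i]]
    show "((\<lambda>s. \<psi> (?P (x + s *\<^sub>R axis i 1)) * mode k \<alpha> (x + s *\<^sub>R axis i 1))
        has_real_derivative ?a x + wave_number k i * ?b x) (at 0)"
      by (simp add: algebra_simps)
  qed
  moreover have "(\<integral>x. ?a x + wave_number k i * ?b x \<partial>torus)
      = (\<integral>x. ?a x \<partial>torus) + wave_number k i * (\<integral>x. ?b x \<partial>torus)"
    using integrable_torus_continuous[OF ca] integrable_torus_continuous[OF cb] by simp
  ultimately show "fcoeff (\<lambda>x. ?Q x * \<psi>' (?P x)) k \<alpha>
      = - (wave_number k i * fcoeff (\<lambda>x. \<psi> (?P x)) k (\<alpha> + pi / 2))"
    by (simp add: fcoeff_def)
qed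

section \<open>A smooth approximation of the absolute value\<close>

definition sabs :: "real \<Rightarrow> real \<Rightarrow> real" where
  "sabs \<epsilon> r = sqrt (r\<^sup>2 + \<epsilon>\<^sup>2)"

definition sabs' :: "real \<Rightarrow> real \<Rightarrow> real" where
  "sabs' \<epsilon> r = r / sabs \<epsilon> r"

definition sabs'' :: "real \<Rightarrow> real \<Rightarrow> real" where
  "sabs'' \<epsilon> r = \<epsilon>\<^sup>2 / sabs \<epsilon> r ^ 3"

context
  fixes \<epsilon> :: real
  assumes eps: "0 < \<epsilon>"
begin

lemma sabs_pos: "0 < sabs \<epsilon> r"
  using eps by (simp add: sabs_def add_nonneg_pos)

lemma sabs_power2: "(sabs \<epsilon> r)\<^sup>2 = r\<^sup>2 + \<epsilon>\<^sup>2"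
  by (simp add: sabs_def)

lemma abs_le_sabs: "\<bar>r\<bar> \<le> sabs \<epsilon> r"
  unfolding sabs_def by (rule real_le_rsqrt) simp

lemma eps_le_sabs: "\<epsilon> \<le> sabs \<epsilon> r"
  unfolding sabs_def by (rule real_le_rsqrt) simp

lemma sabs_0: "sabs \<epsilon> 0 = \<epsilon>"
  using eps by (simp add: sabs_def)

lemma sabs_convex: "sabs \<epsilon> b - sabs \<epsilon> a \<le> sabs' \<epsilon> b * (b - a)"
proof -
  have "(a * b + \<epsilon>\<^sup>2)\<^sup>2 \<le> (a\<^sup>2 + \<epsilon>\<^sup>2) * (b\<^sup>2 + \<epsilon>\<^sup>2)"
    using zero_le_power2[of "\<epsilon> * (a - b)"] by (simp add: power2_eq_square algebra_simps)
  then have "(a * b + \<epsilon>\<^sup>2)\<^sup>2 \<le> (sabs \<epsilon> a * sabs \<epsilon> b)\<^sup>2"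
    by (simp add: power_mult_distrib sabs_power2)
  then have "a * b + \<epsilon>\<^sup>2 \<le> sabs \<epsilon> a * sabs \<epsilon> b"
    by (rule power2_le_imp_le) (simp add: sabs_pos less_imp_le)
  then have "(sabs \<epsilon> b - sabs \<epsilon> a) * sabs \<epsilon> b \<le> b * (b - a)"
    using sabs_power2[of b] by (simp add: algebra_simps power2_eq_square)
  then show ?thesis using sabs_pos[of b] by (simp add: sabs'_def pos_le_divide_eq)
qed

lemma abs_sabs'_le: "\<bar>sabs' \<epsilon> r\<bar> \<le> 1"
  using abs_le_sabs[of r] sabs_pos[of r] by (simp add: sabs'_def abs_divide divide_le_eq)

lemma sabs''_nonneg: "0 \<le> sabs'' \<epsilon> r"
  using sabs_pos[of r] by (simp add: sabs''_def)

lemma DERIV_sabs: "(sabs \<epsilon> has_real_derivative sabs' \<epsilon> r) (at r)"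
proof -
  have "0 < r\<^sup>2 + \<epsilon>\<^sup>2" using eps by (simp add: add_nonneg_pos)
  then have "((\<lambda>r. sqrt (r\<^sup>2 + \<epsilon>\<^sup>2)) has_real_derivative r / sqrt (r\<^sup>2 + \<epsilon>\<^sup>2)) (at r)"
    by (auto intro!: derivative_eq_intros simp: field_simps)
  then show ?thesis by (simp add: sabs_def[abs_def] sabs'_def)
qed

lemma DERIV_sabs': "(sabs' \<epsilon> has_real_derivative sabs'' \<epsilon> r) (at r)"
proof -
  have "((\<lambda>r. r / sabs \<epsilon> r) has_real_derivative
      (1 * sabs \<epsilon> r - r * sabs' \<epsilon> r) / (sabs \<epsilon> r * sabs \<epsilon> r)) (at r)"
    using sabs_pos[of r] by (intro DERIV_divide DERIV_ident DERIV_sabs) simp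
  moreover have "(1 * sabs \<epsilon> r - r * sabs' \<epsilon> r) / (sabs \<epsilon> r * sabs \<epsilon> r)
      = ((sabs \<epsilon> r)\<^sup>2 - r\<^sup>2) / sabs \<epsilon> r ^ 3"
    using sabs_pos[of r] by (simp add: sabs'_def field_simps power2_eq_square power3_eq_cube)
  ultimately show ?thesis
    by (simp add: sabs'_def[abs_def] sabs''_def sabs_power2)
qed

lemma square_mult_sabs''_le: "r\<^sup>2 * sabs'' \<epsilon> r \<le> \<epsilon>"
proof -
  let ?s = "sabs \<epsilon> r"
  have "r\<^sup>2 * \<epsilon>\<^sup>2 \<le> ?s\<^sup>2 * (\<epsilon> * ?s)"
    unfolding power2_eq_square[of \<epsilon>]
    using eps eps_le_sabs[of r] sabs_power2[of r]
    by (intro mult_mono) auto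
  then show ?thesis using sabs_pos[of r]
    by (simp add: sabs''_def divide_le_eq power2_eq_square power3_eq_cube ac_simps)
qed

lemma sabs''_le: "sabs'' \<epsilon> r \<le> 1 / \<epsilon>"
proof -
  have "\<epsilon> ^ 3 \<le> sabs \<epsilon> r ^ 3"
    using eps eps_le_sabs[of r] by (intro power_mono) auto
  then show ?thesis using eps sabs_pos[of r]
    by (simp add: sabs''_def field_simps power2_eq_square power3_eq_cube)
qed

lemma abs_sabs''_le: "\<bar>sabs'' \<epsilon> r\<bar> \<le> 1 / \<epsilon>"
  using sabs''_le[of r] sabs''_nonneg[of r] by simp

lemma lipschitz_sabs: "1-lipschitz_on UNIV (sabs \<epsilon>)"
proof (rule lipschitz_onI)
  fix a b :: real
  show "dist (sabs \<epsilon> a) (sabs \<epsilon> b) \<le> 1 * dist a b"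
    using field_differentiable_bound[of UNIV "sabs \<epsilon>" "sabs' \<epsilon>" 1 a b] DERIV_sabs abs_sabs'_le
    by (simp add: dist_norm)
qed simp

lemma lipschitz_sabs': "(1 / \<epsilon>)-lipschitz_on UNIV (sabs' \<epsilon>)"
proof (rule lipschitz_onI)
  fix a b :: real
  show "dist (sabs' \<epsilon> a) (sabs' \<epsilon> b) \<le> 1 / \<epsilon> * dist a b"
    using field_differentiable_bound[of UNIV "sabs' \<epsilon>" "sabs'' \<epsilon>" "1 / \<epsilon>" a b] DERIV_sabs' abs_sabs''_le
    by (simp add: dist_norm)
qed (use eps in simp)

lemma lipschitz_sabs'': "(3 / \<epsilon>\<^sup>2)-lipschitz_on UNIV (sabs'' \<epsilon>)"
proof (rule lipschitz_onI)
  fix a b :: real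
  let ?d = "\<lambda>r. - (\<epsilon>\<^sup>2 * (3 * (sabs \<epsilon> r)\<^sup>2 * sabs' \<epsilon> r)) / (sabs \<epsilon> r ^ 3 * sabs \<epsilon> r ^ 3)"
  have "(sabs'' \<epsilon> has_real_derivative ?d r) (at r)" for r
    unfolding sabs''_def[abs_def] using sabs_pos[of r]
    by (auto intro!: derivative_eq_intros DERIV_sabs)
  moreover have "\<bar>?d r\<bar> \<le> 3 / \<epsilon>\<^sup>2" for r
  proof -
    let ?s = "sabs \<epsilon> r"
    have s: "0 < ?s" by (rule sabs_pos)
    have "\<bar>?d r\<bar> = 3 * \<epsilon>\<^sup>2 * \<bar>sabs' \<epsilon> r\<bar> / ?s ^ 4"
      using s by (simp add: abs_mult abs_divide field_simps eval_nat_numeral)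
    also have "\<dots> \<le> 3 * \<epsilon>\<^sup>2 * 1 / \<epsilon> ^ 4"
      using eps s eps_le_sabs[of r] abs_sabs'_le[of r]
      by (intro frac_le mult_mono power_mono) auto
    also have "\<dots> = 3 / \<epsilon>\<^sup>2" using eps by (simp add: field_simps eval_nat_numeral)
    finally show ?thesis .
  qed
  ultimately show "dist (sabs'' \<epsilon> a) (sabs'' \<epsilon> b) \<le> 3 / \<epsilon>\<^sup>2 * dist a b"
    using field_differentiable_bound[of UNIV "sabs'' \<epsilon>" ?d "3 / \<epsilon>\<^sup>2" a b]
    by (simp add: dist_norm)
qed simp

lemma continuous_sabs'': "continuous_on UNIV (sabs'' \<epsilon>)"
  by (rule lipschitz_on_continuous_on[OF lipschitz_sabs''])

end

section \<open>Integral inequalities in time\<close>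

text \<open>Uniform continuity on a compact time interval supplies the step length \<open>d\<close>.\<close>

lemma short_step_induct:
  fixes T d :: real
  assumes "0 < d" "P 0"
    and step: "\<And>s t. \<lbrakk>0 \<le> s; s \<le> t; t \<le> T; t - s < d; P s\<rbrakk> \<Longrightarrow> P t"
    and t: "0 \<le> t" "t \<le> T"
  shows "P t"
proof -
  have "t \<le> real n * (d / 2) \<Longrightarrow> 0 \<le> t \<Longrightarrow> t \<le> T \<Longrightarrow> P t" for n t
  proof (induction n arbitrary: t)
    case 0
    with \<open>P 0\<close> show ?case by simp
  next
    case (Suc n)
    define s where "s = max 0 (t - d / 2)"
    have "P s"
    proof (rule Suc.IH)
      have "0 \<le> real n * (d / 2)" using \<open>0 < d\<close> by simp
      moreover have "t - d / 2 \<le> real n * (d / 2)"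
        using Suc.prems(1) by (simp add: algebra_simps)
      ultimately show "s \<le> real n * (d / 2)" unfolding s_def by (rule max.boundedI)
    qed (use Suc.prems \<open>0 < d\<close> in \<open>auto simp: s_def\<close>)
    then show ?case
      by (rule step[rotated 4]) (use Suc.prems \<open>0 < d\<close> in \<open>auto simp: s_def\<close>)
  qed
  moreover have "t \<le> real (nat \<lceil>t / (d / 2)\<rceil>) * (d / 2)"
    using \<open>0 < d\<close> real_nat_ceiling_ge[of "t / (d / 2)"] by (simp add: pos_divide_le_eq)
  ultimately show ?thesis using t by blast
qed

lemma integral_lebesgue_on_point [simp]: "integral\<^sup>L (lebesgue_on {c}) f = (0 :: real)" for c :: real
  using has_bochner_integral_null[of "{c}" f] by (simp add: has_bochner_integral_iff)

lemma borel_measurable_Icc_continuous: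
  fixes c :: "real \<Rightarrow> real"
  assumes "continuous_on {a..b} c"
  shows "c \<in> borel_measurable (lebesgue_on {a..b})"
  by (rule continuous_imp_measurable_on_sets_lebesgue[OF assms]) simp

lemma integrable_times_continuous:
  fixes g c :: "real \<Rightarrow> real"
  assumes g: "integrable (lebesgue_on {a..b}) g" and c: "continuous_on {a..b} c"
  shows "integrable (lebesgue_on {a..b}) (\<lambda>s. g s * c s)"
proof -
  have "bounded (c ` {a..b})"
    by (intro compact_imp_bounded compact_continuous_image c) simp
  then obtain K where K: "\<And>s. s \<in> {a..b} \<Longrightarrow> \<bar>c s\<bar> \<le> K"
    unfolding bounded_iff by force
  show ?thesis
  proof (rule Bochner_Integration.integrable_bound)
    show "integrable (lebesgue_on {a..b}) (\<lambda>s. K * g s)" using g by simp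
    show "(\<lambda>s. g s * c s) \<in> borel_measurable (lebesgue_on {a..b})"
      using borel_measurable_integrable[OF g] borel_measurable_Icc_continuous[OF c] by (rule borel_measurable_times)
    have "\<bar>g s * c s\<bar> \<le> \<bar>K * g s\<bar>" if "s \<in> {a..b}" for s
    proof -
      have "\<bar>g s\<bar> * \<bar>c s\<bar> \<le> \<bar>g s\<bar> * \<bar>K\<bar>"
        using K[OF that] by (intro mult_left_mono) auto
      then show ?thesis by (simp add: abs_mult mult.commute)
    qed
    then show "AE s in lebesgue_on {a..b}. norm (g s * c s) \<le> norm (K * g s)"
      by (auto intro!: AE_I2)
  qed
qed

lemma integrable_Icc_continuous:
  fixes c :: "real \<Rightarrow> real"
  assumes "continuous_on {a..b} c"
  shows "integrable (lebesgue_on {a..b}) c"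
proof -
  have "integrable (lebesgue_on {a..b}) (\<lambda>_. 1 :: real)"
    by (simp add: finite_measure.integrable_const finite_measure_lebesgue_on)
  from integrable_times_continuous[OF this assms] show ?thesis by simp
qed

text \<open>A chain rule for absolutely continuous arguments, as an inequality. A subgradient at the
  right end point of each short interval replaces the derivative, so no differentiation almost
  everywhere is involved: freezing \<open>\<theta> j\<close> on intervals of length \<open>d\<close> costs at most \<open>\<eta> \<integral>\<bar>\<gamma> j\<bar>\<close>.\<close>

lemma subgradient_chain_rule:
  fixes \<Psi> :: "real \<Rightarrow> real" and \<theta> \<gamma> :: "'j \<Rightarrow> real \<Rightarrow> real"
  assumes J: "finite J"
    and \<theta>: "\<And>j. j \<in> J \<Longrightarrow> continuous_on {0..T} (\<theta> j)"
    and \<gamma>: "\<And>j. j \<in> J \<Longrightarrow> integrable (lebesgue_on {0..T}) (\<gamma> j)"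
    and sub: "\<And>s t. \<lbrakk>0 \<le> s; s \<le> t; t \<le> T\<rbrakk> \<Longrightarrow>
      \<Psi> t - \<Psi> s \<le> (\<Sum>j\<in>J. \<theta> j t * integral\<^sup>L (lebesgue_on {s..t}) (\<gamma> j))"
    and t: "0 \<le> t" "t \<le> T"
  shows "\<Psi> t - \<Psi> 0 \<le> (\<integral>s. (\<Sum>j\<in>J. \<gamma> j s * \<theta> j s) \<partial>lebesgue_on {0..t})"
proof -
  define F where "F s = (\<Sum>j\<in>J. \<gamma> j s * \<theta> j s)" for s
  define G where "G s = (\<Sum>j\<in>J. \<bar>\<gamma> j s\<bar>)" for s
  have sub_int: "integrable (lebesgue_on {a..b}) f"
    if "integrable (lebesgue_on {0..T}) f" "0 \<le> a" "b \<le> T" for a b and f :: "real \<Rightarrow> real"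
    by (rule integrable_subinterval[OF that(1)]) (use that in auto)
  have F: "integrable (lebesgue_on {0..T}) F" and G: "integrable (lebesgue_on {0..T}) G"
    unfolding F_def G_def
    by (rule Bochner_Integration.integrable_sum, simp add: integrable_times_continuous \<gamma> \<theta>)+
  have key: "\<Psi> t - \<Psi> 0 - integral\<^sup>L (lebesgue_on {0..t}) F \<le> \<eta> * integral\<^sup>L (lebesgue_on {0..t}) G"
    if eta: "0 < \<eta>" for \<eta>
  proof -
    have "\<exists>d>0. \<forall>s\<in>{0..T}. \<forall>t\<in>{0..T}. dist t s < d \<longrightarrow> dist (\<theta> j t) (\<theta> j s) < \<eta>" if "j \<in> J" for j
      using compact_uniformly_continuous[OF \<theta>[OF that]] eta
      unfolding uniformly_continuous_on_def by fastforce
    then obtain d where d: "\<And>j. j \<in> J \<Longrightarrow> 0 < d j"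
      "\<And>j s t. \<lbrakk>j \<in> J; s \<in> {0..T}; t \<in> {0..T}; dist t s < d j\<rbrakk> \<Longrightarrow> dist (\<theta> j t) (\<theta> j s) < \<eta>"
      by metis
    define d0 where "d0 = Min (insert 1 (d ` J))"
    have d0: "0 < d0" and d0_le: "\<And>j. j \<in> J \<Longrightarrow> d0 \<le> d j"
      using J d(1) by (auto simp: d0_def)
    define R where "R t = \<Psi> t - integral\<^sup>L (lebesgue_on {0..t}) F - \<eta> * integral\<^sup>L (lebesgue_on {0..t}) G" for t
    have "R t \<le> R 0"
    proof (rule short_step_induct[where P = "\<lambda>t. R t \<le> R 0", OF d0 order_refl _ t])
      fix s t assume st: "0 \<le> s" "s \<le> t" "t \<le> T" "t - s < d0" and IH: "R s \<le> R 0"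
      have i\<gamma>: "integrable (lebesgue_on {s..t}) (\<gamma> j)" if "j \<in> J" for j
        using sub_int[OF \<gamma>[OF that]] st by simp
      have iF: "integrable (lebesgue_on {s..t}) F" and iG: "integrable (lebesgue_on {s..t}) G"
        using sub_int[OF F] sub_int[OF G] st by simp_all
      have "\<Psi> t - \<Psi> s \<le> (\<Sum>j\<in>J. \<theta> j t * integral\<^sup>L (lebesgue_on {s..t}) (\<gamma> j))"
        by (rule sub) (use st in auto)
      also have "\<dots> = (\<integral>r. (\<Sum>j\<in>J. \<theta> j t * \<gamma> j r) \<partial>lebesgue_on {s..t})"
        using i\<gamma> by simp
      also have "\<dots> \<le> (\<integral>r. F r + \<eta> * G r \<partial>lebesgue_on {s..t})"
      proof (rule integral_mono)
        show "integrable (lebesgue_on {s..t}) (\<lambda>r. \<Sum>j\<in>J. \<theta> j t * \<gamma> j r)" using i\<gamma> by simp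
        show "integrable (lebesgue_on {s..t}) (\<lambda>r. F r + \<eta> * G r)" using iF iG by simp
        fix r assume "r \<in> space (lebesgue_on {s..t})"
        then have r: "s \<le> r" "r \<le> t" by auto
        have "\<theta> j t * \<gamma> j r \<le> \<gamma> j r * \<theta> j r + \<eta> * \<bar>\<gamma> j r\<bar>" if j: "j \<in> J" for j
        proof -
          have "dist (\<theta> j t) (\<theta> j r) < \<eta>"
            using d(2)[OF j, of r t] d0_le[OF j] r st by (auto simp: dist_real_def)
          then have "\<bar>\<theta> j t - \<theta> j r\<bar> * \<bar>\<gamma> j r\<bar> \<le> \<eta> * \<bar>\<gamma> j r\<bar>"
            by (intro mult_right_mono) (auto simp: dist_real_def)
          then have "(\<theta> j t - \<theta> j r) * \<gamma> j r \<le> \<eta> * \<bar>\<gamma> j r\<bar>"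
            unfolding abs_mult[symmetric] by linarith
          then show ?thesis by (simp add: algebra_simps)
        qed
        then have "(\<Sum>j\<in>J. \<theta> j t * \<gamma> j r) \<le> (\<Sum>j\<in>J. \<gamma> j r * \<theta> j r + \<eta> * \<bar>\<gamma> j r\<bar>)"
          by (rule sum_mono)
        then show "(\<Sum>j\<in>J. \<theta> j t * \<gamma> j r) \<le> F r + \<eta> * G r"
          by (simp add: F_def G_def sum.distrib sum_distrib_left)
      qed
      also have "\<dots> = integral\<^sup>L (lebesgue_on {s..t}) F + \<eta> * integral\<^sup>L (lebesgue_on {s..t}) G"
        using iF iG by simp
      finally have inc: "\<Psi> t - \<Psi> s \<le> integral\<^sup>L (lebesgue_on {s..t}) F + \<eta> * integral\<^sup>L (lebesgue_on {s..t}) G" .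
      have cF: "integral\<^sup>L (lebesgue_on {0..t}) F
          = integral\<^sup>L (lebesgue_on {0..s}) F + integral\<^sup>L (lebesgue_on {s..t}) F"
        by (rule Equivalence_Measurable_On_Borel.integral_combine) (use sub_int[OF F] st in auto)
      have cG: "integral\<^sup>L (lebesgue_on {0..t}) G
          = integral\<^sup>L (lebesgue_on {0..s}) G + integral\<^sup>L (lebesgue_on {s..t}) G"
        by (rule Equivalence_Measurable_On_Borel.integral_combine) (use sub_int[OF G] st in auto)
      have "R t \<le> R s"
        using inc unfolding R_def cF cG by (simp add: distrib_left)
      with IH show "R t \<le> R 0" by simp
    qed
    then show ?thesis by (simp add: R_def)
  qed
  let ?G = "integral\<^sup>L (lebesgue_on {0..t}) G"
  have G0: "0 \<le> ?G" by (intro Bochner_Integration.integral_nonneg) (simp add: G_def sum_nonneg)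
  have "\<Psi> t - \<Psi> 0 - integral\<^sup>L (lebesgue_on {0..t}) F \<le> 0"
  proof (rule field_le_epsilon)
    fix \<epsilon> :: real assume e: "0 < \<epsilon>"
    have "\<Psi> t - \<Psi> 0 - integral\<^sup>L (lebesgue_on {0..t}) F \<le> \<epsilon> / (?G + 1) * ?G"
      using G0 e by (intro key) (simp add: add_nonneg_pos)
    also have "\<dots> \<le> 0 + \<epsilon>"
      using G0 e by (simp add: field_simps)
    finally show "\<Psi> t - \<Psi> 0 - integral\<^sup>L (lebesgue_on {0..t}) F \<le> 0 + \<epsilon>" .
  qed
  then show ?thesis by (simp add: F_def[abs_def])
qed

text \<open>The coefficient \<open>a\<close> is merely integrable. On intervals where its integral is less than
  \<open>1/2\<close>, the maximum of \<open>E\<close> is at most half of itself.\<close>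

lemma gronwall_zero:
  fixes E a :: "real \<Rightarrow> real"
  assumes E: "continuous_on {0..T} E" and E0: "\<And>t. t \<in> {0..T} \<Longrightarrow> 0 \<le> E t"
    and a: "integrable (lebesgue_on {0..T}) a" and a0: "\<And>t. 0 \<le> a t"
    and le: "\<And>t. t \<in> {0..T} \<Longrightarrow> E t \<le> (\<integral>s. a s * E s \<partial>lebesgue_on {0..t})"
    and t: "0 \<le> t" "t \<le> T"
  shows "E t = 0"
proof -
  define A where "A t = integral\<^sup>L (lebesgue_on {0..t}) a" for t
  have sub_int: "integrable (lebesgue_on {c..b}) f"
    if "integrable (lebesgue_on {0..T}) f" "0 \<le> c" "b \<le> T" for b c and f :: "real \<Rightarrow> real"
    by (rule integrable_subinterval[OF that(1)]) (use that in auto)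
  have "continuous_on {0..T} A"
    unfolding A_def by (rule indefinite_integral_continuous_real[OF a])
  then have "uniformly_continuous_on {0..T} A" by (rule compact_uniformly_continuous) simp
  then obtain d where d: "0 < d" "\<And>s t. \<lbrakk>s \<in> {0..T}; t \<in> {0..T}; dist t s < d\<rbrakk> \<Longrightarrow> dist (A t) (A s) < 1 / 2"
    unfolding uniformly_continuous_on_def by (metis half_gt_zero zero_less_one)
  have aE: "integrable (lebesgue_on {0..T}) (\<lambda>s. a s * E s)"
    by (rule integrable_times_continuous[OF a E])
  have "\<forall>r\<in>{0..t}. E r = 0"
  proof (rule short_step_induct[where P = "\<lambda>t. \<forall>r\<in>{0..t}. E r = 0", OF d(1) _ _ t])
    have "0 \<in> {0..T}" using t by simp
    from le[OF this] E0[OF this] show "\<forall>r\<in>{0..0}. E r = 0" by simp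
  next
    fix s t assume st: "0 \<le> s" "s \<le> t" "t \<le> T" "t - s < d" and IH: "\<forall>r\<in>{0..s}. E r = 0"
    have "\<exists>m\<in>{0..t}. \<forall>r\<in>{0..t}. E r \<le> E m"
      by (rule continuous_attains_sup) (use st in \<open>auto intro: continuous_on_subset[OF E]\<close>)
    then obtain m where m: "0 \<le> m" "m \<le> t" and sup: "\<And>r. r \<in> {0..t} \<Longrightarrow> E r \<le> E m" by auto
    have Em: "E m \<le> 0"
    proof (cases "m \<le> s")
      case True
      with IH m show ?thesis by simp
    next
      case False
      have "E m \<le> (\<integral>r. a r * E r \<partial>lebesgue_on {0..m})"
        by (rule le) (use m st in auto)
      also have "\<dots> = (\<integral>r. a r * E r \<partial>lebesgue_on {0..s}) + (\<integral>r. a r * E r \<partial>lebesgue_on {s..m})"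
        by (rule Equivalence_Measurable_On_Borel.integral_combine)
          (use sub_int[OF aE] st m False in auto)
      also have "(\<integral>r. a r * E r \<partial>lebesgue_on {0..s}) = (\<integral>r. 0 \<partial>lebesgue_on {0..s})"
        by (rule Bochner_Integration.integral_cong) (use IH in auto)
      also have "(\<integral>r. a r * E r \<partial>lebesgue_on {s..m}) \<le> (\<integral>r. a r * E m \<partial>lebesgue_on {s..m})"
      proof (rule integral_mono)
        show "integrable (lebesgue_on {s..m}) (\<lambda>r. a r * E r)" using sub_int[OF aE] st m by simp
        show "integrable (lebesgue_on {s..m}) (\<lambda>r. a r * E m)" using sub_int[OF a, of s m] st m by simp
        show "a r * E r \<le> a r * E m" if "r \<in> space (lebesgue_on {s..m})" for r
          using that m st a0 by (intro mult_left_mono sup) auto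
      qed
      also have "\<dots> = (A m - A s) * E m"
      proof -
        have "A m = A s + integral\<^sup>L (lebesgue_on {s..m}) a"
          unfolding A_def
          by (rule Equivalence_Measurable_On_Borel.integral_combine)
            (use sub_int[OF a] st m False in auto)
        then show ?thesis using sub_int[OF a, of s m] st m by simp
      qed
      also have "\<dots> \<le> 1 / 2 * E m"
      proof (rule mult_right_mono)
        have "dist (A m) (A s) < 1 / 2"
          using d(2)[of s m] st m False by (simp add: dist_real_def)
        then show "A m - A s \<le> 1 / 2" unfolding dist_real_def by linarith
        show "0 \<le> E m" using E0 m st by simp
      qed
      finally show ?thesis by simp
    qed
    show "\<forall>r\<in>{0..t}. E r = 0"
    proof
      fix r assume r: "r \<in> {0..t}"
      show "E r = 0" using sup[OF r] Em E0[of r] r st by simp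
    qed
  qed
  with t show ?thesis by simp
qed

section \<open>The energy inequality for the projected solution\<close>

lemma continuous_on_fcoeff_sabs':
  fixes w :: "real \<Rightarrow> real ^ 'd \<Rightarrow> real"
  assumes eps: "0 < \<epsilon>" and c: "\<And>k \<alpha>. continuous_on S (\<lambda>t. fcoeff (w t) k \<alpha>)"
  shows "continuous_on S (\<lambda>t. fcoeff (\<lambda>x. sabs' \<epsilon> (trig_proj N (w t) x)) k \<alpha>)"
proof -
  have s: "continuous_on UNIV (sabs' \<epsilon>)" by (rule lipschitz_on_continuous_on[OF lipschitz_sabs'[OF eps]])
  have c1: "continuous_on (S \<times> cbox 0 1) (\<lambda>p. fcoeff (w (fst p)) k \<alpha>)" for k \<alpha>
    by (rule continuous_on_compose2[OF c]) (auto intro: continuous_intros)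
  have c2: "continuous_on (S \<times> cbox 0 (1 :: real ^ 'd)) (\<lambda>p. mode k \<alpha> (snd p))" for k \<alpha>
    by (rule continuous_on_compose2[OF continuous_mode]) (auto intro: continuous_intros)
  have "continuous_on (S \<times> cbox 0 1) (\<lambda>(t, x). sabs' \<epsilon> (trig_proj N (w t) x) * mode k \<alpha> x)"
    unfolding trig_proj_def case_prod_unfold
    by (intro continuous_on_mult continuous_on_compose2[OF s] continuous_on_sum c1 c2) auto
  then have "continuous_on S (\<lambda>t. integral (cbox 0 1) (\<lambda>x. sabs' \<epsilon> (trig_proj N (w t) x) * mode k \<alpha> x))"
    by (rule integral_continuous_on_param)
  moreover have "fcoeff (\<lambda>x. sabs' \<epsilon> (trig_proj N (w t) x)) k \<alpha>
      = integral (cbox 0 1) (\<lambda>x. sabs' \<epsilon> (trig_proj N (w t) x) * mode k \<alpha> x)" for t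
    unfolding fcoeff_def
    by (rule integral_torus_continuous)
      (intro continuous_on_mult continuous_mode continuous_on_compose2[OF s continuous_trig_proj], simp)
  ultimately show ?thesis by simp
qed

text \<open>By \<open>co\<close> at time \<open>0\<close> the projected function starts from zero, where \<open>sabs\<close> equals
  \<open>\<epsilon>\<close>. Convexity of \<open>sabs\<close> provides the subgradient for \<open>subgradient_chain_rule\<close>.\<close>

lemma energy_inequality:
  fixes w :: "real \<Rightarrow> real ^ 'd \<Rightarrow> real"
  assumes eps: "0 < \<epsilon>"
    and w: "\<And>t. t \<in> {0..T} \<Longrightarrow> w t \<in> square_integrable torus"
    and \<gamma>: "\<And>k \<alpha>. integrable (lebesgue_on {0..T}) (\<gamma> k \<alpha>)"
    and co: "\<And>k \<alpha> t. t \<in> {0..T} \<Longrightarrow> fcoeff (w t) k \<alpha> = integral\<^sup>L (lebesgue_on {0..t}) (\<gamma> k \<alpha>)"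
    and t: "0 \<le> t" "t \<le> T"
  shows "(\<integral>x. sabs \<epsilon> (trig_proj N (w t) x) \<partial>torus) \<le> \<epsilon> +
    (\<integral>s. (\<Sum>(k, \<alpha>)\<in>modes N. \<gamma> k \<alpha> s * fcoeff (\<lambda>x. sabs' \<epsilon> (trig_proj N (w s) x)) k \<alpha>)
      \<partial>lebesgue_on {0..t})"
proof -
  define \<Psi> where "\<Psi> t = (\<integral>x. sabs \<epsilon> (trig_proj N (w t) x) \<partial>torus)" for t
  define \<theta> where "\<theta> j t = fcoeff (\<lambda>x. sabs' \<epsilon> (trig_proj N (w t) x)) (fst j) (snd j)" for j t
  have c_sabs: "continuous_on UNIV (sabs \<epsilon>)" by (rule lipschitz_on_continuous_on[OF lipschitz_sabs[OF eps]])
  have c_sabs': "continuous_on UNIV (sabs' \<epsilon>)" by (rule lipschitz_on_continuous_on[OF lipschitz_sabs'[OF eps]])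
  have c1: "continuous_on UNIV (\<lambda>x. sabs \<epsilon> (trig_proj N (w t) x))"
    and c2: "continuous_on UNIV (\<lambda>x. sabs' \<epsilon> (trig_proj N (w t) x))" for t
    by (rule continuous_on_compose2[OF c_sabs continuous_trig_proj]
        continuous_on_compose2[OF c_sabs' continuous_trig_proj], simp)+
  have cc: "continuous_on {0..T} (\<lambda>t. fcoeff (w t) k \<alpha>)" for k \<alpha>
    using indefinite_integral_continuous_real[OF \<gamma>, of k \<alpha>]
    by (rule continuous_on_eq) (simp add: co)
  have "\<Psi> t - \<Psi> 0 \<le> (\<integral>s. (\<Sum>j\<in>modes N. \<gamma> (fst j) (snd j) s * \<theta> j s) \<partial>lebesgue_on {0..t})"
  proof (rule subgradient_chain_rule[OF finite_modes _ \<gamma> _ t])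
    show "continuous_on {0..T} (\<theta> j)" for j
      unfolding \<theta>_def by (rule continuous_on_fcoeff_sabs'[OF eps cc])
    fix s t assume st: "0 \<le> s" "s \<le> t" "t \<le> T"
    let ?Pt = "trig_proj N (w t)" and ?Ps = "trig_proj N (w s)"
    let ?g = "\<lambda>x. sabs' \<epsilon> (?Pt x)"
    have i1: "integrable torus (\<lambda>x. ?Pt x * ?g x)" "integrable torus (\<lambda>x. ?Ps x * ?g x)"
      by (intro integrable_torus_continuous continuous_on_mult continuous_trig_proj c2)+
    have gs: "?g \<in> square_integrable torus" by (rule square_integrable_torus_continuous[OF c2])
    have "\<Psi> t - \<Psi> s = (\<integral>x. sabs \<epsilon> (?Pt x) - sabs \<epsilon> (?Ps x) \<partial>torus)"
      by (simp add: \<Psi>_def integrable_torus_continuous[OF c1])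
    also have "\<dots> \<le> (\<integral>x. ?Pt x * ?g x - ?Ps x * ?g x \<partial>torus)"
    proof (rule integral_mono)
      show "integrable torus (\<lambda>x. sabs \<epsilon> (?Pt x) - sabs \<epsilon> (?Ps x))"
        by (intro Bochner_Integration.integrable_diff integrable_torus_continuous[OF c1])
      show "integrable torus (\<lambda>x. ?Pt x * ?g x - ?Ps x * ?g x)"
        by (rule Bochner_Integration.integrable_diff[OF i1])
      show "sabs \<epsilon> (?Pt x) - sabs \<epsilon> (?Ps x) \<le> ?Pt x * ?g x - ?Ps x * ?g x" for x
        using sabs_convex[OF eps, of "?Pt x" "?Ps x"] by (simp add: algebra_simps)
    qed
    also have "\<dots> = (\<integral>x. ?Pt x * ?g x \<partial>torus) - (\<integral>x. ?Ps x * ?g x \<partial>torus)"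
      by (rule Bochner_Integration.integral_diff[OF i1])
    also have "\<dots> = (\<Sum>(k, \<alpha>)\<in>modes N. (fcoeff (w t) k \<alpha> - fcoeff (w s) k \<alpha>) * fcoeff ?g k \<alpha>)"
      by (simp add: integral_trig_proj_mult[OF gs] case_prod_unfold sum_subtractf left_diff_distrib)
    also have "\<dots> = (\<Sum>j\<in>modes N. \<theta> j t * integral\<^sup>L (lebesgue_on {s..t}) (\<gamma> (fst j) (snd j)))"
    proof (unfold case_prod_unfold, rule sum.cong[OF refl])
      fix j :: "('d \<Rightarrow> int) \<times> real"
      have "integral\<^sup>L (lebesgue_on {0..t}) (\<gamma> (fst j) (snd j)) = integral\<^sup>L (lebesgue_on {0..s}) (\<gamma> (fst j) (snd j))
          + integral\<^sup>L (lebesgue_on {s..t}) (\<gamma> (fst j) (snd j))"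
        by (rule Equivalence_Measurable_On_Borel.integral_combine[OF integrable_subinterval[OF \<gamma>]])
          (use st in auto)
      then show "(fcoeff (w t) (fst j) (snd j) - fcoeff (w s) (fst j) (snd j)) * fcoeff ?g (fst j) (snd j)
          = \<theta> j t * integral\<^sup>L (lebesgue_on {s..t}) (\<gamma> (fst j) (snd j))"
        using st by (simp add: co \<theta>_def)
    qed
    finally show "\<Psi> t - \<Psi> s \<le> (\<Sum>j\<in>modes N. \<theta> j t * integral\<^sup>L (lebesgue_on {s..t}) (\<gamma> (fst j) (snd j)))" .
  qed
  moreover have "\<Psi> 0 = \<epsilon>"
  proof -
    have "trig_proj N (w 0) x = 0" for x
      using t by (simp add: trig_proj_def co)
    then show ?thesis by (simp add: \<Psi>_def sabs_0[OF eps])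
  qed
  ultimately show ?thesis by (simp add: \<Psi>_def \<theta>_def case_prod_unfold)
qed

section \<open>The coefficients\<close>

text \<open>The hypotheses on the coefficients, with names for the constants in them.\<close>

locale coefficients =
  fixes B :: "real \<Rightarrow> real ^ 'd" and A :: "real \<Rightarrow> real ^ 'd ^ 'd" and \<sigma> :: "nat \<Rightarrow> real \<Rightarrow> real"
    and e :: "nat \<Rightarrow> 'u::real_inner" and L K \<delta> C :: real
  assumes B_lip: "L-lipschitz_on UNIV B" and A_lip: "L-lipschitz_on UNIV A"
    and A_le: "\<And>y. norm (A y) \<le> K"
    and \<delta>_pos: "0 < \<delta>" and coercive: "\<And>y \<xi>. \<delta> * (\<xi> \<bullet> \<xi>) \<le> \<xi> \<bullet> (A y *v \<xi>)"
    and \<sigma>_summable: "\<And>y. summable (\<lambda>k. (\<sigma> k y)\<^sup>2)"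
    and \<sigma>_growth: "\<And>y. (\<Sum>k. (\<sigma> k y)\<^sup>2) \<le> C * (1 + y\<^sup>2)"
    and \<sigma>_diff_summable: "\<And>y z. summable (\<lambda>k. (\<sigma> k y - \<sigma> k z)\<^sup>2)"
    and \<sigma>_lip: "\<And>y z. (\<Sum>k. (\<sigma> k y - \<sigma> k z)\<^sup>2) \<le> C * (y - z)\<^sup>2"
    and basis: "orthonormal_basis e" and hyp: "hypothesis_H B A \<sigma>"

lemma hypothesis_H_coefficients:
  assumes "hypothesis_H B A \<sigma>" "orthonormal_basis e"
  obtains L K \<delta> C where "coefficients B A \<sigma> e L K \<delta> C"
proof -
  obtain LB LA where L: "LB-lipschitz_on UNIV B" "LA-lipschitz_on UNIV A"
    using assms(1) unfolding hypothesis_H_def C1_lip_def by blast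
  obtain K where K: "\<And>y. norm (A y) \<le> K"
    using assms(1) unfolding hypothesis_H_def bounded_iff by blast
  obtain \<delta> where \<delta>: "0 < \<delta>" "\<And>y \<xi>. \<delta> * (\<xi> \<bullet> \<xi>) \<le> \<xi> \<bullet> (A y *v \<xi>)"
    using assms(1) unfolding hypothesis_H_def by blast
  obtain C where
    C: "\<And>y. summable (\<lambda>k. (\<sigma> k y)\<^sup>2)" "\<And>y. (\<Sum>k. (\<sigma> k y)\<^sup>2) \<le> C * (1 + y\<^sup>2)"
       "\<And>y z. summable (\<lambda>k. (\<sigma> k y - \<sigma> k z)\<^sup>2)" "\<And>y z. (\<Sum>k. (\<sigma> k y - \<sigma> k z)\<^sup>2) \<le> C * (y - z)\<^sup>2"
    using assms(1) unfolding hypothesis_H_def power2_abs by blast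
  have "coefficients B A \<sigma> e (max LB LA) K \<delta> C"
    by unfold_locales
      (use K \<delta> C assms in \<open>auto intro: lipschitz_on_le[OF L(1)] lipschitz_on_le[OF L(2)]\<close>)
  then show thesis by (rule that)
qed

lemma norm_matrix_vector_mult_le:
  fixes M :: "real ^ 'n ^ 'm"
  shows "norm (M *v x) \<le> CARD('m) * norm M * norm x"
proof -
  have "norm (M *v x) \<le> (\<Sum>i\<in>UNIV. \<bar>(M *v x) $ i\<bar>)" by (rule norm_le_l1_cart)
  also have "\<dots> \<le> (\<Sum>i\<in>(UNIV :: 'm set). norm M * norm x)"
  proof (rule sum_mono)
    fix i
    have "\<bar>(M *v x) $ i\<bar> \<le> norm (M $ i) * norm x"
      by (simp add: matrix_vector_mul_component Cauchy_Schwarz_ineq2)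
    also have "\<dots> \<le> norm M * norm x"
      by (intro mult_right_mono Finite_Cartesian_Product.norm_nth_le) auto
    finally show "\<bar>(M *v x) $ i\<bar> \<le> norm M * norm x" .
  qed
  also have "\<dots> = CARD('m) * norm M * norm x" by simp
  finally show ?thesis .
qed

lemma continuous_on_matrix_vector_mult:
  "continuous_on S (\<lambda>p :: (real ^ 'n ^ 'm) \<times> (real ^ 'n). fst p *v snd p)"
  unfolding matrix_vector_mult_def by (intro continuous_intros)

context coefficients
begin

lemma L_nonneg: "0 \<le> L" using B_lip by (rule lipschitz_on_nonneg)

lemma K_nonneg: "0 \<le> K" using A_le[of 0] norm_ge_zero[of "A 0"] by linarith

lemma C_nonneg: "0 \<le> C"
proof -
  have "0 \<le> (\<Sum>k. (\<sigma> k 0)\<^sup>2)" by (intro suminf_nonneg \<sigma>_summable) auto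
  with \<sigma>_growth[of 0] show ?thesis by simp
qed

lemma B_diff_le: "norm (B y - B z) \<le> L * \<bar>y - z\<bar>"
  using lipschitz_onD[OF B_lip, of y z] by (simp add: dist_norm)

lemma A_diff_le: "norm (A y - A z) \<le> L * \<bar>y - z\<bar>"
  using lipschitz_onD[OF A_lip, of y z] by (simp add: dist_norm)

lemma A_vec_le: "norm (A y *v \<xi>) \<le> real CARD('d) * K * norm \<xi>"
  by (rule order_trans[OF norm_matrix_vector_mult_le])
    (use A_le in \<open>auto intro!: mult_right_mono mult_left_mono\<close>)

lemma A_diff_vec_le: "norm ((A y - A z) *v \<xi>) \<le> real CARD('d) * (L * \<bar>y - z\<bar>) * norm \<xi>"
  by (rule order_trans[OF norm_matrix_vector_mult_le])
    (intro mult_right_mono mult_left_mono A_diff_le; simp)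

definition flux :: "real \<Rightarrow> real ^ 'd \<Rightarrow> real ^ 'd" where
  "flux y \<xi> = B y - A y *v \<xi>"

definition flux_const :: real where
  "flux_const = L\<^sup>2 * (1 + (real CARD('d))\<^sup>2) / (2 * \<delta>)"

lemma flux_const_nonneg: "0 \<le> flux_const"
  using \<delta>_pos by (simp add: flux_const_def add_nonneg_nonneg)

text \<open>Ellipticity absorbs the gradient of the difference. What remains is quadratic in \<open>y - z\<close> and
  involves only the gradient of the second solution.\<close>

lemma flux_diff_inner_le:
  "(flux y \<xi> - flux z \<eta>) \<bullet> (\<xi> - \<eta>) \<le> flux_const * (y - z)\<^sup>2 * (1 + (norm \<eta>)\<^sup>2)"
proof -
  define W r q where "W = \<xi> - \<eta>" and "r = norm W" and "q = L * \<bar>y - z\<bar> * (1 + real CARD('d) * norm \<eta>)"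
  have "flux y \<xi> - flux z \<eta> = (B y - B z) - A y *v W - (A y - A z) *v \<eta>"
    by (simp add: flux_def W_def matrix_vector_mult_diff_distrib matrix_vector_mult_diff_rdistrib)
  then have "(flux y \<xi> - flux z \<eta>) \<bullet> W
      = (B y - B z) \<bullet> W - W \<bullet> (A y *v W) - ((A y - A z) *v \<eta>) \<bullet> W"
    by (simp add: inner_diff_left inner_commute[of "A y *v W" W])
  also have "\<dots> \<le> norm (B y - B z) * r - \<delta> * r\<^sup>2 + norm ((A y - A z) *v \<eta>) * r"
  proof -
    have "(B y - B z) \<bullet> W \<le> norm (B y - B z) * r"
      unfolding r_def by (rule norm_cauchy_schwarz)
    moreover have "- (((A y - A z) *v \<eta>) \<bullet> W) \<le> norm ((A y - A z) *v \<eta>) * r"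
      using norm_cauchy_schwarz[of "- ((A y - A z) *v \<eta>)" W] by (simp add: r_def)
    moreover have "\<delta> * r\<^sup>2 \<le> W \<bullet> (A y *v W)"
      using coercive[of W y] by (simp add: r_def power2_norm_eq_inner)
    ultimately show ?thesis by linarith
  qed
  also have "\<dots> \<le> q * r - \<delta> * r\<^sup>2"
  proof -
    have "norm (B y - B z) * r + norm ((A y - A z) *v \<eta>) * r
        \<le> L * \<bar>y - z\<bar> * r + real CARD('d) * (L * \<bar>y - z\<bar>) * norm \<eta> * r"
      by (intro add_mono mult_right_mono B_diff_le A_diff_vec_le) (simp_all add: r_def)
    also have "\<dots> = q * r" by (simp add: q_def algebra_simps)
    finally show ?thesis by linarith
  qed
  also have "\<dots> \<le> q\<^sup>2 / (4 * \<delta>)"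
  proof -
    have "0 \<le> (q - 2 * \<delta> * r)\<^sup>2" by simp
    then have "4 * \<delta> * (q * r - \<delta> * r\<^sup>2) \<le> q\<^sup>2"
      by (simp add: power2_eq_square algebra_simps)
    then show ?thesis using \<delta>_pos by (simp add: pos_le_divide_eq mult.commute)
  qed
  also have "\<dots> \<le> flux_const * (y - z)\<^sup>2 * (1 + (norm \<eta>)\<^sup>2)"
  proof -
    have "(1 + real CARD('d) * norm \<eta>)\<^sup>2 \<le> 2 * (1 + (real CARD('d) * norm \<eta>)\<^sup>2)"
      using sum_squares_bound[of 1 "real CARD('d) * norm \<eta>"] by (simp add: power2_sum)
    also have "\<dots> \<le> 2 * ((1 + (real CARD('d))\<^sup>2) * (1 + (norm \<eta>)\<^sup>2))"
      by (simp add: power_mult_distrib algebra_simps)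
    finally have "L\<^sup>2 * (y - z)\<^sup>2 * (1 + real CARD('d) * norm \<eta>)\<^sup>2
        \<le> L\<^sup>2 * (y - z)\<^sup>2 * (2 * ((1 + (real CARD('d))\<^sup>2) * (1 + (norm \<eta>)\<^sup>2)))"
      by (rule mult_left_mono) simp
    then have "q\<^sup>2 / (4 * \<delta>) \<le> L\<^sup>2 * (y - z)\<^sup>2 * (2 * ((1 + (real CARD('d))\<^sup>2) * (1 + (norm \<eta>)\<^sup>2))) / (4 * \<delta>)"
      using \<delta>_pos by (intro divide_right_mono) (simp_all add: q_def power_mult_distrib)
    also have "\<dots> = flux_const * (y - z)\<^sup>2 * (1 + (norm \<eta>)\<^sup>2)"
      using \<delta>_pos by (simp add: flux_const_def field_simps)
    finally show ?thesis .
  qed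
  finally show ?thesis by (simp add: W_def)
qed

lemma norm_flux_diff_le:
  "norm (flux y \<xi> - flux z \<eta>) \<le> L * \<bar>y - z\<bar> + real CARD('d) * K * norm \<xi> + real CARD('d) * K * norm \<eta>"
proof -
  have "norm (flux y \<xi> - flux z \<eta>) = norm ((B y - B z) - A y *v \<xi> + A z *v \<eta>)"
    by (simp add: flux_def algebra_simps)
  also have "\<dots> \<le> norm (B y - B z) + norm (A y *v \<xi>) + norm (A z *v \<eta>)"
    by (meson add_right_mono norm_triangle_ineq norm_triangle_ineq4 order_trans)
  finally show ?thesis using B_diff_le[of y z] A_vec_le[of y \<xi>] A_vec_le[of z \<eta>] by linarith
qed

lemma borel_measurable_A_vec:
  assumes "u \<in> borel_measurable M" "U \<in> borel_measurable M"
  shows "(\<lambda>x. A (u x) *v U x) \<in> borel_measurable M"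
proof (rule borel_measurable_continuous_Pair[OF _ assms(2) continuous_on_matrix_vector_mult])
  show "(\<lambda>x. A (u x)) \<in> borel_measurable M"
    by (rule borel_measurable_continuous_on[OF lipschitz_on_continuous_on[OF A_lip] assms(1)])
qed

lemma borel_measurable_B: 
  assumes "u \<in> borel_measurable M"
  shows "(\<lambda>x. B (u x)) \<in> borel_measurable M"
  by (rule borel_measurable_continuous_on[OF lipschitz_on_continuous_on[OF B_lip] assms])

end

section \<open>The energy balance at a fixed time\<close>

text \<open>The values \<open>u\<close>, \<open>v\<close> of two solutions at one time, their gradients, and the difference \<open>f\<close> of
  their noise terms, which is dominated by \<open>u - v\<close> with a factor depending on time.\<close>

locale solution_pair = coefficients B A \<sigma> e L K \<delta> C
  for B :: "real \<Rightarrow> real ^ 'd" and A :: "real \<Rightarrow> real ^ 'd ^ 'd" and \<sigma> :: "nat \<Rightarrow> real \<Rightarrow> real"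
    and e :: "nat \<Rightarrow> 'u::real_inner" and L K \<delta> C :: real +
  fixes u v f :: "real ^ 'd \<Rightarrow> real" and U V :: "real ^ 'd \<Rightarrow> real ^ 'd" and c :: real
  assumes u: "u \<in> square_integrable torus" and v: "v \<in> square_integrable torus"
    and U: "is_weak_grad u U" and V: "is_weak_grad v V"
    and f: "f \<in> borel_measurable torus" and f_le: "\<And>x. \<bar>f x\<bar> \<le> c * \<bar>u x - v x\<bar>"
begin

definition w :: "real ^ 'd \<Rightarrow> real" where "w x = u x - v x"
definition W :: "'d \<Rightarrow> real ^ 'd \<Rightarrow> real" where "W i x = U x $ i - V x $ i"
definition F :: "real ^ 'd \<Rightarrow> real ^ 'd" where "F x = flux (u x) (U x) - flux (v x) (V x)"

lemma U_sq: "U \<in> square_integrable torus" and V_sq: "V \<in> square_integrable torus"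
  using U V by (auto simp: is_weak_grad_def)

lemma w_sq: "w \<in> square_integrable torus"
  unfolding w_def[abs_def] by (rule square_integrable_diff[OF u v])

lemma W_sq: "W i \<in> square_integrable torus"
  unfolding W_def[abs_def] by (intro square_integrable_diff square_integrable_component U_sq V_sq)

lemma W_le: "L2_norm torus (W i) \<le> L2_norm torus U + L2_norm torus V"
proof -
  have "L2_norm torus (W i) \<le> L2_norm torus (\<lambda>x. U x $ i) + L2_norm torus (\<lambda>x. V x $ i)"
    unfolding W_def[abs_def]
    by (intro L2_norm_triangle_diff square_integrable_component U_sq V_sq)
  then show ?thesis
    using L2_norm_component_le[OF U_sq, of i] L2_norm_component_le[OF V_sq, of i] by linarith
qed

lemma w_le: "L2_norm torus w \<le> L2_norm torus u + L2_norm torus v"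
  unfolding w_def[abs_def] by (rule L2_norm_triangle_diff[OF u v])

lemma weak_partial_w: "weak_partial i w (W i)"
  unfolding w_def[abs_def] W_def[abs_def]
  by (intro weak_partial_diff weak_partial_weak_grad U V u v square_integrable_component U_sq V_sq)

lemma f_bound: "norm (f x) \<le> \<bar>c\<bar> * norm (w x)"
  using f_le[of x] mult_right_mono[OF abs_ge_self[of c] abs_ge_zero[of "w x"]] by (simp add: w_def)

lemmas f_sq = square_integrable_scaled_bound(1)[OF w_sq f abs_ge_zero f_bound]
  and f_norm_le = square_integrable_scaled_bound(2)[OF w_sq f abs_ge_zero f_bound]

lemma c_w_nonneg: "0 \<le> c * \<bar>w x\<bar>"
  using f_le[of x] abs_ge_zero[of "f x"] by (simp add: w_def)

definition F_bound :: "real ^ 'd \<Rightarrow> real" where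
  "F_bound x = L * \<bar>w x\<bar> + real CARD('d) * K * norm (U x) + real CARD('d) * K * norm (V x)"

lemma F_bound_sq: "F_bound \<in> square_integrable torus"
proof -
  have "(\<lambda>x. (L *\<^sub>R norm (w x) + (real CARD('d) * K) *\<^sub>R norm (U x)) + (real CARD('d) * K) *\<^sub>R norm (V x)) \<in> square_integrable torus"
    by (intro square_integrable_add square_integrable_cmult square_integrable_norm w_sq U_sq V_sq)
  then show ?thesis by (simp add: F_bound_def[abs_def])
qed

lemma norm_F_le: "norm (F x) \<le> F_bound x"
  unfolding F_def F_bound_def w_def by (rule norm_flux_diff_le)

lemma F_meas: "F \<in> borel_measurable torus"
  unfolding F_def[abs_def] flux_def
  by (intro borel_measurable_diff borel_measurable_A_vec borel_measurable_B
      square_integrableD(1)[OF u] square_integrableD(1)[OF v]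
      square_integrableD(1)[OF U_sq] square_integrableD(1)[OF V_sq])

lemma norm_F_le': "norm (F x) \<le> 1 * norm (F_bound x)"
  using norm_F_le[of x] by simp

lemmas F_sq = square_integrable_scaled_bound(1)[OF F_bound_sq F_meas zero_le_one norm_F_le']

lemma F_norm_le:
  "L2_norm torus F \<le> L * L2_norm torus w + real CARD('d) * K * L2_norm torus U + real CARD('d) * K * L2_norm torus V"
proof -
  let ?a = "\<lambda>x. L *\<^sub>R norm (w x)" and ?b = "\<lambda>x. (real CARD('d) * K) *\<^sub>R norm (U x)"
    and ?d = "\<lambda>x. (real CARD('d) * K) *\<^sub>R norm (V x)"
  have s: "?a \<in> square_integrable torus" "?b \<in> square_integrable torus" "?d \<in> square_integrable torus"
    by (intro square_integrable_cmult square_integrable_norm w_sq U_sq V_sq)+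
  have "L2_norm torus F \<le> L2_norm torus F_bound"
    using square_integrable_scaled_bound(2)[OF F_bound_sq F_meas zero_le_one norm_F_le'] by simp
  also have "F_bound = (\<lambda>x. (?a x + ?b x) + ?d x)" by (simp add: F_bound_def fun_eq_iff)
  also have "L2_norm torus (\<lambda>x. (?a x + ?b x) + ?d x)
      \<le> (L2_norm torus ?a + L2_norm torus ?b) + L2_norm torus ?d"
    using L2_norm_triangle[OF square_integrable_add[OF s(1,2)] s(3)] L2_norm_triangle[OF s(1,2)] by linarith
  also have "L2_norm torus ?a = L * L2_norm torus w"
    unfolding L2_norm_cmult L2_norm_norm using L_nonneg by simp
  also have "L2_norm torus ?b = real CARD('d) * K * L2_norm torus U"
    unfolding L2_norm_cmult L2_norm_norm using K_nonneg by simp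
  also have "L2_norm torus ?d = real CARD('d) * K * L2_norm torus V"
    unfolding L2_norm_cmult L2_norm_norm using K_nonneg by simp
  finally show ?thesis .
qed

text \<open>The time derivative of the regularised \<open>L\<^sup>1\<close> norm of the projected difference.\<close>

definition J :: "real \<Rightarrow> nat \<Rightarrow> real" where
  "J \<epsilon> N = (\<Sum>(k, \<alpha>)\<in>modes N.
    ((\<Sum>i\<in>UNIV. wave_number k i * fcoeff (\<lambda>x. F x $ i) k (\<alpha> + pi / 2)) + fcoeff f k \<alpha>)
      * fcoeff (\<lambda>x. sabs' \<epsilon> (trig_proj N w x)) k \<alpha>)"

context
  fixes \<epsilon> :: real
  assumes eps: "0 < \<epsilon>"
begin

lemma continuous_compose_proj:
  assumes "continuous_on UNIV \<psi>"
  shows "continuous_on UNIV (\<lambda>x. \<psi> (trig_proj N g x))"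
  by (rule continuous_on_compose2[OF assms continuous_trig_proj]) simp

lemma continuous_sabs': "continuous_on UNIV (sabs' \<epsilon>)"
  by (rule lipschitz_on_continuous_on[OF lipschitz_sabs'[OF eps]])

text \<open>All projections are moved onto the flux, the noise term and the gradient, where they
  converge.\<close>

lemma J_eq:
  "J \<epsilon> N = (\<Sum>i\<in>UNIV. \<integral>x. trig_proj N (\<lambda>x. F x $ i) x * trig_proj N (W i) x * sabs'' \<epsilon> (trig_proj N w x) \<partial>torus)
    + (\<integral>x. trig_proj N f x * sabs' \<epsilon> (trig_proj N w x) \<partial>torus)"
proof -
  let ?g = "\<lambda>x. sabs' \<epsilon> (trig_proj N w x)"
  let ?h = "\<lambda>i x. trig_proj N (W i) x * sabs'' \<epsilon> (trig_proj N w x)"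
  have g: "?g \<in> square_integrable torus"
    by (intro square_integrable_torus_continuous continuous_compose_proj continuous_sabs')
  have h: "?h i \<in> square_integrable torus" for i
    by (intro square_integrable_torus_continuous continuous_on_mult continuous_trig_proj
        continuous_compose_proj continuous_sabs''[OF eps])
  have wp: "weak_partial i ?g (?h i)" for i
    by (rule weak_partial_compose_trig_proj[OF weak_partial_w DERIV_sabs'[OF eps] continuous_sabs''[OF eps]])
  have "J \<epsilon> N = (\<Sum>i\<in>UNIV. \<Sum>(k, \<alpha>)\<in>modes N. wave_number k i * fcoeff (\<lambda>x. F x $ i) k (\<alpha> + pi / 2) * fcoeff ?g k \<alpha>)
      + (\<Sum>(k, \<alpha>)\<in>modes N. fcoeff f k \<alpha> * fcoeff ?g k \<alpha>)"
    unfolding J_def case_prod_unfold distrib_right sum.distrib sum_distrib_right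
    by (subst sum.swap) (rule refl)
  then show ?thesis
    unfolding sum_modes_flux[OF wp h] integral_trig_proj_mult[OF g] by (simp add: mult.assoc)
qed

text \<open>The bound is uniform in \<open>N\<close>: it dominates the energy balance in time.\<close>

lemma abs_J_le:
  "\<bar>J \<epsilon> N\<bar> \<le> real CARD('d) * (L2_norm torus F * (L2_norm torus U + L2_norm torus V) / \<epsilon>) + L2_norm torus f"
proof -
  have "\<bar>\<integral>x. trig_proj N (\<lambda>x. F x $ i) x * trig_proj N (W i) x * sabs'' \<epsilon> (trig_proj N w x) \<partial>torus\<bar>
      \<le> L2_norm torus F * (L2_norm torus U + L2_norm torus V) / \<epsilon>" for i
  proof -
    let ?h = "\<lambda>x. sabs'' \<epsilon> (trig_proj N w x) * trig_proj N (W i) x"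
    have pw: "trig_proj N (W i) \<in> square_integrable torus" by (rule square_integrable_trig_proj)
    have h: "?h \<in> square_integrable torus"
      by (intro square_integrable_torus_continuous continuous_on_mult continuous_trig_proj
        continuous_compose_proj continuous_sabs''[OF eps])
    have "L2_norm torus ?h \<le> 1 / \<epsilon> * L2_norm torus (trig_proj N (W i))"
      by (rule bounded_times_square_integrable(2)[OF pw _ abs_sabs''_le[OF eps]])
        (intro borel_measurable_torus_continuous continuous_compose_proj continuous_sabs''[OF eps])
    also have "\<dots> \<le> 1 / \<epsilon> * (L2_norm torus U + L2_norm torus V)"
      using eps L2_norm_trig_proj_le[OF W_sq, of N i] W_le[of i] by (intro mult_left_mono) auto
    finally have hle: "L2_norm torus ?h \<le> 1 / \<epsilon> * (L2_norm torus U + L2_norm torus V)" .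
    have Fi: "L2_norm torus (trig_proj N (\<lambda>x. F x $ i)) \<le> L2_norm torus F"
      using L2_norm_trig_proj_le[OF square_integrable_component[OF F_sq], of N i]
        L2_norm_component_le[OF F_sq, of i] by linarith
    have "\<bar>\<integral>x. trig_proj N (\<lambda>x. F x $ i) x * ?h x \<partial>torus\<bar>
        \<le> L2_norm torus (trig_proj N (\<lambda>x. F x $ i)) * L2_norm torus ?h"
      by (rule integral_mult_le_L2_norm[OF square_integrable_trig_proj h])
    also have "\<dots> \<le> L2_norm torus F * (1 / \<epsilon> * (L2_norm torus U + L2_norm torus V))"
      by (rule mult_mono[OF Fi hle]) auto
    finally show ?thesis by (simp add: ac_simps)
  qed
  then have 1: "\<bar>\<Sum>i\<in>UNIV. \<integral>x. trig_proj N (\<lambda>x. F x $ i) x * trig_proj N (W i) x * sabs'' \<epsilon> (trig_proj N w x) \<partial>torus\<bar>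
      \<le> real CARD('d) * (L2_norm torus F * (L2_norm torus U + L2_norm torus V) / \<epsilon>)"
    by (intro order_trans[OF sum_abs] order_trans[OF sum_bounded_above]) auto
  have g: "(\<lambda>x. sabs' \<epsilon> (trig_proj N w x)) \<in> square_integrable torus"
    by (intro square_integrable_torus_continuous continuous_compose_proj continuous_sabs')
  have "\<bar>\<integral>x. trig_proj N f x * sabs' \<epsilon> (trig_proj N w x) \<partial>torus\<bar>
      \<le> L2_norm torus (trig_proj N f) * L2_norm torus (\<lambda>x. sabs' \<epsilon> (trig_proj N w x))"
    by (rule integral_mult_le_L2_norm[OF square_integrable_trig_proj g])
  also have "\<dots> \<le> L2_norm torus f * 1"
    by (intro mult_mono L2_norm_trig_proj_le[OF f_sq] L2_norm_torus_le_bound abs_sabs'_le[OF eps]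
        square_integrableD(1)[OF g]) auto
  finally have 2: "\<bar>\<integral>x. trig_proj N f x * sabs' \<epsilon> (trig_proj N w x) \<partial>torus\<bar> \<le> L2_norm torus f" by simp
  show ?thesis unfolding J_eq by (rule order_trans[OF abs_triangle_ineq add_mono[OF 1 2]])
qed

lemma J_limit:
  "J \<epsilon> \<longlonglongrightarrow> (\<integral>x. (F x \<bullet> (U x - V x)) * sabs'' \<epsilon> (w x) \<partial>torus) + (\<integral>x. f x * sabs' \<epsilon> (w x) \<partial>torus)"
proof -
  note lim = trig_proj_tendsto
  note one = square_integrable_torus_const[of 1]
  have Fi: "(\<lambda>x. F x $ i) \<in> square_integrable torus" for i by (rule square_integrable_component[OF F_sq])
  have 1: "(\<lambda>N. \<integral>x. trig_proj N (\<lambda>x. F x $ i) x * trig_proj N (W i) x * sabs'' \<epsilon> (trig_proj N w x) \<partial>torus)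
      \<longlonglongrightarrow> (\<integral>x. F x $ i * W i x * sabs'' \<epsilon> (w x) \<partial>torus)" for i
    by (rule tendsto_integral_triple[OF finite_measure_torus square_integrable_trig_proj Fi
          square_integrable_trig_proj W_sq square_integrable_trig_proj w_sq lim[OF Fi] lim[OF W_sq] lim[OF w_sq]
          lipschitz_sabs''[OF eps] abs_sabs''_le[OF eps]])
  have z: "(\<lambda>n::nat. L2_norm torus (\<lambda>x :: real ^ 'd. 1 - 1 :: real)) \<longlonglongrightarrow> 0" by (simp add: L2_norm_def)
  have 2: "(\<lambda>N. \<integral>x. trig_proj N f x * 1 * sabs' \<epsilon> (trig_proj N w x) \<partial>torus)
      \<longlonglongrightarrow> (\<integral>x. f x * 1 * sabs' \<epsilon> (w x) \<partial>torus)"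
    by (rule tendsto_integral_triple[OF finite_measure_torus square_integrable_trig_proj f_sq
          one one square_integrable_trig_proj w_sq lim[OF f_sq] z lim[OF w_sq]
          lipschitz_sabs'[OF eps] abs_sabs'_le[OF eps]])
  have s: "sabs'' \<epsilon> \<in> borel_measurable borel"
    by (rule borel_measurable_continuous_onI[OF continuous_sabs''[OF eps]])
  have int: "integrable torus (\<lambda>x. F x $ i * W i x * sabs'' \<epsilon> (w x))" for i
  proof -
    have "(\<lambda>x. sabs'' \<epsilon> (w x) * W i x) \<in> square_integrable torus"
      by (rule bounded_times_square_integrable(1)[OF W_sq measurable_compose[OF square_integrableD(1)[OF w_sq] s] abs_sabs''_le[OF eps]])
    from integrable_mult_square_integrable[OF Fi[of i] this] show ?thesis by (simp add: ac_simps)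
  qed
  have "J \<epsilon> \<longlonglongrightarrow> (\<Sum>i\<in>UNIV. \<integral>x. F x $ i * W i x * sabs'' \<epsilon> (w x) \<partial>torus) + (\<integral>x. f x * sabs' \<epsilon> (w x) \<partial>torus)"
    unfolding J_eq[abs_def] by (rule tendsto_add[OF tendsto_sum[OF 1] 2[unfolded mult_1_right]])
  also have "(\<Sum>i\<in>UNIV. \<integral>x. F x $ i * W i x * sabs'' \<epsilon> (w x) \<partial>torus)
      = (\<integral>x. (\<Sum>i\<in>UNIV. F x $ i * W i x * sabs'' \<epsilon> (w x)) \<partial>torus)"
    by (rule Bochner_Integration.integral_sum[symmetric]) (rule int)
  also have "\<dots> = (\<integral>x. (F x \<bullet> (U x - V x)) * sabs'' \<epsilon> (w x) \<partial>torus)"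
    by (simp add: inner_vec_def W_def sum_distrib_right)
  finally show ?thesis .
qed

text \<open>The dangerous factor \<open>sabs''\<close>, of size \<open>1/\<epsilon>\<close>, only meets \<open>w\<^sup>2\<close>, and \<open>w\<^sup>2 sabs'' \<le> \<epsilon>\<close>. This is
  what allows merely Lipschitz coefficients in the second order term.\<close>

lemma J_limit_le:
  "(\<integral>x. (F x \<bullet> (U x - V x)) * sabs'' \<epsilon> (w x) \<partial>torus) + (\<integral>x. f x * sabs' \<epsilon> (w x) \<partial>torus)
    \<le> \<epsilon> * flux_const * (1 + (L2_norm torus V)\<^sup>2) + c * (\<integral>x. \<bar>w x\<bar> \<partial>torus)"
proof -
  have wi: "integrable torus (\<lambda>x. \<bar>w x\<bar>)"
    by (intro integrable_abs integrable_if_square_integrable finite_measure_torus w_sq)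
  have ci: "integrable torus (\<lambda>x :: real ^ 'd. 1 :: real)"
    by (rule integrable_torus_continuous[OF continuous_on_const])
  have vi: "integrable torus (\<lambda>x. \<epsilon> * flux_const * (1 + (norm (V x))\<^sup>2))"
    using ci square_integrableD(2)[OF V_sq] by simp
  have 1: "(\<integral>x. (F x \<bullet> (U x - V x)) * sabs'' \<epsilon> (w x) \<partial>torus)
      \<le> (\<integral>x. \<epsilon> * flux_const * (1 + (norm (V x))\<^sup>2) \<partial>torus)"
  proof (rule integral_mono')
    show "integrable torus (\<lambda>x. \<epsilon> * flux_const * (1 + (norm (V x))\<^sup>2))" by (rule vi)
    fix x
    have "(F x \<bullet> (U x - V x)) * sabs'' \<epsilon> (w x)
        \<le> (flux_const * (w x)\<^sup>2 * (1 + (norm (V x))\<^sup>2)) * sabs'' \<epsilon> (w x)"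
      unfolding F_def w_def by (rule mult_right_mono[OF flux_diff_inner_le sabs''_nonneg[OF eps]])
    also have "\<dots> = ((w x)\<^sup>2 * sabs'' \<epsilon> (w x)) * (flux_const * (1 + (norm (V x))\<^sup>2))"
      by (simp add: ac_simps)
    also have "\<dots> \<le> \<epsilon> * (flux_const * (1 + (norm (V x))\<^sup>2))"
      using flux_const_nonneg by (intro mult_right_mono square_mult_sabs''_le[OF eps]) (simp add: add_nonneg_nonneg)
    finally show "(F x \<bullet> (U x - V x)) * sabs'' \<epsilon> (w x) \<le> \<epsilon> * flux_const * (1 + (norm (V x))\<^sup>2)"
      by (simp add: mult.assoc)
    show "0 \<le> \<epsilon> * flux_const * (1 + (norm (V x))\<^sup>2)"
      using eps flux_const_nonneg by (simp add: add_nonneg_nonneg)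
  qed
  have 2: "(\<integral>x. f x * sabs' \<epsilon> (w x) \<partial>torus) \<le> (\<integral>x. c * \<bar>w x\<bar> \<partial>torus)"
  proof (rule integral_mono')
    show "integrable torus (\<lambda>x. c * \<bar>w x\<bar>)" using wi by simp
    fix x
    have "f x * sabs' \<epsilon> (w x) \<le> \<bar>f x\<bar> * \<bar>sabs' \<epsilon> (w x)\<bar>"
      unfolding abs_mult[symmetric] by (rule abs_ge_self)
    also have "\<dots> \<le> \<bar>f x\<bar> * 1" by (intro mult_left_mono abs_sabs'_le[OF eps]) simp
    also have "\<dots> \<le> c * \<bar>w x\<bar>" using f_le[of x] by (simp add: w_def)
    finally show "f x * sabs' \<epsilon> (w x) \<le> c * \<bar>w x\<bar>" .
  qed (rule c_w_nonneg)
  have 3: "(\<integral>x. \<epsilon> * flux_const * (1 + (norm (V x))\<^sup>2) \<partial>torus) = \<epsilon> * flux_const * (1 + (L2_norm torus V)\<^sup>2)"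
    using ci square_integrableD(2)[OF V_sq] by (simp add: L2_norm_power2)
  have 4: "(\<integral>x. c * \<bar>w x\<bar> \<partial>torus) = c * (\<integral>x. \<bar>w x\<bar> \<partial>torus)" by simp
  show ?thesis using add_mono[OF 1 2] unfolding 3 4 .
qed

end

end

section \<open>Sobolev functions and time measurability\<close>

lemma is_weak_grad_weak_grad: "f \<in> H1 \<Longrightarrow> is_weak_grad f (weak_grad f)"
  unfolding H1_def weak_grad_def using someI_ex[of "is_weak_grad f"] by blast

lemma H1_square_integrable: "f \<in> H1 \<Longrightarrow> f \<in> square_integrable torus"
  by (simp add: H1_def)

lemma weak_grad_square_integrable: "f \<in> H1 \<Longrightarrow> weak_grad f \<in> square_integrable torus"
  using is_weak_grad_weak_grad by (auto simp: is_weak_grad_def)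

lemma H1_norm_nonneg [simp]: "0 \<le> H1_norm f"
  by (simp add: H1_norm_def)

lemma L2_norm_le_H1_norm: "L2_norm torus f \<le> H1_norm f"
  unfolding H1_norm_def by (rule real_le_rsqrt) simp

lemma L2_norm_weak_grad_le_H1_norm: "L2_norm torus (weak_grad f) \<le> H1_norm f"
  unfolding H1_norm_def by (rule real_le_rsqrt) simp

lemma H1_diff:
  fixes f g :: "real ^ 'd \<Rightarrow> real"
  assumes f: "f \<in> H1" and g: "g \<in> H1"
  shows "(\<lambda>x. f x - g x) \<in> H1"
proof -
  note fs = H1_square_integrable[OF f] and gs = H1_square_integrable[OF g]
  let ?G = "\<lambda>x. weak_grad f x - weak_grad g x"
  have G: "?G \<in> square_integrable torus"
    by (intro square_integrable_diff weak_grad_square_integrable f g)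
  have "is_weak_grad (\<lambda>x. f x - g x) ?G"
    unfolding is_weak_grad_def
  proof (intro conjI G ballI allI)
    fix \<phi> :: "real ^ 'd \<Rightarrow> real" and i
    assume \<phi>: "\<phi> \<in> smooth_torus"
    have C: "C_diff 2 \<phi>" using \<phi> by (simp add: smooth_torus_def)
    have \<phi>c: "continuous_on UNIV \<phi>"
      using C by (auto simp: numeral_2_eq_2 intro!: continuous_at_imp_continuous_on differentiable_imp_continuous_within)
    have pc: "continuous_on UNIV (partial i \<phi>)"
      using C by (auto simp: numeral_2_eq_2 intro!: continuous_at_imp_continuous_on differentiable_imp_continuous_within)
    note ps = square_integrable_torus_continuous[OF pc] and \<phi>s = square_integrable_torus_continuous[OF \<phi>c]
    have ff: "(\<integral>x. f x * partial i \<phi> x \<partial>torus) = - (\<integral>x. weak_grad f x $ i * \<phi> x \<partial>torus)"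
      using is_weak_grad_weak_grad[OF f] \<phi> unfolding is_weak_grad_def by blast
    have gg: "(\<integral>x. g x * partial i \<phi> x \<partial>torus) = - (\<integral>x. weak_grad g x $ i * \<phi> x \<partial>torus)"
      using is_weak_grad_weak_grad[OF g] \<phi> unfolding is_weak_grad_def by blast
    have "(\<integral>x. (f x - g x) * partial i \<phi> x \<partial>torus)
        = (\<integral>x. f x * partial i \<phi> x \<partial>torus) - (\<integral>x. g x * partial i \<phi> x \<partial>torus)"
      unfolding left_diff_distrib
      by (rule Bochner_Integration.integral_diff[OF integrable_mult_square_integrable[OF fs ps]
            integrable_mult_square_integrable[OF gs ps]])
    moreover have "(\<integral>x. ?G x $ i * \<phi> x \<partial>torus)
        = (\<integral>x. weak_grad f x $ i * \<phi> x \<partial>torus) - (\<integral>x. weak_grad g x $ i * \<phi> x \<partial>torus)"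
      unfolding vector_minus_component left_diff_distrib
      by (intro Bochner_Integration.integral_diff integrable_mult_square_integrable \<phi>s
          square_integrable_component weak_grad_square_integrable f g)
    ultimately show "(\<integral>x. (f x - g x) * partial i \<phi> x \<partial>torus) = - (\<integral>x. ?G x $ i * \<phi> x \<partial>torus)"
      by (simp only: ff gg)
  qed
  then show ?thesis
    using square_integrable_diff[OF fs gs] unfolding H1_def by blast
qed

text \<open>The chosen representatives of the weak gradients are linear up to null sets.\<close>

lemma L2_norm_weak_grad_component_diff_le:
  fixes f g :: "real ^ 'd \<Rightarrow> real"
  assumes f: "f \<in> H1" and g: "g \<in> H1"
  shows "L2_norm torus (\<lambda>x. weak_grad f x $ i - weak_grad g x $ i) \<le> H1_norm (\<lambda>x. f x - g x)"
proof -
  let ?d = "\<lambda>x. f x - g x"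
  note d = H1_diff[OF f g]
  have c: "(\<lambda>x. weak_grad u x $ i) \<in> square_integrable torus" if "u \<in> H1" for u :: "real ^ 'd \<Rightarrow> real"
    by (rule square_integrable_component[OF weak_grad_square_integrable[OF that]])
  have "AE x in torus. weak_grad f x $ i - weak_grad g x $ i = weak_grad ?d x $ i"
  proof (rule weak_partial_unique)
    show "weak_partial i ?d (\<lambda>x. weak_grad f x $ i - weak_grad g x $ i)"
      by (intro weak_partial_diff weak_partial_weak_grad is_weak_grad_weak_grad f g c H1_square_integrable)
    show "weak_partial i ?d (\<lambda>x. weak_grad ?d x $ i)"
      by (rule weak_partial_weak_grad[OF is_weak_grad_weak_grad[OF d]])
  qed (intro square_integrable_diff c f g d)+
  then have "L2_norm torus (\<lambda>x. weak_grad f x $ i - weak_grad g x $ i) = L2_norm torus (\<lambda>x. weak_grad ?d x $ i)"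
    by (intro L2_norm_cong_AE square_integrableD(1)[OF c[OF d]]
        square_integrableD(1)[OF square_integrable_diff[OF c[OF f] c[OF g]]])
  also have "\<dots> \<le> L2_norm torus (weak_grad ?d)"
    by (rule L2_norm_component_le[OF weak_grad_square_integrable[OF d]])
  also have "\<dots> \<le> H1_norm ?d" by (rule L2_norm_weak_grad_le_H1_norm)
  finally show ?thesis .
qed

text \<open>The Lebesgue measure is complete, so convergence almost everywhere suffices.\<close>

lemma borel_measurable_lebesgue_on_AE_limit:
  fixes f :: "real \<Rightarrow> real"
  assumes g: "\<And>n. g n \<in> borel_measurable (lebesgue_on {a..b})"
    and lim: "AE s in lebesgue_on {a..b}. (\<lambda>n. g n s) \<longlonglongrightarrow> f s"
  shows "f \<in> borel_measurable (lebesgue_on {a..b})"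
proof -
  let ?g = "\<lambda>s. lim (\<lambda>n. g n s)"
  have gm: "?g \<in> borel_measurable (lebesgue_on {a..b})"
    by (rule borel_measurable_lim_metric[OF g])
  have eq: "AE s in lebesgue. s \<in> {a..b} \<longrightarrow> ?g s = f s"
  proof -
    have "AE s in lebesgue_on {a..b}. ?g s = f s"
      using lim by eventually_elim (rule limI)
    then show ?thesis by (subst (asm) AE_restrict_space_iff) auto
  qed
  have "(\<lambda>s. if s \<in> {a..b} then f s else 0) \<in> borel_measurable lebesgue"
  proof (rule borel_measurable_AE)
    show "(\<lambda>s. if s \<in> {a..b} then ?g s else 0) \<in> borel_measurable lebesgue"
      using gm by (subst borel_measurable_if) auto
    show "AE s in lebesgue. (if s \<in> {a..b} then ?g s else 0) = (if s \<in> {a..b} then f s else 0)"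
      using eq by eventually_elim auto
  qed
  then show ?thesis by (subst (asm) borel_measurable_if) auto
qed

lemma L2_norm_mode_le_1: "L2_norm torus (mode k \<alpha>) \<le> 1"
  by (rule L2_norm_torus_le_bound[OF square_integrableD(1)[OF square_integrable_mode] abs_mode_le_1])

lemma abs_fcoeff_le:
  assumes "f \<in> square_integrable torus"
  shows "\<bar>fcoeff f k \<alpha>\<bar> \<le> L2_norm torus f"
proof -
  have "\<bar>fcoeff f k \<alpha>\<bar> \<le> L2_norm torus f * L2_norm torus (mode k \<alpha>)"
    unfolding fcoeff_def by (rule integral_mult_le_L2_norm[OF assms square_integrable_mode])
  also have "\<dots> \<le> L2_norm torus f * 1"
    by (rule mult_left_mono[OF L2_norm_mode_le_1 L2_norm_nonneg])
  finally show ?thesis by simp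
qed

lemma C_H_square_integrable: "u \<in> C_H T \<Longrightarrow> t \<in> {0..T} \<Longrightarrow> u t \<in> square_integrable torus"
  by (simp add: C_H_def)

lemma continuous_on_C_H:
  assumes u: "u \<in> C_H T"
    and le: "\<And>s t. s \<in> {0..T} \<Longrightarrow> t \<in> {0..T} \<Longrightarrow>
      \<bar>g s - g t\<bar> \<le> M * L2_norm torus (\<lambda>x. u s x - u t x)"
  shows "continuous_on {0..T} (g :: real \<Rightarrow> real)"
  unfolding continuous_on_def
proof
  fix t assume t: "t \<in> {0..T}"
  have "((\<lambda>s. L2_norm torus (\<lambda>x. u s x - u t x)) \<longlongrightarrow> 0) (at t within {0..T})"
    using u t by (simp add: C_H_def)
  then have "((\<lambda>s. M * L2_norm torus (\<lambda>x. u s x - u t x)) \<longlongrightarrow> 0) (at t within {0..T})"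
    by (rule tendsto_mult_right_zero)
  moreover have "\<forall>\<^sub>F s in at t within {0..T}. norm (g s - g t) \<le> M * L2_norm torus (\<lambda>x. u s x - u t x)"
    unfolding eventually_at_filter using le[OF _ t] by (auto intro!: always_eventually)
  ultimately have "((\<lambda>s. g s - g t) \<longlongrightarrow> 0) (at t within {0..T})"
    by (rule Lim_null_comparison[rotated])
  then show "(g \<longlongrightarrow> g t) (at t within {0..T})"
    by (simp add: LIM_zero_iff)
qed

lemma continuous_on_L2_norm_C_H:
  assumes "u \<in> C_H T"
  shows "continuous_on {0..T} (\<lambda>s. L2_norm torus (u s))"
  by (rule continuous_on_C_H[OF assms, of _ 1])
    (simp add: L2_norm_reverse_triangle C_H_square_integrable[OF assms])

lemma continuous_on_L1_diff:
  fixes u v :: "real \<Rightarrow> real ^ 'd \<Rightarrow> real"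
  assumes u: "u \<in> C_H T" and v: "v \<in> C_H T"
  shows "continuous_on {0..T} (\<lambda>s. \<integral>x. \<bar>u s x - v s x\<bar> \<partial>torus)"
proof -
  let ?w = "\<lambda>s x. u s x - v s x"
  have ws: "?w s \<in> square_integrable torus" if "s \<in> {0..T}" for s
    by (rule square_integrable_diff[OF C_H_square_integrable[OF u that] C_H_square_integrable[OF v that]])
  have d: "(\<lambda>x. u s x - u t x) \<in> square_integrable torus" "(\<lambda>x. v s x - v t x) \<in> square_integrable torus"
    if "s \<in> {0..T}" "t \<in> {0..T}" for s t
    using that by (intro square_integrable_diff C_H_square_integrable[OF u] C_H_square_integrable[OF v]; simp)+
  have le: "L2_norm torus (\<lambda>x. ?w s x - ?w t x)
      \<le> L2_norm torus (\<lambda>x. u s x - u t x) + L2_norm torus (\<lambda>x. v s x - v t x)"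
    if st: "s \<in> {0..T}" "t \<in> {0..T}" for s t
  proof -
    have "(\<lambda>x. ?w s x - ?w t x) = (\<lambda>x. (u s x - u t x) - (v s x - v t x))" by (simp add: fun_eq_iff)
    then show ?thesis using L2_norm_triangle_diff[OF d[OF st]] by simp
  qed
  have w: "?w \<in> C_H T"
    unfolding C_H_def
  proof (intro CollectI ballI conjI ws)
    fix t assume t: "t \<in> {0..T}"
    have lim: "((\<lambda>s. L2_norm torus (\<lambda>x. u s x - u t x) + L2_norm torus (\<lambda>x. v s x - v t x)) \<longlongrightarrow> 0)
        (at t within {0..T})"
      using u v t by (intro tendsto_add_zero) (auto simp: C_H_def)
    have "\<forall>\<^sub>F s in at t within {0..T}. norm (L2_norm torus (\<lambda>x. ?w s x - ?w t x))
        \<le> L2_norm torus (\<lambda>x. u s x - u t x) + L2_norm torus (\<lambda>x. v s x - v t x)"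
      unfolding eventually_at_filter using le[OF _ t] by (auto intro!: always_eventually)
    then show "((\<lambda>s. L2_norm torus (\<lambda>x. ?w s x - ?w t x)) \<longlongrightarrow> 0) (at t within {0..T})"
      by (rule Lim_null_comparison[OF _ lim])
  qed
  show ?thesis
  proof (rule continuous_on_C_H[OF w, of _ 1])
    fix s t assume s: "s \<in> {0..T}" and t: "t \<in> {0..T}"
    note ds = square_integrable_diff[OF ws[OF s] ws[OF t]]
    note i = integral_abs_le_L2_norm_torus(1)
    have "\<bar>(\<integral>x. \<bar>?w s x\<bar> \<partial>torus) - (\<integral>x. \<bar>?w t x\<bar> \<partial>torus)\<bar> = \<bar>\<integral>x. \<bar>?w s x\<bar> - \<bar>?w t x\<bar> \<partial>torus\<bar>"
      by (subst Bochner_Integration.integral_diff) (intro i ws s t refl)+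
    also have "\<dots> \<le> (\<integral>x. \<bar>\<bar>?w s x\<bar> - \<bar>?w t x\<bar>\<bar> \<partial>torus)" by (rule integral_abs_bound)
    also have "\<dots> \<le> (\<integral>x. \<bar>?w s x - ?w t x\<bar> \<partial>torus)"
      by (rule integral_mono)
        (use i[OF ds] Bochner_Integration.integrable_diff[OF i[OF ws[OF s]] i[OF ws[OF t]]] in auto)
    also have "\<dots> \<le> L2_norm torus (\<lambda>x. ?w s x - ?w t x)"
      by (rule integral_abs_le_L2_norm_torus(2)[OF ds])
    finally show "\<bar>(\<integral>x. \<bar>?w s x\<bar> \<partial>torus) - (\<integral>x. \<bar>?w t x\<bar> \<partial>torus)\<bar>
        \<le> 1 * L2_norm torus (\<lambda>x. ?w s x - ?w t x)" by simp
  qed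
qed

lemma lipschitz_compose_square_integrable:
  fixes \<psi> :: "real \<Rightarrow> real" and u :: "real ^ 'd \<Rightarrow> real"
  assumes lip: "M-lipschitz_on UNIV \<psi>" and u: "u \<in> square_integrable torus"
  shows "(\<lambda>x. \<psi> (u x)) \<in> square_integrable torus"
proof -
  have "(\<lambda>x. \<psi> (u x) - \<psi> 0) \<in> square_integrable torus"
  proof (rule square_integrable_scaled_bound(1)[OF u])
    have "(\<lambda>x. \<psi> (u x)) \<in> borel_measurable torus"
      by (rule borel_measurable_continuous_on[OF lipschitz_on_continuous_on[OF lip] square_integrableD(1)[OF u]])
    then show "(\<lambda>x. \<psi> (u x) - \<psi> 0) \<in> borel_measurable torus" by simp
    show "norm (\<psi> (u x) - \<psi> 0) \<le> M * norm (u x)" for x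
      using lipschitz_onD[OF lip, of "u x" 0] by (simp add: dist_real_def)
  qed (rule lipschitz_on_nonneg[OF lip])
  from square_integrable_add[OF this square_integrable_torus_const[of "\<psi> 0"]] show ?thesis by simp
qed

lemma continuous_on_fcoeff_lipschitz:
  fixes \<psi> :: "real \<Rightarrow> real"
  assumes u: "u \<in> C_H T" and lip: "M-lipschitz_on UNIV \<psi>"
  shows "continuous_on {0..T} (\<lambda>s. fcoeff (\<lambda>x. \<psi> (u s x)) k \<alpha>)"
proof (rule continuous_on_C_H[OF u, of _ M])
  fix s t assume s: "s \<in> {0..T}" and t: "t \<in> {0..T}"
  note us = C_H_square_integrable[OF u s] and ut = C_H_square_integrable[OF u t]
  note ps = lipschitz_compose_square_integrable[OF lip us] and pt = lipschitz_compose_square_integrable[OF lip ut]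
  have "\<bar>fcoeff (\<lambda>x. \<psi> (u s x)) k \<alpha> - fcoeff (\<lambda>x. \<psi> (u t x)) k \<alpha>\<bar>
      = \<bar>fcoeff (\<lambda>x. \<psi> (u s x) - \<psi> (u t x)) k \<alpha>\<bar>"
    by (simp add: fcoeff_diff[OF ps pt])
  also have "\<dots> \<le> L2_norm torus (\<lambda>x. \<psi> (u s x) - \<psi> (u t x))"
    by (rule abs_fcoeff_le[OF square_integrable_diff[OF ps pt]])
  also have "\<dots> \<le> M * L2_norm torus (\<lambda>x. u s x - u t x)"
    by (rule square_integrable_scaled_bound(2)[OF square_integrable_diff[OF us ut]
          square_integrableD(1)[OF square_integrable_diff[OF ps pt]] lipschitz_on_nonneg[OF lip]])
      (use lipschitz_onD[OF lip] in \<open>simp add: dist_real_def\<close>)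
  finally show "\<bar>fcoeff (\<lambda>x. \<psi> (u s x)) k \<alpha> - fcoeff (\<lambda>x. \<psi> (u t x)) k \<alpha>\<bar>
      \<le> M * L2_norm torus (\<lambda>x. u s x - u t x)" .
qed


context coefficients
begin

lemma B_component_lip: "L-lipschitz_on UNIV (\<lambda>y. B y $ i)"
proof (rule lipschitz_onI[OF _ L_nonneg])
  fix y z
  have "\<bar>(B y - B z) $ i\<bar> \<le> norm (B y - B z)" by (rule component_le_norm_cart)
  then show "dist (B y $ i) (B z $ i) \<le> L * dist y z"
    using B_diff_le[of y z] by (simp add: dist_real_def)
qed

lemma A_component_lip: "L-lipschitz_on UNIV (\<lambda>y. A y $ i $ j)"
proof (rule lipschitz_onI[OF _ L_nonneg])
  fix y z
  have "\<bar>(A y - A z) $ i $ j\<bar> \<le> norm ((A y - A z) $ i)" by (rule component_le_norm_cart)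
  also have "\<dots> \<le> norm (A y - A z)" by (rule Finite_Cartesian_Product.norm_nth_le)
  finally show "dist (A y $ i $ j) (A z $ i $ j) \<le> L * dist y z"
    using A_diff_le[of y z] by (simp add: dist_real_def)
qed

lemma A_component_le: "\<bar>A y $ i $ j\<bar> \<le> K"
  using component_le_norm_cart[of "A y $ i" j] Finite_Cartesian_Product.norm_nth_le[of "A y" i] A_le[of y]
  by linarith

lemma \<sigma>_component_lip: "(sqrt C)-lipschitz_on UNIV (\<sigma> k)"
proof (rule lipschitz_onI)
  fix y z
  have "(\<sigma> k y - \<sigma> k z)\<^sup>2 \<le> (\<Sum>k. (\<sigma> k y - \<sigma> k z)\<^sup>2)"
    using sum_le_suminf[OF \<sigma>_diff_summable, of "{k}" y z] by simp
  also note \<sigma>_lip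
  finally have "sqrt ((\<sigma> k y - \<sigma> k z)\<^sup>2) \<le> sqrt (C * (y - z)\<^sup>2)" by (rule real_sqrt_le_mono)
  then show "dist (\<sigma> k y) (\<sigma> k z) \<le> sqrt C * dist y z"
    by (simp add: dist_real_def real_sqrt_mult)
qed (use C_nonneg in simp)

lemma A_vec_square_integrable:
  assumes u: "u \<in> borel_measurable torus" and U: "U \<in> square_integrable torus"
  shows "(\<lambda>x. A (u x) *v U x) \<in> square_integrable torus"
    "L2_norm torus (\<lambda>x. A (u x) *v U x) \<le> real CARD('d) * K * L2_norm torus U"
proof -
  have "0 \<le> real CARD('d) * K" using K_nonneg by simp
  note bound = square_integrable_scaled_bound[OF U borel_measurable_A_vec[OF u square_integrableD(1)[OF U]] this A_vec_le]
  show "(\<lambda>x. A (u x) *v U x) \<in> square_integrable torus"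
    "L2_norm torus (\<lambda>x. A (u x) *v U x) \<le> real CARD('d) * K * L2_norm torus U"
    by (rule bound)+
qed

definition A_coeff :: "('d \<Rightarrow> int) \<Rightarrow> real \<Rightarrow> 'd \<Rightarrow> (real ^ 'd \<Rightarrow> real) \<Rightarrow> real" where
  "A_coeff k \<beta> i u = fcoeff (\<lambda>x. (A (u x) *v weak_grad u x) $ i) k \<beta>"

lemma A_coeff_eq:
  assumes u: "u \<in> H1"
  shows "A_coeff k \<beta> i u = (\<Sum>j\<in>UNIV. \<integral>x. weak_grad u x $ j * mode k \<beta> x * A (u x) $ i $ j \<partial>torus)"
proof -
  have "integrable torus (\<lambda>x. weak_grad u x $ j * mode k \<beta> x * A (u x) $ i $ j)" for j
  proof -
    have "(\<lambda>x. A (u x) $ i $ j * mode k \<beta> x) \<in> square_integrable torus"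
      by (rule bounded_times_square_integrable(1)[OF square_integrable_mode _ A_component_le])
        (rule borel_measurable_continuous_on[OF lipschitz_on_continuous_on[OF A_component_lip]
            square_integrableD(1)[OF H1_square_integrable[OF u]]])
    from integrable_mult_square_integrable[OF square_integrable_component[OF weak_grad_square_integrable[OF u], of j] this]
    show ?thesis by (simp add: ac_simps)
  qed
  then have "(\<Sum>j\<in>UNIV. \<integral>x. weak_grad u x $ j * mode k \<beta> x * A (u x) $ i $ j \<partial>torus)
      = (\<integral>x. (\<Sum>j\<in>UNIV. weak_grad u x $ j * mode k \<beta> x * A (u x) $ i $ j) \<partial>torus)"
    by (intro Bochner_Integration.integral_sum[symmetric])
  also have "\<dots> = A_coeff k \<beta> i u"
    unfolding A_coeff_def fcoeff_def matrix_vector_mult_def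
    by (intro Bochner_Integration.integral_cong refl) (simp add: sum_distrib_right sum_distrib_left ac_simps)
  finally show ?thesis by simp
qed

lemma A_coeff_tendsto:
  assumes u: "u \<in> H1" and g: "\<And>n. g n \<in> H1"
    and lim: "(\<lambda>n. H1_norm (\<lambda>x. u x - g n x)) \<longlonglongrightarrow> 0"
  shows "(\<lambda>n. A_coeff k \<beta> i (g n)) \<longlonglongrightarrow> A_coeff k \<beta> i u"
proof -
  have l1: "(\<lambda>n. L2_norm torus (\<lambda>x. g n x - u x)) \<longlonglongrightarrow> 0"
    unfolding L2_norm_minus_commute[of _ "g _"] by (rule L2_norm_tendsto_0I[OF L2_norm_le_H1_norm lim])
  have l2: "(\<lambda>n. L2_norm torus (\<lambda>x. weak_grad (g n) x $ j - weak_grad u x $ j)) \<longlonglongrightarrow> 0" for j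
  proof (rule L2_norm_tendsto_0I[OF _ lim])
    show "L2_norm torus (\<lambda>x. weak_grad (g n) x $ j - weak_grad u x $ j) \<le> H1_norm (\<lambda>x. u x - g n x)" for n
      using L2_norm_weak_grad_component_diff_le[OF u g, of j n]
      by (simp add: L2_norm_minus_commute[of torus "\<lambda>x. weak_grad u x $ j"])
  qed
  have l3: "(\<lambda>n::nat. L2_norm torus (\<lambda>x. mode k \<beta> x - mode k \<beta> x)) \<longlonglongrightarrow> 0" by (simp add: L2_norm_def)
  have c: "(\<lambda>x. weak_grad v x $ j) \<in> square_integrable torus" if "v \<in> H1" for j and v :: "real ^ 'd \<Rightarrow> real"
    by (rule square_integrable_component[OF weak_grad_square_integrable[OF that]])
  have "(\<lambda>n. \<integral>x. weak_grad (g n) x $ j * mode k \<beta> x * A (g n x) $ i $ j \<partial>torus)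
      \<longlonglongrightarrow> (\<integral>x. weak_grad u x $ j * mode k \<beta> x * A (u x) $ i $ j \<partial>torus)" for j
    by (rule tendsto_integral_triple[OF finite_measure_torus c[OF g] c[OF u] square_integrable_mode
          square_integrable_mode H1_square_integrable[OF g] H1_square_integrable[OF u] l2 l3 l1
          A_component_lip A_component_le])
  then show ?thesis
    unfolding A_coeff_eq[OF u] A_coeff_eq[OF g] by (rule tendsto_sum)
qed

lemma abs_A_coeff_le:
  assumes u: "u \<in> H1"
  shows "\<bar>A_coeff k \<beta> i u\<bar> \<le> real CARD('d) * K * H1_norm u"
proof -
  note s = A_vec_square_integrable[OF square_integrableD(1)[OF H1_square_integrable[OF u]] weak_grad_square_integrable[OF u]]
  have "\<bar>A_coeff k \<beta> i u\<bar> \<le> L2_norm torus (\<lambda>x. A (u x) *v weak_grad u x)"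
    unfolding A_coeff_def
    by (rule order_trans[OF abs_fcoeff_le[OF square_integrable_component[OF s(1)]] L2_norm_component_le[OF s(1)]])
  also have "\<dots> \<le> real CARD('d) * K * L2_norm torus (weak_grad u)" by (rule s(2))
  also have "\<dots> \<le> real CARD('d) * K * H1_norm u"
    using K_nonneg by (intro mult_left_mono L2_norm_weak_grad_le_H1_norm) simp
  finally show ?thesis .
qed

text \<open>Strong measurability in \<open>H\<^sup>1\<close> is what makes the second order term measurable in time: it is
  continuous on \<open>H\<^sup>1\<close>, hence an almost everywhere limit of simple functions.\<close>

lemma integrable_A_coeff:
  assumes u: "u \<in> L2_H1 T"
  shows "integrable (lebesgue_on {0..T}) (\<lambda>s. A_coeff k \<beta> i (u s))"
proof -
  have uH: "AE s in lebesgue_on {0..T}. u s \<in> H1"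
    and n: "(\<lambda>s. H1_norm (u s)) \<in> square_integrable (lebesgue_on {0..T})"
    using u by (auto simp: L2_H1_def)
  obtain g where g: "\<And>n::nat. simple_function (lebesgue_on {0..T}) (g n)" "\<And>n. g n ` {0..T} \<subseteq> H1"
    "AE s in lebesgue_on {0..T}. (\<lambda>n. H1_norm (\<lambda>x. u s x - g n s x)) \<longlonglongrightarrow> 0"
    using u unfolding L2_H1_def by blast
  have meas: "(\<lambda>s. A_coeff k \<beta> i (u s)) \<in> borel_measurable (lebesgue_on {0..T})"
  proof (rule borel_measurable_lebesgue_on_AE_limit)
    show "(\<lambda>s. A_coeff k \<beta> i (g n s)) \<in> borel_measurable (lebesgue_on {0..T})" for n
      by (rule borel_measurable_simple_function[OF simple_function_compose1[OF g(1)]])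
    show "AE s in lebesgue_on {0..T}. (\<lambda>n. A_coeff k \<beta> i (g n s)) \<longlonglongrightarrow> A_coeff k \<beta> i (u s)"
      using uH g(3) AE_space
    proof eventually_elim
      case (elim s)
      have "g n s \<in> H1" for n using g(2)[of n] elim(3) unfolding image_subset_iff by simp
      with elim show ?case by (intro A_coeff_tendsto)
    qed
  qed
  have fm: "finite_measure (lebesgue_on {0..T})" by (rule finite_measure_lebesgue_on) auto
  have "integrable (lebesgue_on {0..T}) (\<lambda>s. real CARD('d) * K * H1_norm (u s))"
    using integrable_if_square_integrable[OF fm n] by simp
  then show ?thesis
  proof (rule Bochner_Integration.integrable_bound[OF _ meas])
    show "AE s in lebesgue_on {0..T}. norm (A_coeff k \<beta> i (u s)) \<le> norm (real CARD('d) * K * H1_norm (u s))"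
      using uH by eventually_elim (use abs_A_coeff_le K_nonneg in \<open>simp add: abs_mult\<close>)
  qed
qed

text \<open>The noise operator is controlled pointwise by the Cauchy-Schwarz inequality in \<open>\<ell>\<^sup>2\<close>.\<close>

lemma sigma_partial_sum_le:
  "\<bar>\<Sum>j<n. (h \<bullet> e j) * \<sigma> j y\<bar> \<le> norm h * (sqrt C * (1 + \<bar>y\<bar>))"
proof -
  have "(\<Sum>j<n. (h \<bullet> e j) * \<sigma> j y)\<^sup>2 \<le> (\<Sum>j<n. (h \<bullet> e j)\<^sup>2) * (\<Sum>j<n. (\<sigma> j y)\<^sup>2)"
    by (rule Cauchy_Schwarz_ineq_sum)
  also have "\<dots> \<le> (norm h)\<^sup>2 * (C * (1 + \<bar>y\<bar>)\<^sup>2)"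
  proof (rule mult_mono)
    show "(\<Sum>j<n. (h \<bullet> e j)\<^sup>2) \<le> (norm h)\<^sup>2"
      using basis by (intro bessel_partial) (simp add: orthonormal_basis_def)
    have "(\<Sum>j<n. (\<sigma> j y)\<^sup>2) \<le> (\<Sum>j. (\<sigma> j y)\<^sup>2)" by (intro sum_le_suminf \<sigma>_summable) auto
    also have "\<dots> \<le> C * (1 + y\<^sup>2)" by (rule \<sigma>_growth)
    also have "\<dots> \<le> C * (1 + \<bar>y\<bar>)\<^sup>2"
      using C_nonneg by (intro mult_left_mono) (simp_all add: power2_sum)
    finally show "(\<Sum>j<n. (\<sigma> j y)\<^sup>2) \<le> C * (1 + \<bar>y\<bar>)\<^sup>2" .
  qed (auto intro: sum_nonneg)
  also have "\<dots> = (norm h * (sqrt C * (1 + \<bar>y\<bar>)))\<^sup>2"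
    using C_nonneg by (simp add: power_mult_distrib)
  finally have "\<bar>\<Sum>j<n. (h \<bullet> e j) * \<sigma> j y\<bar>\<^sup>2 \<le> (norm h * (sqrt C * (1 + \<bar>y\<bar>)))\<^sup>2" by simp
  then show ?thesis
    by (rule power2_le_imp_le) (use C_nonneg in simp)
qed

lemma sigma_partial_sum_LIMSEQ:
  "(\<lambda>n. \<Sum>j<n. (h \<bullet> e j) * \<sigma> j (u x)) \<longlonglongrightarrow> sigma_op e \<sigma> u h x"
  unfolding sigma_op_def
  by (rule summable_LIMSEQ[OF summable_rabs_cancel[OF sigma_op_abs_summable[OF basis hyp]]])

lemma abs_sigma_op_le: "\<bar>sigma_op e \<sigma> u h x\<bar> \<le> norm h * (sqrt C * (1 + \<bar>u x\<bar>))"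
  by (rule LIMSEQ_le_const2[OF tendsto_rabs[OF sigma_partial_sum_LIMSEQ]]) (use sigma_partial_sum_le in blast)

lemma sigma_op_diff_le:
  "\<bar>sigma_op e \<sigma> u h x - sigma_op e \<sigma> v h x\<bar> \<le> sqrt C * norm h * \<bar>u x - v x\<bar>"
proof -
  have s: "summable (\<lambda>k. (h \<bullet> e k) * \<sigma> k y)" for y
    by (rule summable_rabs_cancel[OF sigma_op_abs_summable[OF basis hyp]])
  have "sigma_op e \<sigma> u h x - sigma_op e \<sigma> v h x = (\<Sum>k. (h \<bullet> e k) * (\<sigma> k (u x) - \<sigma> k (v x)))"
    unfolding sigma_op_def by (simp add: suminf_diff[OF s s] right_diff_distrib)
  then have "(sigma_op e \<sigma> u h x - sigma_op e \<sigma> v h x)\<^sup>2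
      \<le> (\<Sum>k. (h \<bullet> e k)\<^sup>2) * (\<Sum>k. (\<sigma> k (u x) - \<sigma> k (v x))\<^sup>2)"
    using suminf_mult_square_le[OF bessel(1)[OF basis] \<sigma>_diff_summable] by simp
  also have "\<dots> \<le> (norm h)\<^sup>2 * (C * (u x - v x)\<^sup>2)"
    by (intro mult_mono bessel(2)[OF basis] \<sigma>_lip suminf_nonneg \<sigma>_diff_summable) auto
  also have "\<dots> = (sqrt C * norm h * \<bar>u x - v x\<bar>)\<^sup>2"
    using C_nonneg by (simp add: power_mult_distrib)
  finally have "\<bar>sigma_op e \<sigma> u h x - sigma_op e \<sigma> v h x\<bar>\<^sup>2 \<le> (sqrt C * norm h * \<bar>u x - v x\<bar>)\<^sup>2" by simp
  then show ?thesis by (rule power2_le_imp_le) (use C_nonneg in simp)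
qed

lemma sigma_op_square_integrable:
  fixes u :: "real ^ 'd \<Rightarrow> real"
  assumes "u \<in> square_integrable torus"
  shows "sigma_op e \<sigma> u h \<in> square_integrable torus"
  using sigma_op_bounded[OF basis hyp assms] by blast

text \<open>Each summand on the left is a continuous function of \<open>u\<close> times a linear function of \<open>h\<close>,
  which gives measurability in time of the limit.\<close>

lemma fcoeff_sigma_op_LIMSEQ:
  fixes u :: "real ^ 'd \<Rightarrow> real"
  assumes u: "u \<in> square_integrable torus"
  shows "(\<lambda>n. \<Sum>j<n. (h \<bullet> e j) * fcoeff (\<lambda>x. \<sigma> j (u x)) k \<alpha>) \<longlonglongrightarrow> fcoeff (sigma_op e \<sigma> u h) k \<alpha>"
proof -
  have s: "(\<lambda>x. \<sigma> j (u x)) \<in> square_integrable torus" for j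
    by (rule lipschitz_compose_square_integrable[OF \<sigma>_component_lip u])
  let ?S = "\<lambda>n x. (\<Sum>j<n. (h \<bullet> e j) * \<sigma> j (u x))"
  have eq: "(\<Sum>j<n. (h \<bullet> e j) * fcoeff (\<lambda>x. \<sigma> j (u x)) k \<alpha>) = (\<integral>x. ?S n x * mode k \<alpha> x \<partial>torus)" for n
    unfolding fcoeff_def sum_distrib_right
    by (subst Bochner_Integration.integral_sum) (simp_all add: integrable_mult_mode[OF s] mult.assoc)
  have one: "integrable torus (\<lambda>x :: real ^ 'd. 1 :: real)"
    by (rule integrable_torus_continuous[OF continuous_on_const])
  have "(\<lambda>n. \<integral>x. ?S n x * mode k \<alpha> x \<partial>torus) \<longlonglongrightarrow> (\<integral>x. sigma_op e \<sigma> u h x * mode k \<alpha> x \<partial>torus)"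
  proof (rule integral_dominated_convergence[where w = "\<lambda>x. norm h * (sqrt C * (1 + \<bar>u x\<bar>))"])
    show "integrable torus (\<lambda>x. norm h * (sqrt C * (1 + \<bar>u x\<bar>)))"
      using one integrable_if_square_integrable[OF finite_measure_torus u] by simp
    show "(\<lambda>x. sigma_op e \<sigma> u h x * mode k \<alpha> x) \<in> borel_measurable torus"
      by (rule borel_measurable_integrable[OF integrable_mult_mode[OF sigma_op_square_integrable[OF u]]])
    show "(\<lambda>x. ?S n x * mode k \<alpha> x) \<in> borel_measurable torus" for n
      by (intro borel_measurable_times borel_measurable_sum borel_measurable_const
          square_integrableD(1)[OF s] square_integrableD(1)[OF square_integrable_mode])
    show "AE x in torus. (\<lambda>n. ?S n x * mode k \<alpha> x) \<longlonglongrightarrow> sigma_op e \<sigma> u h x * mode k \<alpha> x"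
      by (intro AE_I2 tendsto_mult_right sigma_partial_sum_LIMSEQ)
    show "AE x in torus. norm (?S n x * mode k \<alpha> x) \<le> norm h * (sqrt C * (1 + \<bar>u x\<bar>))" for n
    proof (rule AE_I2)
      fix x
      have "\<bar>?S n x\<bar> * \<bar>mode k \<alpha> x\<bar> \<le> norm h * (sqrt C * (1 + \<bar>u x\<bar>)) * 1"
        by (rule mult_mono[OF sigma_partial_sum_le abs_mode_le_1]) (use C_nonneg in auto)
      then show "norm (?S n x * mode k \<alpha> x) \<le> norm h * (sqrt C * (1 + \<bar>u x\<bar>))"
        by (simp add: abs_mult)
    qed
  qed
  then show ?thesis unfolding eq by (simp add: fcoeff_def)
qed

lemma abs_fcoeff_sigma_op_le:
  fixes u :: "real ^ 'd \<Rightarrow> real"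
  assumes u: "u \<in> square_integrable torus"
  shows "\<bar>fcoeff (sigma_op e \<sigma> u h) k \<alpha>\<bar> \<le> norm h * (sqrt C * (1 + L2_norm torus u))"
proof -
  note one = square_integrable_torus_const[of 1, where 'd = 'd]
  note s = square_integrable_add[OF one square_integrable_norm[OF u]]
  have "\<bar>fcoeff (sigma_op e \<sigma> u h) k \<alpha>\<bar> \<le> L2_norm torus (sigma_op e \<sigma> u h)"
    by (rule abs_fcoeff_le[OF sigma_op_square_integrable[OF u]])
  also have "\<dots> \<le> (norm h * sqrt C) * L2_norm torus (\<lambda>x. 1 + norm (u x))"
    by (rule square_integrable_scaled_bound(2)[OF s square_integrableD(1)[OF sigma_op_square_integrable[OF u]]])
      (use abs_sigma_op_le[of u h] C_nonneg in \<open>auto simp: mult.assoc\<close>)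
  also have "\<dots> \<le> norm h * sqrt C * (L2_norm torus (\<lambda>x :: real ^ 'd. 1 :: real) + L2_norm torus (\<lambda>x. norm (u x)))"
    using C_nonneg by (intro mult_left_mono L2_norm_triangle one square_integrable_norm u) simp
  finally show ?thesis by (simp add: mult.assoc L2_norm_def)
qed

lemma integrable_fcoeff_sigma_op:
  fixes u :: "real \<Rightarrow> real ^ 'd \<Rightarrow> real"
  assumes u: "u \<in> C_H T" and h: "h \<in> square_integrable (lebesgue_on {0..T})"
  shows "integrable (lebesgue_on {0..T}) (\<lambda>s. fcoeff (sigma_op e \<sigma> (u s) (h s)) k \<alpha>)"
proof -
  have fm: "finite_measure (lebesgue_on {0..T})" by (rule finite_measure_lebesgue_on) auto
  have hn: "integrable (lebesgue_on {0..T}) (\<lambda>s. norm (h s))"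
    by (rule integrable_if_square_integrable[OF fm square_integrable_norm[OF h]])
  have he: "(\<lambda>s. h s \<bullet> e j) \<in> borel_measurable (lebesgue_on {0..T})" for j
    by (rule borel_measurable_continuous_on[OF _ square_integrableD(1)[OF h], where f = "\<lambda>y. y \<bullet> e j"])
      (intro continuous_intros)
  have meas: "(\<lambda>s. fcoeff (sigma_op e \<sigma> (u s) (h s)) k \<alpha>) \<in> borel_measurable (lebesgue_on {0..T})"
  proof (rule borel_measurable_LIMSEQ_real)
    show "(\<lambda>n. \<Sum>j<n. (h s \<bullet> e j) * fcoeff (\<lambda>x. \<sigma> j (u s x)) k \<alpha>) \<longlonglongrightarrow> fcoeff (sigma_op e \<sigma> (u s) (h s)) k \<alpha>"
      if "s \<in> space (lebesgue_on {0..T})" for s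
      using that by (intro fcoeff_sigma_op_LIMSEQ C_H_square_integrable[OF u]) simp
    show "(\<lambda>s. \<Sum>j<n. (h s \<bullet> e j) * fcoeff (\<lambda>x. \<sigma> j (u s x)) k \<alpha>) \<in> borel_measurable (lebesgue_on {0..T})" for n
      by (intro borel_measurable_sum borel_measurable_times he
          borel_measurable_Icc_continuous continuous_on_fcoeff_lipschitz[OF u \<sigma>_component_lip])
  qed
  have "integrable (lebesgue_on {0..T}) (\<lambda>s. norm (h s) * (sqrt C * (1 + L2_norm torus (u s))))"
    by (rule integrable_times_continuous[OF hn]) (intro continuous_intros continuous_on_L2_norm_C_H[OF u])
  then show ?thesis
  proof (rule Bochner_Integration.integrable_bound[OF _ meas])
    show "AE s in lebesgue_on {0..T}. norm (fcoeff (sigma_op e \<sigma> (u s) (h s)) k \<alpha>)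
        \<le> norm (norm (h s) * (sqrt C * (1 + L2_norm torus (u s))))"
    proof (rule AE_I2)
      fix s assume "s \<in> space (lebesgue_on {0..T})"
      then have "u s \<in> square_integrable torus" by (intro C_H_square_integrable[OF u]) simp
      from abs_fcoeff_sigma_op_le[OF this, of "h s" k \<alpha>]
      show "norm (fcoeff (sigma_op e \<sigma> (u s) (h s)) k \<alpha>)
          \<le> norm (norm (h s) * (sqrt C * (1 + L2_norm torus (u s))))"
        unfolding real_norm_def by (rule order_trans[OF _ abs_ge_self])
    qed
  qed
qed

section \<open>The equation tested with a Fourier mode\<close>

definition mode_rhs :: "(real \<Rightarrow> 'u) \<Rightarrow> (real \<Rightarrow> real ^ 'd \<Rightarrow> real) \<Rightarrow> ('d \<Rightarrow> int) \<Rightarrow> real \<Rightarrow> real \<Rightarrow> real" where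
  "mode_rhs h u k \<alpha> s =
    (\<Sum>i\<in>UNIV. wave_number k i * fcoeff (\<lambda>x. B (u s x) $ i) k (\<alpha> + pi / 2))
    - (\<Sum>i\<in>UNIV. wave_number k i * A_coeff k (\<alpha> + pi / 2) i (u s))
    + fcoeff (sigma_op e \<sigma> (u s) (h s)) k \<alpha>"

lemma integral_inner_grad_mode:
  assumes "\<And>i. (\<lambda>x. G x $ i) \<in> square_integrable torus"
  shows "(\<integral>x. G x \<bullet> grad (mode k \<alpha>) x \<partial>torus)
    = (\<Sum>i\<in>UNIV. wave_number k i * fcoeff (\<lambda>x. G x $ i) k (\<alpha> + pi / 2))"
proof -
  have "(\<integral>x. G x \<bullet> grad (mode k \<alpha>) x \<partial>torus)
      = (\<integral>x. (\<Sum>i\<in>UNIV. wave_number k i * (G x $ i * mode k (\<alpha> + pi / 2) x)) \<partial>torus)"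
    by (intro Bochner_Integration.integral_cong refl) (simp add: inner_vec_def grad_def partial_mode ac_simps)
  also have "\<dots> = (\<Sum>i\<in>UNIV. wave_number k i * fcoeff (\<lambda>x. G x $ i) k (\<alpha> + pi / 2))"
    by (simp add: fcoeff_def integrable_mult_mode[OF assms])
  finally show ?thesis .
qed

lemma AE_lebesgue_on_subinterval:
  assumes "AE s in lebesgue_on {a..b}. P s" "{c..d} \<subseteq> {a..b}"
  shows "AE s in lebesgue_on {c..d :: real}. P s"
proof -
  have "AE s in lebesgue. s \<in> {a..b} \<longrightarrow> P s" using assms(1) by (subst (asm) AE_restrict_space_iff) auto
  then have "AE s in lebesgue. s \<in> {c..d} \<longrightarrow> P s"
    by eventually_elim (use assms(2) in auto)
  then show ?thesis by (subst AE_restrict_space_iff) auto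
qed

lemma solution_mode_equation:
  assumes sol: "is_solution B A \<sigma> e T u0 h u" and h: "h \<in> square_integrable (lebesgue_on {0..T})"
  shows "integrable (lebesgue_on {0..T}) (mode_rhs h u k \<alpha>)"
    and "t \<in> {0..T} \<Longrightarrow>
      fcoeff (u t) k \<alpha> = fcoeff u0 k \<alpha> + integral\<^sup>L (lebesgue_on {0..t}) (mode_rhs h u k \<alpha>)"
proof -
  have u: "u \<in> C_H T" "u \<in> L2_H1 T" using sol by (auto simp: is_solution_def)
  have uH: "AE s in lebesgue_on {0..T}. u s \<in> H1" using u(2) by (simp add: L2_H1_def)
  define b where "b s = (\<Sum>i\<in>UNIV. wave_number k i * fcoeff (\<lambda>x. B (u s x) $ i) k (\<alpha> + pi / 2))" for s
  define a where "a s = (\<Sum>i\<in>UNIV. wave_number k i * A_coeff k (\<alpha> + pi / 2) i (u s))" for s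
  define z where "z s = fcoeff (sigma_op e \<sigma> (u s) (h s)) k \<alpha>" for s
  have bi: "integrable (lebesgue_on {0..T}) b"
    unfolding b_def
    by (intro integrable_Icc_continuous continuous_intros continuous_on_fcoeff_lipschitz[OF u(1) B_component_lip])
  have ai: "integrable (lebesgue_on {0..T}) a"
    unfolding a_def by (intro Bochner_Integration.integrable_sum integrable_mult_right integrable_A_coeff[OF u(2)])
  have zi: "integrable (lebesgue_on {0..T}) z"
    unfolding z_def by (rule integrable_fcoeff_sigma_op[OF u(1) h])
  have rhs: "mode_rhs h u k \<alpha> = (\<lambda>s. b s - a s + z s)"
    by (simp add: mode_rhs_def b_def a_def z_def fun_eq_iff)
  show "integrable (lebesgue_on {0..T}) (mode_rhs h u k \<alpha>)"
    unfolding rhs by (intro Bochner_Integration.integrable_add Bochner_Integration.integrable_diff bi ai zi)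
  assume t: "t \<in> {0..T}"
  have si: "integrable (lebesgue_on {0..t}) f" if "integrable (lebesgue_on {0..T}) f" for f :: "real \<Rightarrow> real"
    by (rule integrable_subinterval[OF that]) (use t in auto)
  have "(\<integral>x. u t x * mode k \<alpha> x \<partial>torus) - (\<integral>x. u0 x * mode k \<alpha> x \<partial>torus)
      - (\<integral>s. (\<integral>x. B (u s x) \<bullet> grad (mode k \<alpha>) x \<partial>torus) \<partial>lebesgue_on {0..t})
    = - (\<integral>s. (\<integral>x. (A (u s x) *v weak_grad (u s) x) \<bullet> grad (mode k \<alpha>) x \<partial>torus) \<partial>lebesgue_on {0..t})
      + (\<integral>s. (\<integral>x. sigma_op e \<sigma> (u s) (h s) x * mode k \<alpha> x \<partial>torus) \<partial>lebesgue_on {0..t})"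
    using sol t mode_smooth_torus[of k \<alpha>] unfolding is_solution_def by blast
  moreover have "(\<integral>s. (\<integral>x. B (u s x) \<bullet> grad (mode k \<alpha>) x \<partial>torus) \<partial>lebesgue_on {0..t}) = integral\<^sup>L (lebesgue_on {0..t}) b"
  proof (rule Bochner_Integration.integral_cong[OF refl])
    fix s assume "s \<in> space (lebesgue_on {0..t})"
    with t have "u s \<in> square_integrable torus" by (intro C_H_square_integrable[OF u(1)]) auto
    then show "(\<integral>x. B (u s x) \<bullet> grad (mode k \<alpha>) x \<partial>torus) = b s"
      unfolding b_def
      by (intro integral_inner_grad_mode lipschitz_compose_square_integrable[OF B_component_lip])
  qed
  moreover have "(\<integral>s. (\<integral>x. (A (u s x) *v weak_grad (u s) x) \<bullet> grad (mode k \<alpha>) x \<partial>torus) \<partial>lebesgue_on {0..t})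
      = integral\<^sup>L (lebesgue_on {0..t}) a"
  proof -
    have eq: "AE s in lebesgue_on {0..t}. a s = (\<integral>x. (A (u s x) *v weak_grad (u s) x) \<bullet> grad (mode k \<alpha>) x \<partial>torus)"
    proof -
      have "AE s in lebesgue_on {0..t}. u s \<in> H1"
        by (rule AE_lebesgue_on_subinterval[OF uH]) (use t in auto)
      then show ?thesis
      proof eventually_elim
        case (elim s)
        show ?case unfolding a_def A_coeff_def
          by (intro integral_inner_grad_mode[symmetric] square_integrable_component A_vec_square_integrable(1)
              square_integrableD(1)[OF H1_square_integrable] weak_grad_square_integrable elim)
      qed
    qed
    have am: "a \<in> borel_measurable (lebesgue_on {0..t})" by (rule borel_measurable_integrable[OF si[OF ai]])
    show ?thesis
    proof (rule integral_cong_AE)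
      show "(\<lambda>s. \<integral>x. (A (u s x) *v weak_grad (u s) x) \<bullet> grad (mode k \<alpha>) x \<partial>torus) \<in> borel_measurable (lebesgue_on {0..t})"
        by (rule borel_measurable_lebesgue_on_AE_limit[where g = "\<lambda>_. a", OF am])
          (use eq in \<open>eventually_elim, simp\<close>)
      show "AE s in lebesgue_on {0..t}. (\<integral>x. (A (u s x) *v weak_grad (u s) x) \<bullet> grad (mode k \<alpha>) x \<partial>torus) = a s"
        using eq by eventually_elim simp
    qed (rule am)
  qed
  moreover have "(\<integral>s. (\<integral>x. sigma_op e \<sigma> (u s) (h s) x * mode k \<alpha> x \<partial>torus) \<partial>lebesgue_on {0..t})
      = integral\<^sup>L (lebesgue_on {0..t}) z"
    by (simp add: z_def[abs_def] fcoeff_def)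
  moreover have "integral\<^sup>L (lebesgue_on {0..t}) (mode_rhs h u k \<alpha>)
      = integral\<^sup>L (lebesgue_on {0..t}) b - integral\<^sup>L (lebesgue_on {0..t}) a + integral\<^sup>L (lebesgue_on {0..t}) z"
    unfolding rhs using si[OF ai] si[OF bi] si[OF zi] by simp
  ultimately show "fcoeff (u t) k \<alpha> = fcoeff u0 k \<alpha> + integral\<^sup>L (lebesgue_on {0..t}) (mode_rhs h u k \<alpha>)"
    unfolding fcoeff_def[of "u t"] fcoeff_def[of u0] by linarith
qed

end

section \<open>Uniqueness\<close>

context coefficients
begin

text \<open>The energy inequality in the limit of vanishing projection error. Only the positive part of
  \<open>J N - b\<close> has to converge, so the pointwise estimate of the limit by \<open>b\<close> is all that enters
  the integral in time.\<close>

lemma L1_diff_integral_inequality: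
  assumes su: "is_solution B A \<sigma> e T u0 h u" and sv: "is_solution B A \<sigma> e T u0 h v"
    and h: "h \<in> square_integrable (lebesgue_on {0..T})" and eps: "0 < \<epsilon>" and t: "t \<in> {0..T}"
  shows "(\<integral>x. \<bar>u t x - v t x\<bar> \<partial>torus) \<le>
    \<epsilon> * (1 + flux_const * (\<integral>s. 1 + (H1_norm (v s))\<^sup>2 \<partial>lebesgue_on {0..t}))
    + (\<integral>s. sqrt C * norm (h s) * (\<integral>x. \<bar>u s x - v s x\<bar> \<partial>torus) \<partial>lebesgue_on {0..t})"
proof -
  let ?I = "lebesgue_on {0..T}" and ?It = "lebesgue_on {0..t}"
  define w where "w s x = u s x - v s x" for s x
  define E where "E s = (\<integral>x. \<bar>w s x\<bar> \<partial>torus)" for s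
  define \<gamma> where "\<gamma> k \<alpha> s = mode_rhs h u k \<alpha> s - mode_rhs h v k \<alpha> s" for k \<alpha> s
  define J where "J N s = (\<Sum>(k, \<alpha>)\<in>modes N. \<gamma> k \<alpha> s * fcoeff (\<lambda>x. sabs' \<epsilon> (trig_proj N (w s) x)) k \<alpha>)" for N s
  define a where "a s = sqrt C * norm (h s)" for s
  define b where "b s = \<epsilon> * flux_const * (1 + (H1_norm (v s))\<^sup>2) + a s * E s" for s
  define H where "H s = H1_norm (u s) + H1_norm (v s)" for s
  define D where "D s = real CARD('d) * ((L + 2 * real CARD('d) * K) * (H s)\<^sup>2 / \<epsilon>)
    + sqrt C * ((norm (h s))\<^sup>2 + (H s)\<^sup>2)" for s
  have u: "u \<in> C_H T" "u \<in> L2_H1 T" and v: "v \<in> C_H T" "v \<in> L2_H1 T"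
    using su sv by (auto simp: is_solution_def)
  have us: "u s \<in> square_integrable torus" and vs: "v s \<in> square_integrable torus" if "s \<in> {0..T}" for s
    using that u(1) v(1) by (auto intro: C_H_square_integrable)
  have ws: "w s \<in> square_integrable torus" if "s \<in> {0..T}" for s
    unfolding w_def[abs_def] by (rule square_integrable_diff[OF us[OF that] vs[OF that]])
  have nu: "(\<lambda>s. H1_norm (u s)) \<in> square_integrable ?I" and nv: "(\<lambda>s. H1_norm (v s)) \<in> square_integrable ?I"
    using u(2) v(2) by (auto simp: L2_H1_def)
  have fm: "finite_measure ?I" by (rule finite_measure_lebesgue_on) auto
  have one: "integrable ?I (\<lambda>_. 1 :: real)" by (rule integrable_Icc_continuous) (rule continuous_on_const)
  have t': "0 \<le> t" "t \<le> T" using t by auto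
  have si: "integrable ?It f" if "integrable ?I f" for f :: "real \<Rightarrow> real"
    by (rule integrable_subinterval[OF that]) (use t in auto)

  have \<gamma>i: "integrable ?I (\<gamma> k \<alpha>)" for k \<alpha>
    unfolding \<gamma>_def[abs_def]
    by (rule Bochner_Integration.integrable_diff[OF solution_mode_equation(1)[OF su h] solution_mode_equation(1)[OF sv h]])
  have co: "fcoeff (w s) k \<alpha> = integral\<^sup>L (lebesgue_on {0..s}) (\<gamma> k \<alpha>)" if s: "s \<in> {0..T}" for s k \<alpha>
  proof -
    have sub: "integrable (lebesgue_on {0..s}) f" if "integrable ?I f" for f :: "real \<Rightarrow> real"
      by (rule integrable_subinterval[OF that]) (use s in auto)
    have "fcoeff (w s) k \<alpha> = fcoeff (u s) k \<alpha> - fcoeff (v s) k \<alpha>"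
      unfolding w_def[abs_def] by (rule fcoeff_diff[OF us[OF s] vs[OF s]])
    also have "\<dots> = integral\<^sup>L (lebesgue_on {0..s}) (mode_rhs h u k \<alpha>) - integral\<^sup>L (lebesgue_on {0..s}) (mode_rhs h v k \<alpha>)"
      using solution_mode_equation(2)[OF su h s, of k \<alpha>] solution_mode_equation(2)[OF sv h s, of k \<alpha>] by simp
    also have "\<dots> = integral\<^sup>L (lebesgue_on {0..s}) (\<gamma> k \<alpha>)"
      unfolding \<gamma>_def[abs_def]
      by (rule Bochner_Integration.integral_diff[symmetric])
        (rule sub[OF solution_mode_equation(1)[OF su h]] sub[OF solution_mode_equation(1)[OF sv h]])+
    finally show ?thesis .
  qed
  have cc: "continuous_on {0..T} (\<lambda>s. fcoeff (w s) k \<alpha>)" for k \<alpha>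
    using indefinite_integral_continuous_real[OF \<gamma>i, of k \<alpha>] by (rule continuous_on_eq) (simp add: co)
  have Ji: "integrable ?I (J N)" for N
    unfolding J_def[abs_def] case_prod_unfold
    by (intro Bochner_Integration.integrable_sum integrable_times_continuous \<gamma>i continuous_on_fcoeff_sabs'[OF eps cc])
  have Ec: "continuous_on {0..T} E" unfolding E_def w_def by (rule continuous_on_L1_diff[OF u(1) v(1)])
  have ai: "integrable ?I a"
    unfolding a_def using integrable_if_square_integrable[OF fm square_integrable_norm[OF h]] by simp
  have bv: "integrable ?I (\<lambda>s. 1 + (H1_norm (v s))\<^sup>2)"
    using one square_integrable_realD[OF nv] by simp
  have aE: "integrable ?I (\<lambda>s. a s * E s)" by (rule integrable_times_continuous[OF ai Ec])
  have bi: "integrable ?I b" unfolding b_def[abs_def] using bv aE by simp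
  have Hs: "H \<in> square_integrable ?I" unfolding H_def[abs_def] by (rule square_integrable_add[OF nu nv])
  have Di: "integrable ?I D"
    unfolding D_def[abs_def] using square_integrable_realD[OF Hs] square_integrableD(2)[OF h] by simp

  \<comment> \<open>\<open>D\<close> dominates the projected energy balances, and \<open>b\<close> bounds their limit.\<close>
  have good: "AE s in ?I. (\<forall>N. \<bar>J N s\<bar> \<le> D s) \<and> (\<lambda>N. max (J N s - b s) 0) \<longlonglongrightarrow> 0"
  proof -
    have "AE s in ?I. u s \<in> H1" "AE s in ?I. v s \<in> H1" using u(2) v(2) by (auto simp: L2_H1_def)
    then show ?thesis using AE_space
    proof eventually_elim
      case (elim s)
      have s: "s \<in> {0..T}" using elim(3) by simp
      let ?f = "\<lambda>x. sigma_op e \<sigma> (u s) (h s) x - sigma_op e \<sigma> (v s) (h s) x"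
      note us = us[OF s] and vs = vs[OF s]
      have fs: "?f \<in> square_integrable torus"
        by (intro square_integrable_diff sigma_op_square_integrable us vs)
      interpret P: solution_pair B A \<sigma> e L K \<delta> C "u s" "v s" ?f "weak_grad (u s)" "weak_grad (v s)" "a s"
        by unfold_locales
          (use elim sigma_op_diff_le square_integrableD(1)[OF fs] in
            \<open>auto simp: a_def intro: H1_square_integrable is_weak_grad_weak_grad\<close>)
      have Pw: "P.w = w s" by (simp add: P.w_def w_def fun_eq_iff)
      have eqJ: "J N s = P.J \<epsilon> N" for N
      proof -
        have "\<gamma> k \<alpha> s = (\<Sum>i\<in>UNIV. wave_number k i * fcoeff (\<lambda>x. P.F x $ i) k (\<alpha> + pi / 2)) + fcoeff ?f k \<alpha>" for k \<alpha>
        proof -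
          have B1: "(\<lambda>x. B (u s x) $ i) \<in> square_integrable torus" and B2: "(\<lambda>x. B (v s x) $ i) \<in> square_integrable torus" for i
            by (rule lipschitz_compose_square_integrable[OF B_component_lip us]
                lipschitz_compose_square_integrable[OF B_component_lip vs])+
          have A1: "(\<lambda>x. (A (u s x) *v weak_grad (u s) x) $ i) \<in> square_integrable torus"
            and A2: "(\<lambda>x. (A (v s x) *v weak_grad (v s) x) $ i) \<in> square_integrable torus" for i
            by (intro square_integrable_component A_vec_square_integrable(1)
                square_integrableD(1) us vs weak_grad_square_integrable elim)+
          have "fcoeff (\<lambda>x. P.F x $ i) k \<beta> = (fcoeff (\<lambda>x. B (u s x) $ i) k \<beta> - A_coeff k \<beta> i (u s))
              - (fcoeff (\<lambda>x. B (v s x) $ i) k \<beta> - A_coeff k \<beta> i (v s))" for i \<beta>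
            unfolding P.F_def flux_def A_coeff_def vector_minus_component
            by (simp only: fcoeff_diff B1 B2 A1 A2 square_integrable_diff)
          moreover have "fcoeff ?f k \<alpha> = fcoeff (sigma_op e \<sigma> (u s) (h s)) k \<alpha> - fcoeff (sigma_op e \<sigma> (v s) (h s)) k \<alpha>"
            by (rule fcoeff_diff) (intro sigma_op_square_integrable us vs)+
          ultimately show ?thesis
            unfolding \<gamma>_def mode_rhs_def by (simp add: right_diff_distrib sum_subtractf)
        qed
        then show ?thesis unfolding J_def P.J_def Pw by simp
      qed
      have Hn: "L2_norm torus (weak_grad (u s)) + L2_norm torus (weak_grad (v s)) \<le> H s"
        unfolding H_def by (intro add_mono L2_norm_weak_grad_le_H1_norm)
      have Hw: "L2_norm torus P.w \<le> H s"
        unfolding H_def by (rule order_trans[OF P.w_le]) (intro add_mono L2_norm_le_H1_norm)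
      have H0: "0 \<le> H s" by (simp add: H_def)
      have "L2_norm torus P.F \<le> (L + 2 * real CARD('d) * K) * H s"
      proof -
        have "L2_norm torus P.F \<le> L * L2_norm torus P.w + real CARD('d) * K * L2_norm torus (weak_grad (u s))
            + real CARD('d) * K * L2_norm torus (weak_grad (v s))" by (rule P.F_norm_le)
        also have "\<dots> = L * L2_norm torus P.w + real CARD('d) * K * (L2_norm torus (weak_grad (u s)) + L2_norm torus (weak_grad (v s)))"
          by (simp add: distrib_left)
        also have "\<dots> \<le> L * H s + real CARD('d) * K * H s"
          using L_nonneg K_nonneg by (intro add_mono mult_left_mono Hw Hn) auto
        also have "\<dots> \<le> (L + 2 * real CARD('d) * K) * H s"
          using H0 K_nonneg by (simp add: distrib_right)
        finally show ?thesis .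
      qed
      then have "L2_norm torus P.F * (L2_norm torus (weak_grad (u s)) + L2_norm torus (weak_grad (v s)))
          \<le> (L + 2 * real CARD('d) * K) * H s * H s"
        using H0 L_nonneg K_nonneg by (intro mult_mono Hn) auto
      then have D1: "real CARD('d) * (L2_norm torus P.F * (L2_norm torus (weak_grad (u s)) + L2_norm torus (weak_grad (v s))) / \<epsilon>)
          \<le> real CARD('d) * ((L + 2 * real CARD('d) * K) * (H s)\<^sup>2 / \<epsilon>)"
        using eps by (intro mult_left_mono divide_right_mono) (simp_all add: power2_eq_square mult.assoc)
      have D2: "L2_norm torus ?f \<le> sqrt C * ((norm (h s))\<^sup>2 + (H s)\<^sup>2)"
      proof -
        have "L2_norm torus ?f \<le> sqrt C * norm (h s) * L2_norm torus P.w"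
          using P.f_norm_le C_nonneg by (simp add: a_def abs_mult)
        also have "\<dots> \<le> sqrt C * norm (h s) * H s"
          using C_nonneg by (intro mult_left_mono Hw) simp
        also have "\<dots> = sqrt C * (norm (h s) * H s)" by simp
        also have "\<dots> \<le> sqrt C * ((norm (h s))\<^sup>2 + (H s)\<^sup>2)"
        proof (rule mult_left_mono)
          have "norm (h s) * H s \<le> 2 * norm (h s) * H s" using H0 by simp
          also have "\<dots> \<le> (norm (h s))\<^sup>2 + (H s)\<^sup>2" by (rule sum_squares_bound)
          finally show "norm (h s) * H s \<le> (norm (h s))\<^sup>2 + (H s)\<^sup>2" .
        qed (use C_nonneg in simp)
        finally show ?thesis .
      qed
      have "\<bar>J N s\<bar> \<le> D s" for N
        unfolding eqJ D_def by (rule order_trans[OF P.abs_J_le[OF eps] add_mono[OF D1 D2]])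
      moreover have "(\<lambda>N. max (J N s - b s) 0) \<longlonglongrightarrow> 0"
      proof -
        define l where "l = (\<integral>x. (P.F x \<bullet> (weak_grad (u s) x - weak_grad (v s) x)) * sabs'' \<epsilon> (P.w x) \<partial>torus)
            + (\<integral>x. ?f x * sabs' \<epsilon> (P.w x) \<partial>torus)"
        have "(\<lambda>N. J N s) \<longlonglongrightarrow> l" unfolding eqJ l_def by (rule P.J_limit[OF eps])
        then have "(\<lambda>N. max (J N s - b s) 0) \<longlonglongrightarrow> max (l - b s) 0" by (intro tendsto_intros)
        moreover have "l \<le> b s"
        proof -
          have "l \<le> \<epsilon> * flux_const * (1 + (L2_norm torus (weak_grad (v s)))\<^sup>2) + a s * E s"
            using P.J_limit_le[OF eps] unfolding l_def Pw E_def .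
          also have "\<dots> \<le> b s"
            unfolding b_def using eps flux_const_nonneg L2_norm_weak_grad_le_H1_norm[of "v s"]
            by (intro add_right_mono mult_left_mono add_left_mono power_mono) auto
          finally show ?thesis .
        qed
        ultimately show ?thesis by simp
      qed
      ultimately show ?case by blast
    qed
  qed

  define X where "X N = (\<integral>s. max (J N s - b s) 0 \<partial>?It)" for N
  have b0: "0 \<le> b s" for s
  proof -
    have "0 \<le> a s" "0 \<le> E s" using C_nonneg by (auto simp: a_def E_def)
    then show ?thesis unfolding b_def using eps flux_const_nonneg
      by (intro add_nonneg_nonneg mult_nonneg_nonneg) auto
  qed
  have mi: "integrable ?It (\<lambda>s. max (J N s - b s) 0)" for N
    using si[OF Ji] si[OF bi] by (intro Bochner_Integration.integrable_max) auto
  have X: "X \<longlonglongrightarrow> 0"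
  proof -
    have goodt: "AE s in ?It. (\<forall>N. \<bar>J N s\<bar> \<le> D s) \<and> (\<lambda>N. max (J N s - b s) 0) \<longlonglongrightarrow> 0"
      by (rule AE_lebesgue_on_subinterval[OF good]) (use t in auto)
    have "X \<longlonglongrightarrow> (\<integral>s. 0 \<partial>?It)"
      unfolding X_def[abs_def]
    proof (rule integral_dominated_convergence[where w = D])
      show "integrable ?It D" by (rule si[OF Di])
      show "AE s in ?It. (\<lambda>N. max (J N s - b s) 0) \<longlonglongrightarrow> 0"
        using goodt by eventually_elim simp
      show "AE s in ?It. norm (max (J N s - b s) 0) \<le> D s" for N
        using goodt
      proof eventually_elim
        case (elim s)
        then have "\<bar>J N s\<bar> \<le> D s" by blast
        with b0[of s] show ?case unfolding max_def real_norm_def by (auto simp: abs_le_iff)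
      qed
      show "(\<lambda>s. max (J N s - b s) 0) \<in> borel_measurable ?It" for N
        by (rule borel_measurable_integrable[OF mi])
    qed simp
    then show ?thesis by simp
  qed
  have wt: "w t \<in> square_integrable torus" by (rule ws[OF t])
  \<comment> \<open>\<open>\<bar>w\<bar>\<close> is at most the projection error plus \<open>sabs\<close> of the projection.\<close>
  have est: "E t \<le> L2_norm torus (\<lambda>x. trig_proj N (w t) x - w t x) + \<epsilon> + integral\<^sup>L ?It b + X N" for N
  proof -
    have d: "(\<lambda>x. trig_proj N (w t) x - w t x) \<in> square_integrable torus"
      by (rule square_integrable_diff[OF square_integrable_trig_proj wt])
    note di = integral_abs_le_L2_norm_torus[OF d]
    have Si: "integrable torus (\<lambda>x. sabs \<epsilon> (trig_proj N (w t) x))"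
      by (intro integrable_torus_continuous
          continuous_on_compose2[OF lipschitz_on_continuous_on[OF lipschitz_sabs[OF eps]] continuous_trig_proj]) simp
    have "E t \<le> (\<integral>x. \<bar>trig_proj N (w t) x - w t x\<bar> + sabs \<epsilon> (trig_proj N (w t) x) \<partial>torus)"
      unfolding E_def
    proof (rule integral_mono)
      show "integrable torus (\<lambda>x. \<bar>w t x\<bar>)"
        by (rule integral_abs_le_L2_norm_torus(1)[OF wt])
      show "integrable torus (\<lambda>x. \<bar>trig_proj N (w t) x - w t x\<bar> + sabs \<epsilon> (trig_proj N (w t) x))"
        by (rule Bochner_Integration.integrable_add[OF di(1) Si])
      show "\<bar>w t x\<bar> \<le> \<bar>trig_proj N (w t) x - w t x\<bar> + sabs \<epsilon> (trig_proj N (w t) x)" for x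
        using abs_le_sabs[OF eps, of "trig_proj N (w t) x"] by linarith
    qed
    also have "\<dots> = (\<integral>x. \<bar>trig_proj N (w t) x - w t x\<bar> \<partial>torus) + (\<integral>x. sabs \<epsilon> (trig_proj N (w t) x) \<partial>torus)"
      by (rule Bochner_Integration.integral_add[OF di(1) Si])
    also have "\<dots> \<le> L2_norm torus (\<lambda>x. trig_proj N (w t) x - w t x) + (\<epsilon> + integral\<^sup>L ?It (J N))"
    proof (rule add_mono[OF di(2)])
      show "(\<integral>x. sabs \<epsilon> (trig_proj N (w t) x) \<partial>torus) \<le> \<epsilon> + integral\<^sup>L ?It (J N)"
        unfolding J_def[abs_def] by (rule energy_inequality[OF eps ws \<gamma>i co t'])
    qed
    also have "integral\<^sup>L ?It (J N) \<le> (\<integral>s. b s + max (J N s - b s) 0 \<partial>?It)"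
      by (rule integral_mono) (use si[OF Ji] Bochner_Integration.integrable_add[OF si[OF bi] mi] in auto)
    also have "\<dots> = integral\<^sup>L ?It b + X N"
      unfolding X_def by (rule Bochner_Integration.integral_add[OF si[OF bi] mi])
    finally show ?thesis by simp
  qed
  have "(\<lambda>N. L2_norm torus (\<lambda>x. trig_proj N (w t) x - w t x) + \<epsilon> + integral\<^sup>L ?It b + X N)
      \<longlonglongrightarrow> 0 + \<epsilon> + integral\<^sup>L ?It b + 0"
    by (intro tendsto_add tendsto_const trig_proj_tendsto[OF wt] X)
  then have "E t \<le> 0 + \<epsilon> + integral\<^sup>L ?It b + 0"
    by (rule LIMSEQ_le_const) (use est in blast)
  also have "integral\<^sup>L ?It b = \<epsilon> * flux_const * (\<integral>s. 1 + (H1_norm (v s))\<^sup>2 \<partial>?It) + (\<integral>s. a s * E s \<partial>?It)"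
    unfolding b_def[abs_def]
    by (subst Bochner_Integration.integral_add) (use si[OF bv] si[OF aE] in simp_all)
  finally show ?thesis
    unfolding E_def w_def a_def by (simp add: distrib_left mult.assoc)
qed

text \<open>As \<open>\<epsilon>\<close> tends to zero, only the noise term remains, and Gronwall's lemma applies.\<close>

theorem solution_unique:
  assumes su: "is_solution B A \<sigma> e T u0 h u" and sv: "is_solution B A \<sigma> e T u0 h v"
    and h: "h \<in> square_integrable (lebesgue_on {0..T})" and t: "t \<in> {0..T}"
  shows "AE x in torus. u t x = v t x"
proof -
  define E where "E s = (\<integral>x. \<bar>u s x - v s x\<bar> \<partial>torus)" for s
  have u: "u \<in> C_H T" and v: "v \<in> C_H T" using su sv by (auto simp: is_solution_def)
  have fm: "finite_measure (lebesgue_on {0..T})" by (rule finite_measure_lebesgue_on) auto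
  have "E t = 0"
  proof (rule gronwall_zero[where E = E and T = T and t = t and a = "\<lambda>s. sqrt C * norm (h s)"])
    show "continuous_on {0..T} E" unfolding E_def by (rule continuous_on_L1_diff[OF u v])
    show "integrable (lebesgue_on {0..T}) (\<lambda>s. sqrt C * norm (h s))"
      using integrable_if_square_integrable[OF fm square_integrable_norm[OF h]] by simp
    show "0 \<le> sqrt C * norm (h s)" for s using C_nonneg by simp
    show "0 \<le> E s" if "s \<in> {0..T}" for s by (simp add: E_def)
    show "0 \<le> t" "t \<le> T" using t by auto
    fix s assume s: "s \<in> {0..T}"
    define M where "M = 1 + flux_const * (\<integral>r. 1 + (H1_norm (v r))\<^sup>2 \<partial>lebesgue_on {0..s})"
    define G where "G = (\<integral>r. sqrt C * norm (h r) * E r \<partial>lebesgue_on {0..s})"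
    have M: "0 < M"
      unfolding M_def using flux_const_nonneg
      by (intro add_pos_nonneg mult_nonneg_nonneg Bochner_Integration.integral_nonneg) (auto simp: add_nonneg_nonneg)
    have "E s \<le> G"
    proof (rule field_le_epsilon)
      fix \<eta> :: real assume "0 < \<eta>"
      with M have "0 < \<eta> / M" by simp
      from L1_diff_integral_inequality[OF su sv h this s]
      have "E s \<le> \<eta> / M * M + G" unfolding E_def M_def G_def .
      with M show "E s \<le> G + \<eta>" by simp
    qed
    then show "E s \<le> (\<integral>r. sqrt C * norm (h r) * E r \<partial>lebesgue_on {0..s})" by (simp add: G_def)
  qed
  moreover have "integrable torus (\<lambda>x. \<bar>u t x - v t x\<bar>)"
    by (intro integral_abs_le_L2_norm_torus(1) square_integrable_diff
        C_H_square_integrable[OF u t] C_H_square_integrable[OF v t])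
  ultimately have "AE x in torus. \<bar>u t x - v t x\<bar> = 0"
    unfolding E_def by (subst (asm) integral_nonneg_eq_0_iff_AE) auto
  then show ?thesis by simp
qed

end

theorem theorem4p1:
  fixes T :: real
    and e :: "nat \<Rightarrow> 'u::{real_inner, polish_space}"
    and B :: "real \<Rightarrow> real ^ 'd"
    and A :: "real \<Rightarrow> real ^ 'd ^ 'd"
    and \<sigma> :: "nat \<Rightarrow> real \<Rightarrow> real"
    and u0 :: "real ^ 'd \<Rightarrow> real"
  assumes "T > 0"
    and "orthonormal_basis e"
    and "hypothesis_H B A \<sigma>"
    and "u0 \<in> square_integrable torus"
  shows "\<forall>h \<in> square_integrable (lebesgue_on {0..T}). \<forall>u v.
           is_solution B A \<sigma> e T u0 h u \<and> is_solution B A \<sigma> e T u0 h v \<longrightarrow>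
           (\<forall>t\<in>{0..T}. AE x in torus. u t x = v t x)"
proof -
  obtain L K \<delta> C where "coefficients B A \<sigma> e L K \<delta> C"
    using hypothesis_H_coefficients[OF assms(3,2)] .
  then interpret coefficients B A \<sigma> e L K \<delta> C .
  show ?thesis using solution_unique by blast
qed

end
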